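(* Let $m\geqslant 22$ be an integer and let $G$ be a graph with exactly $m$ edges, no isolated vertices, containing no subgraph isomorphic to the cycle $C_6$, and with $G\not\cong S_{\frac{m+3}{2},2}$. Let $\rho_2(m)$ be the largest real zero of $\psi_2(x)$, where $\psi_2(x)=x^3-2x^2-(m-3)x+m-6$ if $m$ is even and $22\leqslant m\leqslant 72$; $\psi_2(x)=x^4-mx^2-(m-2)x+\frac{m}{2}-1$ if $m$ is even and $m\geqslant 74$; $\psi_2(x)=x^5-x^4-(m-1)x^3-2x^2+\frac{3m-17}{2}x-\frac{m-7}{2}$ if $m$ is odd and $23\leqslant m\leqslant 71$; $\psi_2(x)=x^4-mx^2-(m-3)x+m-3$ if $m$ is odd and $m\geqslant 73$. Then $\lambda(G)\leqslant \rho_2(m)$, with equality if and only if $G\cong K_1\vee S^1_{\frac{m}{2}}$ (when $m$ is even and $22\leqslant m\leqslant 72$), $G\cong S^1_{\frac{m+4}{2},2}$ (when $m$ is even and $m\geqslant 74$), $G\cong K_1\vee (S^1_{\frac{m-1}{2}}\cup K_1)$ (when $m$ is odd and $23\leqslant m\leqslant 71$), and $G\cong S^2_{\frac{m+5}{2},2}$ (when $m$ is odd and $m\geqslant 73$).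
   Context: All graphs are finite and simple; $\lambda(G)$ denotes the largest eigenvalue (spectral radius) of the adjacency matrix of $G$. For graphs $G,H$, the join $G\vee H$ is obtained from $G\cup H$ by adding all edges between $V(G)$ and $V(H)$. $S_{n,k}:=K_k\vee (n-k)K_1$ is the complete split graph (the excluded graph $S_{\frac{m+3}{2},2}$ exists only when $m$ is odd). $S^t_{n,k}$ denotes the graph obtained from $S_{n-t,k}$ by attaching $t$ pendant vertices to a vertex of maximum degree of $S_{n-t,k}$. $S_n^k$ denotes the graph obtained from the star $K_{1,n-1}$ by adding $k$ pairwise disjoint edges among its $n-1$ leaves. *)

theory Defs
  imports
    "Graph_Theory.Pair_Digraph"
    "Graph_Theory.Digraph_Component"
    "Graph_Theory.Digraph_Isomorphism"
    "Jordan_Normal_Form.Spectral_Radius"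
begin

text \<open>
  A finite simple graph is a \<^locale>\<open>pair_graph\<close>: a finite vertex set with a symmetric,
  irreflexive set of ordered pairs of vertices. An undirected edge corresponds to two arcs.
\<close>

definition edges :: "'a pair_pre_digraph \<Rightarrow> 'a set set" where
  "edges G = {{u, v} | u v. (u, v) \<in> parcs G}"

definition isolated :: "'a pair_pre_digraph \<Rightarrow> 'a \<Rightarrow> bool" where
  "isolated G v \<longleftrightarrow> v \<in> pverts G \<and> (\<forall>w. (v, w) \<notin> parcs G)"

definition graph_iso :: "'a pair_pre_digraph \<Rightarrow> 'b pair_pre_digraph \<Rightarrow> bool" (infix \<open>\<simeq>\<^sub>g\<close> 50) where
  "G \<simeq>\<^sub>g H \<longleftrightarrow> digraph_iso (with_proj G) (with_proj H)"

text \<open>Subgraphs are not required to be induced.\<close>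

definition contains_subgraph :: "'a pair_pre_digraph \<Rightarrow> 'b pair_pre_digraph \<Rightarrow> bool" where
  "contains_subgraph G F \<longleftrightarrow>
     (\<exists>H :: 'a pair_pre_digraph. subgraph (with_proj H) (with_proj G) \<and> H \<simeq>\<^sub>g F)"


text \<open>
  The spectrum of the adjacency matrix does not depend on the enumeration \<open>vs\<close> of the vertices,
  so for a finite graph any enumeration may be chosen. As the matrix is real symmetric, all its
  eigenvalues are real.
\<close>

definition adj_mat :: "'a pair_pre_digraph \<Rightarrow> 'a list \<Rightarrow> real mat" where
  "adj_mat G vs =
     mat (length vs) (length vs) (\<lambda>(i, j). if (vs ! i, vs ! j) \<in> parcs G then 1 else 0)"

definition lambda_max :: "'a pair_pre_digraph \<Rightarrow> real" where
  "lambda_max G = Max (spectrum (adj_mat G (SOME vs. distinct vs \<and> set vs = pverts G)))"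


definition edgeless :: "nat \<Rightarrow> nat pair_pre_digraph" where
  "edgeless n = \<lparr>pverts = {..<n}, parcs = {}\<rparr>"

definition complete_graph :: "nat \<Rightarrow> nat pair_pre_digraph" where
  "complete_graph n = \<lparr>pverts = {..<n}, parcs = {(i, j). i < n \<and> j < n \<and> i \<noteq> j}\<rparr>"

text \<open>This is a cycle for \<open>n \<ge> 3\<close>.\<close>

definition cycle_graph :: "nat \<Rightarrow> nat pair_pre_digraph" where
  "cycle_graph n = \<lparr>pverts = {..<n},
     parcs = {(i, j). i < n \<and> j < n \<and> (j = (i + 1) mod n \<or> i = (j + 1) mod n)}\<rparr>"

definition disj_union ::
  "'a pair_pre_digraph \<Rightarrow> 'b pair_pre_digraph \<Rightarrow> ('a + 'b) pair_pre_digraph" where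
  "disj_union G H = \<lparr>pverts = pverts G <+> pverts H,
     parcs = map_prod Inl Inl ` parcs G \<union> map_prod Inr Inr ` parcs H\<rparr>"

definition join_graph ::
  "'a pair_pre_digraph \<Rightarrow> 'b pair_pre_digraph \<Rightarrow> ('a + 'b) pair_pre_digraph" where
  "join_graph G H = \<lparr>pverts = pverts (disj_union G H),
     parcs = parcs (disj_union G H)
       \<union> (Inl ` pverts G) \<times> (Inr ` pverts H) \<union> (Inr ` pverts H) \<times> (Inl ` pverts G)\<rparr>"

definition attach_pendants ::
  "nat \<Rightarrow> 'a \<Rightarrow> 'a pair_pre_digraph \<Rightarrow> ('a + nat) pair_pre_digraph" where
  "attach_pendants t v G = \<lparr>pverts = pverts G <+> {..<t},
     parcs = map_prod Inl Inl ` parcs G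
       \<union> {Inl v} \<times> (Inr ` {..<t}) \<union> (Inr ` {..<t}) \<times> {Inl v}\<rparr>"

text \<open>
  In a symmetric digraph the out-degree of a vertex is the degree of the underlying graph.
\<close>

definition max_degree_vertex :: "'a pair_pre_digraph \<Rightarrow> 'a" where
  "max_degree_vertex G = arg_max_on (out_degree (with_proj G)) (pverts G)"

text \<open>\<open>split_graph n k\<close> is $S_{n,k}$ (for \<open>k \<le> n\<close>).\<close>

definition split_graph :: "nat \<Rightarrow> nat \<Rightarrow> (nat + nat) pair_pre_digraph" where
  "split_graph n k = join_graph (complete_graph k) (edgeless (n - k))"

text \<open>\<open>split_graph_pendant t n k\<close> is $S^t_{n,k}$ (for \<open>k + t \<le> n\<close>); it has \<open>n\<close> vertices in total.\<close>

definition split_graph_pendant :: "nat \<Rightarrow> nat \<Rightarrow> nat \<Rightarrow> ((nat + nat) + nat) pair_pre_digraph" where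
  "split_graph_pendant t n k =
     attach_pendants t (max_degree_vertex (split_graph (n - t) k)) (split_graph (n - t) k)"

definition star_graph :: "nat \<Rightarrow> (nat + nat) pair_pre_digraph" where
  "star_graph n = join_graph (complete_graph 1) (edgeless (n - 1))"

text \<open>
  \<open>star_matching n k\<close> is $S_n^k$ (for \<open>2 * k \<le> n - 1\<close>): the leaves of the star
  on \<open>n\<close> vertices are \<open>Inr i\<close> with \<open>i < n - 1\<close>, and the \<open>k\<close> added edges join
  \<open>Inr (2 * i)\<close> to \<open>Inr (2 * i + 1)\<close> for \<open>i < k\<close>.
\<close>

definition star_matching :: "nat \<Rightarrow> nat \<Rightarrow> (nat + nat) pair_pre_digraph" where
  "star_matching n k = \<lparr>pverts = pverts (star_graph n),
     parcs = parcs (star_graph n)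
       \<union> {(Inr (2 * i), Inr (2 * i + 1)) | i. i < k}
       \<union> {(Inr (2 * i + 1), Inr (2 * i)) | i. i < k}\<rparr>"


definition psi2 :: "nat \<Rightarrow> real \<Rightarrow> real" where
  "psi2 m x =
     (if even m then
        if m \<le> 72 then x ^ 3 - 2 * x ^ 2 - (real m - 3) * x + real m - 6
        else x ^ 4 - real m * x ^ 2 - (real m - 2) * x + real m / 2 - 1
      else
        if m \<le> 71 then x ^ 5 - x ^ 4 - (real m - 1) * x ^ 3 - 2 * x ^ 2
                          + (3 * real m - 17) / 2 * x - (real m - 7) / 2
        else x ^ 4 - real m * x ^ 2 - (real m - 3) * x + real m - 3)"

definition rho2 :: "nat \<Rightarrow> real" where
  "rho2 m = Max {x. psi2 m x = 0}"

end

theory Submission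
  imports Defs "HOL-Analysis.Function_Topology"
begin

text \<open>
  Let \<open>x\<close> be a Perron vector of \<open>G\<close> with maximal entry \<open>x u = 1\<close>, let \<open>N\<close> be the neighbourhood
  of \<open>u\<close> and \<open>W\<close> the set of the remaining vertices. Expanding \<open>\<lambda>\<^sup>2 - \<lambda>\<close> at \<open>u\<close> and subtracting the
  number \<open>m\<close> of edges yields \<open>\<lambda>\<^sup>2 - \<lambda> - m = \<Sum>\<^sub>N g - \<Sum>\<^sub>W p\<close> with vertex weights
  \<open>g v = (d\<^sub>N(v) - 1) x\<^sub>v - d\<^sub>N(v)/2\<close> and \<open>p w = d\<^sub>N(w) (1 - x\<^sub>w) + d\<^sub>W(w)/2 \<ge> 0\<close>.
  If \<open>\<lambda> \<ge> \<rho>\<^sub>2(m)\<close>, then \<open>\<lambda> > 5\<close> and the right-hand side exceeds \<open>-2\<close>.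

  As \<open>G\<close> has no hexagon, \<open>G[N]\<close> has no path on five vertices, so each of its components is a single
  vertex, has exactly four vertices, is a triangle with pendant vertices at one corner, or is a star
  or a double star. Charging the weights \<open>p\<close> of the attached vertices of \<open>W\<close> to the components, a
  component on a 4-cycle contributes at most \<open>-2\<close> and every other nontrivial component at most \<open>-1\<close>.
  Hence exactly one component is nontrivial, and it is a triangle with pendant vertices or a
  (double) star. In both cases the eigenvalue equations can be solved explicitly: they force \<open>W\<close> to
  be empty, and comparing with \<open>\<psi>\<^sub>2(\<lambda>) \<ge> 0\<close> leaves only the extremal graph and the excluded graph
  \<open>S\<^bsub>(m+3)/2,2\<^esub>\<close>.
\<close>

section \<open>The weight identity at a vertex of maximal Perron weight\<close>

text \<open>The natural scale is \<open>d = l^2 - l - m + 2\<close>, called \<open>gap\<close>. It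
  is 1 for the excluded graph. Where it is 0, \<open>psi2\<close> is still negative, so
  \<open>l \<ge> rho2 m\<close> forces \<open>d > 0\<close>. The bound \<open>m \<ge> 22\<close>
  enters as 5^2 - 5 = 22 - 2, that is, as \<open>l > 5\<close>; and 5 is just enough to make a
  component K_4 cost 2. The ranges of \<open>m\<close> come from a competition near
  \<open>l = 9\<close>. For even \<open>m\<close> the triangle with pendant vertices has
  \<open>d = 4 / (l - 1)\<close>, and the star with one further vertex pendant at \<open>u\<close>
  has \<open>d\<close> slightly above 1/2; the values meet near \<open>l = 9\<close>, where
  \<open>m = l^2 - l + 2 - d\<close> is about 73.5. For odd \<open>m\<close> the competitors have
  \<open>d\<close> about (9 - l) / (2 (l - 1)) and about 1 / (l (l + 1)), which meet a little below
  9. Two obstacles shape the proof. The graph need not be connected, so the Perron vector may vanish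
  away from \<open>u\<close> and only \<open>0 \<le> x v \<le> 1\<close> is available. And a vertex
  of \<open>W\<close> not only costs \<open>p\<close>, it also raises entries in \<open>N\<close>;
  the cost has to be shown to outweigh this gain before \<open>W\<close> can be proved
  empty.\<close>

locale hexfree =
  fixes V :: "'a set" and E :: "'a \<Rightarrow> 'a \<Rightarrow> bool"
  assumes finite_V: "finite V"
    and E_in: "E v w \<Longrightarrow> v \<in> V"
    and E_sym: "E v w \<Longrightarrow> E w v"
    and E_irrefl: "\<not> E v v"
    and no_hexagon: "distinct [a, b, c, d, e, f] \<Longrightarrow> E a b \<Longrightarrow> E b c \<Longrightarrow> E c d \<Longrightarrow> E d e \<Longrightarrow> E e f
      \<Longrightarrow> E f a \<Longrightarrow> False"
begin

lemma E_in2: "E v w \<Longrightarrow> w \<in> V"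
  using E_in E_sym by blast

lemma E_commute: "E v w \<longleftrightarrow> E w v"
  using E_sym by blast

end

locale perron = hexfree +
  fixes x :: "'a \<Rightarrow> real" and l :: real and u :: 'a and m :: nat
  assumes x_nonneg: "v \<in> V \<Longrightarrow> 0 \<le> x v"
    and x_le1: "v \<in> V \<Longrightarrow> x v \<le> 1"
    and u_in: "u \<in> V" and xu: "x u = 1"
    and eig: "v \<in> V \<Longrightarrow> l * x v = (\<Sum>w | E v w. x w)"
    and no_isolated: "v \<in> V \<Longrightarrow> \<exists>w. E v w"
    and edge_count: "2 * m = (\<Sum>v\<in>V. card {w. E v w})"
    and l_gt5: "l > 5"
    and l_big: "l^2 - l > real m - 2"
begin

text \<open>
  \<open>AN\<close> and \<open>AW\<close> are the parts of a neighbourhood in \<open>N\<close> and in \<open>W\<close>, and \<open>dN\<close> and \<open>dW\<close> their sizes;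
  \<open>W\<close> includes all vertices of other connected components.
\<close>

definition N where "N = {v. E u v}"
definition W where "W = V - insert u N"
definition AN where "AN v = {w. E v w \<and> w \<in> N}"
definition AW where "AW v = {w. E v w \<and> w \<in> W}"
definition dN where "dN v = real (card (AN v))"
definition dW where "dW v = real (card (AW v))"
definition g where "g v = (dN v - 1) * x v - dN v / 2"
definition p where "p w = dN w * (1 - x w) + dW w / 2"
definition gap where "gap = l^2 - l - real m + 2"

lemma gap_pos: "gap > 0" using l_big by (simp add: gap_def)

lemma N_V: "N \<subseteq> V" and W_V: "W \<subseteq> V" and u_N: "u \<notin> N" and u_W: "u \<notin> W" and NW: "N \<inter> W = {}"
  using E_in2 E_irrefl by (auto simp: N_def W_def)

lemma V_eq: "V = insert u (N \<union> W)"
  using N_V u_in by (auto simp: W_def)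

lemma finN: "finite N" and finW: "finite W"
  using finite_V N_V W_V finite_subset by auto

lemma finAN: "finite (AN v)" and finAW: "finite (AW v)"
  using finN finW by (auto simp: AN_def AW_def)

lemma nb_N: "v \<in> N \<Longrightarrow> {w. E v w} = insert u (AN v \<union> AW v)"
  using E_in2 E_sym by (auto simp: AN_def AW_def N_def W_def)

lemma nb_W: "w \<in> W \<Longrightarrow> {v. E w v} = AN w \<union> AW w"
  using E_in2 E_sym by (auto simp: AN_def AW_def W_def N_def)

lemma AN_AW: "AN v \<inter> AW v = {}" "u \<notin> AN v" "u \<notin> AW v"
  using NW u_N u_W by (auto simp: AN_def AW_def)

lemma eig_u: "l = (\<Sum>v\<in>N. x v)"
  using eig[OF u_in] by (simp add: xu N_def)

lemma eig_N: "v \<in> N \<Longrightarrow> l * x v = 1 + (\<Sum>w\<in>AN v. x w) + (\<Sum>w\<in>AW v. x w)"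
  using eig[of v] N_V AN_AW[of v] finAN[of v] finAW[of v] by (auto simp: nb_N xu sum.union_disjoint)

lemma eig_W: "w \<in> W \<Longrightarrow> l * x w = (\<Sum>v\<in>AN w. x v) + (\<Sum>v\<in>AW w. x v)"
  using eig[of w] W_V AN_AW[of w] finAN[of w] finAW[of w] by (auto simp: nb_W sum.union_disjoint)

lemma deg_N: "v \<in> N \<Longrightarrow> real (card {w. E v w}) = 1 + dN v + dW v"
  using AN_AW[of v] finAN[of v] finAW[of v] by (simp add: nb_N dN_def dW_def card_Un_disjoint)

lemma deg_W: "v \<in> W \<Longrightarrow> real (card {w. E v w}) = dN v + dW v"
  using AN_AW[of v] finAN[of v] finAW[of v] by (simp add: nb_W dN_def dW_def card_Un_disjoint)

lemma dN_nonneg: "dN v \<ge> 0" and dW_nonneg: "dW v \<ge> 0"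
  by (auto simp: dN_def dW_def)

lemma x01: "v \<in> N \<Longrightarrow> 0 \<le> x v" "v \<in> N \<Longrightarrow> x v \<le> 1" "w \<in> W \<Longrightarrow> 0 \<le> x w" "w \<in> W \<Longrightarrow> x w \<le> 1"
  using x_nonneg x_le1 N_V W_V by auto

section \<open>Counting edges and walks of length two\<close>

lemma sum_AN_swap:
  assumes "finite A"
  shows "(\<Sum>v\<in>A. \<Sum>w\<in>AN v. f w) = (\<Sum>w\<in>N. real (card {v\<in>A. E w v}) * f w)"
proof -
  have "(\<Sum>v\<in>A. \<Sum>w\<in>AN v. f w) = (\<Sum>v\<in>A. \<Sum>w\<in>N. if E v w then f w else 0)"
    using finN by (simp add: AN_def sum.inter_filter[symmetric] conj_commute)
  also have "\<dots> = (\<Sum>w\<in>N. \<Sum>v\<in>A. if E v w then f w else 0)"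
    by (rule sum.swap)
  also have "\<dots> = (\<Sum>w\<in>N. real (card {v\<in>A. E w v}) * f w)"
    using assms by (intro sum.cong) (auto simp: sum.If_cases E_commute Int_def)
  finally show ?thesis .
qed

lemma sum_AW_swap:
  assumes "finite A"
  shows "(\<Sum>v\<in>A. \<Sum>w\<in>AW v. f w) = (\<Sum>w\<in>W. real (card {v\<in>A. E w v}) * f w)"
proof -
  have "(\<Sum>v\<in>A. \<Sum>w\<in>AW v. f w) = (\<Sum>v\<in>A. \<Sum>w\<in>W. if E v w then f w else 0)"
    using finW by (simp add: AW_def sum.inter_filter[symmetric] conj_commute)
  also have "\<dots> = (\<Sum>w\<in>W. \<Sum>v\<in>A. if E v w then f w else 0)"
    by (rule sum.swap)
  also have "\<dots> = (\<Sum>w\<in>W. real (card {v\<in>A. E w v}) * f w)"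
    using assms by (intro sum.cong) (auto simp: sum.If_cases E_commute Int_def)
  finally show ?thesis .
qed

lemma AN_alt: "{v\<in>N. E w v} = AN w"
  by (auto simp: AN_def)

lemma m_eq: "real m = real (card N) + (\<Sum>v\<in>N. dN v) / 2 + (\<Sum>w\<in>W. dN w) + (\<Sum>w\<in>W. dW w) / 2"
proof -
  have "2 * real m = real (\<Sum>v\<in>V. card {w. E v w})"
    using edge_count by (metis of_nat_mult of_nat_numeral)
  also have "\<dots> = (\<Sum>v\<in>V. real (card {w. E v w}))" by simp
  also have "\<dots> = real (card {w. E u w}) + ((\<Sum>v\<in>N. real (card {w. E v w})) + (\<Sum>v\<in>W. real (card {w. E v w})))"
    using finN finW u_N u_W NW by (simp add: sum.cong[OF V_eq refl] sum.union_disjoint)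
  also have "\<dots> = real (card N) + ((\<Sum>v\<in>N. 1 + dN v + dW v) + (\<Sum>w\<in>W. dN w + dW w))"
    by (simp add: deg_N deg_W N_def[symmetric])
  also have "\<dots> = 2 * real (card N) + (\<Sum>v\<in>N. dN v) + (\<Sum>v\<in>N. dW v) + (\<Sum>w\<in>W. dN w) + (\<Sum>w\<in>W. dW w)"
    by (simp add: sum.distrib)
  \<comment> \<open>The edges between \<open>N\<close> and \<open>W\<close> are now counted from the
    side of \<open>W\<close>, where their cost is booked.\<close>
  also have "(\<Sum>v\<in>N. dW v) = (\<Sum>w\<in>W. dN w)"
    using sum_AW_swap[OF finN, of "\<lambda>_. 1"] by (simp add: AN_alt dN_def dW_def)
  finally show ?thesis by simp
qed

text \<open>A walk of length two from \<open>u\<close> returns to \<open>u\<close>, ends in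
  \<open>N\<close> or ends in \<open>W\<close>; this yields the three terms of \<open>l^2\<close>.
  The equation at \<open>u\<close> spreads the subtracted \<open>l\<close> over \<open>N\<close>,
  and \<open>m_eq\<close> does the rest.\<close>

lemma gap_identity: "gap - 2 = (\<Sum>v\<in>N. g v) - (\<Sum>w\<in>W. p w)"
proof -
  have "l^2 = (\<Sum>v\<in>N. l * x v)"
    using eig_u by (metis power2_eq_square sum_distrib_left)
  also have "\<dots> = real (card N) + (\<Sum>v\<in>N. \<Sum>w\<in>AN v. x w) + (\<Sum>v\<in>N. \<Sum>w\<in>AW v. x w)"
    by (simp add: eig_N sum.distrib)
  also have "\<dots> = real (card N) + (\<Sum>v\<in>N. dN v * x v) + (\<Sum>v\<in>W. dN v * x v)"
    by (simp add: sum_AN_swap sum_AW_swap finN AN_alt dN_def)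
  finally have a: "l^2 = real (card N) + (\<Sum>v\<in>N. dN v * x v) + (\<Sum>v\<in>W. dN v * x v)" .
  have b: "(\<Sum>v\<in>N. g v) = (\<Sum>v\<in>N. dN v * x v) - l - (\<Sum>v\<in>N. dN v) / 2"
    by (subst eig_u) (simp add: g_def sum_subtractf left_diff_distrib sum_divide_distrib)
  have c: "(\<Sum>w\<in>W. p w) = (\<Sum>w\<in>W. dN w) - (\<Sum>v\<in>W. dN v * x v) + (\<Sum>w\<in>W. dW w) / 2"
    by (simp add: p_def sum.distrib sum_subtractf right_diff_distrib sum_divide_distrib)
  show ?thesis unfolding gap_def a b c using m_eq by simp
qed

lemma p_nonneg: "w \<in> W \<Longrightarrow> p w \<ge> 0"
  using dN_nonneg dW_nonneg x01 by (auto simp: p_def)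

lemma five: "v \<in> V \<Longrightarrow> 5 * x v \<le> l * x v"
  using x_nonneg l_gt5 by (intro mult_right_mono) auto

lemma xW_le: assumes "w \<in> W" shows "5 * x w \<le> dN w + dW w"
proof -
  have "(\<Sum>v\<in>AN w. x v) \<le> (\<Sum>v\<in>AN w. 1)" "(\<Sum>v\<in>AW w. x v) \<le> (\<Sum>v\<in>AW w. 1)"
    using x01 by (intro sum_mono; auto simp: AN_def AW_def)+
  then show ?thesis using eig_W[OF assms] five[of w] assms W_V by (auto simp: dN_def dW_def)
qed

text \<open>With \<open>k = dN w\<close>, what \<open>k * (1 - x w)\<close> loses near
  \<open>x w = 1\<close> is made up by \<open>dW w \<ge> 5 * x w - k\<close>. At
  \<open>x w = 1\<close> the resulting bound is (5 - k) / 2 against k / 4, which holds for k = 3 and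
  fails for k = 4.\<close>

lemma p_ge_quarter:
  assumes "w \<in> W" "dN w \<le> 3"
  shows "p w \<ge> dN w * x w / 4"
proof -
  have "dN w \<in> {0,1,2,3}"
    using assms by (auto simp: dN_def)
  moreover have "dW w / 2 \<ge> (5 * x w - dN w) / 2" using xW_le[OF assms(1)] by simp
  ultimately show ?thesis using assms x01[of w] dW_nonneg[of w] unfolding p_def by auto
qed

lemma p_ge_x:
  assumes "w \<in> W" "dN w = 1"
  shows "p w \<ge> x w"
  using xW_le[OF assms(1)] assms x01[of w] dW_nonneg[of w] unfolding p_def by auto

end

section \<open>Components of the neighbourhood\<close>

context perron begin

lemma AN_sym: "v \<in> N \<Longrightarrow> w \<in> AN v \<Longrightarrow> v \<in> AN w"
  using E_sym by (auto simp: AN_def)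

lemma AN_N: "AN v \<subseteq> N" and AN_E: "w \<in> AN v \<Longrightarrow> E v w"
  by (auto simp: AN_def)

lemma uN: "v \<in> N \<Longrightarrow> E u v" "v \<in> N \<Longrightarrow> E v u" "v \<in> N \<Longrightarrow> u \<noteq> v" "v \<in> N \<Longrightarrow> v \<noteq> u"
  using E_sym u_N by (auto simp: N_def)

lemma WN: "v \<in> N \<Longrightarrow> w \<in> W \<Longrightarrow> w \<noteq> v" "v \<in> N \<Longrightarrow> w \<in> W \<Longrightarrow> v \<noteq> w"
  "w \<in> W \<Longrightarrow> w \<noteq> u" "w \<in> W \<Longrightarrow> u \<noteq> w"
  using NW u_W by auto

lemma no_path5:
  assumes "distinct [a, b, c, d, e]" "E a b" "E b c" "E c d" "E d e" "a \<in> N" "b \<in> N" "c \<in> N" "d \<in> N" "e \<in> N"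
  shows False
  using no_hexagon[of u a b c d e] assms uN by auto

text \<open>The intersection removes the reflexive pairs that the closure adds outside
  \<open>N\<close>, so that the relation is an equivalence on \<open>N\<close>.\<close>

definition R where "R = {(v, w). v \<in> N \<and> w \<in> AN v}\<^sup>* \<inter> N \<times> N"

lemma equiv_R: "equiv N R"
proof (rule equivI)
  have s: "sym {(v, w). v \<in> N \<and> w \<in> AN v}"
    using AN_sym AN_N by (auto intro!: symI)
  show "R \<subseteq> N \<times> N" by (auto simp: R_def)
  show "refl_on N R" by (auto simp: refl_on_def R_def)
  show "sym R" using sym_rtrancl[OF s] by (auto simp: sym_def R_def)
  show "trans R" by (auto simp: trans_def R_def)
qed

definition comps where "comps = N // R"

lemma comp_N: "C \<in> comps \<Longrightarrow> C \<subseteq> N"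
  using in_quotient_imp_subset[OF equiv_R] by (simp add: comps_def)

lemma comp_fin: "C \<in> comps \<Longrightarrow> finite C"
  using comp_N finN finite_subset by blast

lemma comp_nonempty: "C \<in> comps \<Longrightarrow> \<exists>v. v \<in> C"
  using in_quotient_imp_non_empty[OF equiv_R] by (auto simp: comps_def)

lemma comp_closed: "C \<in> comps \<Longrightarrow> v \<in> C \<Longrightarrow> AN v \<subseteq> C"
proof
  fix w assume "C \<in> comps" "v \<in> C" "w \<in> AN v"
  moreover have "(v, w) \<in> R" using calculation comp_N AN_N by (auto simp: R_def)
  ultimately show "w \<in> C" using in_quotient_imp_closed[OF equiv_R] by (auto simp: comps_def)
qed

text \<open>Induction along a path inside \<open>N\<close>. Every component below is identified by
  exhibiting a set closed under neighbours in \<open>N\<close>.\<close>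

lemma comp_minimal:
  assumes "C \<in> comps" "v \<in> C" "v \<in> S" and cl: "\<And>w. w \<in> S \<Longrightarrow> w \<in> N \<Longrightarrow> AN w \<subseteq> S"
  shows "C \<subseteq> S"
proof
  fix w assume "w \<in> C"
  then have "(v, w) \<in> R" using in_quotient_imp_in_rel[OF equiv_R] assms by (auto simp: comps_def)
  then have "(v, w) \<in> {(v, w). v \<in> N \<and> w \<in> AN v}\<^sup>*" by (auto simp: R_def)
  then show "w \<in> S"
    by (induction) (use assms(3) cl in auto)
qed

lemma comps_disjoint: "C \<in> comps \<Longrightarrow> C' \<in> comps \<Longrightarrow> v \<in> C \<Longrightarrow> v \<in> C' \<Longrightarrow> C = C'"
  using quotient_disj[OF equiv_R] by (auto simp: comps_def)

lemma comps_Union: "\<Union>comps = N"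
  using Union_quotient[OF equiv_R] by (simp add: comps_def)

lemma comps_finite: "finite comps"
  using finN comps_Union by (auto intro: finite_UnionD)

lemma sum_comps: "(\<Sum>v\<in>N. f v) = (\<Sum>C\<in>comps. \<Sum>v\<in>C. f v)"
  unfolding comps_Union[symmetric]
  using comp_fin comps_disjoint by (subst sum.Union_disjoint) auto

text \<open>The diagonals are left open: the 4-cycle is covered with and without chords.\<close>

definition "four C \<longleftrightarrow> (\<exists>a b c d. distinct [a, b, c, d] \<and> E a b \<and> E b c \<and> E c d \<and> E d a \<and> C = {a, b, c, d})"

definition "tri C a b c D \<longleftrightarrow> distinct [a, b, c] \<and> {a, b, c} \<inter> D = {} \<and> C = {a, b, c} \<union> D
  \<and> AN a = {b, c} \<union> D \<and> AN b = {a, c} \<and> AN c = {a, b} \<and> (\<forall>d\<in>D. AN d = {a})"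

text \<open>A star is the case \<open>D' = {}\<close>, with an arbitrary leaf in the role of \<open>a'\<close>.\<close>

definition "dstar C a a' D D' \<longleftrightarrow> a \<noteq> a' \<and> {a, a'} \<inter> (D \<union> D') = {} \<and> D \<inter> D' = {} \<and> C = {a, a'} \<union> D \<union> D'
  \<and> AN a = insert a' D \<and> AN a' = insert a D' \<and> (\<forall>d\<in>D. AN d = {a}) \<and> (\<forall>d\<in>D'. AN d = {a'})"

text \<open>A further vertex adjacent to the cycle would start a path on five vertices that runs
  once round it.\<close>

lemma four_comp:
  assumes C: "C \<in> comps" and "a \<in> C" "distinct [a, b, c, d]" "E a b" "E b c" "E c d" "E d a"
    "b \<in> N" "c \<in> N" "d \<in> N"
  shows "C = {a, b, c, d}"
proof
  have N: "a \<in> N" using C assms(2) comp_N by auto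
  show "C \<subseteq> {a, b, c, d}"
  proof (rule comp_minimal[OF C \<open>a \<in> C\<close>])
    fix w assume w: "w \<in> {a, b, c, d}" "w \<in> N"
    show "AN w \<subseteq> {a, b, c, d}"
    proof
      fix v assume v: "v \<in> AN w"
      then have vN: "v \<in> N" "E v w" using AN_N E_sym AN_E by blast+
      show "v \<in> {a, b, c, d}"
      proof (rule ccontr)
        assume "v \<notin> {a, b, c, d}"
        then show False using w vN assms N
          no_path5[of v a b c d] no_path5[of v b c d a] no_path5[of v c d a b] no_path5[of v d a b c] by auto
      qed
    qed
  qed simp
  have "b \<in> C" using comp_closed[OF C \<open>a \<in> C\<close>] assms by (auto simp: AN_def)
  moreover then have "c \<in> C" using comp_closed[OF C] assms by (auto simp: AN_def)
  moreover then have "d \<in> C" using comp_closed[OF C] assms by (auto simp: AN_def)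
  ultimately show "{a, b, c, d} \<subseteq> C" using assms by auto
qed

text \<open>Assumption \<open>dd\<close> says that \<open>a\<close> is the right corner to carry the
  pendant vertices. Outside neighbours at two corners give a 4-cycle if they coincide and a path on
  five vertices otherwise.\<close>

lemma tri_comp_aux:
  assumes C: "C \<in> comps" and n4: "\<not> four C" and in_C: "a \<in> C" "b \<in> C" "c \<in> C"
    and tr: "E a b" "E b c" "E a c"
    and dd: "AN b \<union> AN c \<subseteq> {a, b, c} \<or> (\<exists>d. d \<in> AN a - {b, c})"
  shows "\<exists>D. tri C a b c D"
proof -
  have N: "a \<in> N" "b \<in> N" "c \<in> N" using in_C C comp_N by auto
  have tr': "E b a" "E c b" "E c a" using tr E_sym by auto
  have ne: "a \<noteq> b" "b \<noteq> c" "a \<noteq> c" using tr E_irrefl by auto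
  note facts = N tr tr' ne
  have no4: False if "distinct [s, t, y, z]" "E s t" "E t y" "E y z" "E z s" "s \<in> C" "t \<in> N" "y \<in> N" "z \<in> N" for s t y z
    using four_comp[OF C, of s t y z] that n4 by (auto simp: four_def)
  have bc: "AN b \<union> AN c \<subseteq> {a, b, c}"
  proof (rule ccontr)
    assume n: "\<not> AN b \<union> AN c \<subseteq> {a, b, c}"
    then obtain d where d: "d \<in> AN a" "d \<noteq> b" "d \<noteq> c" using dd by auto
    have d': "d \<in> N" "E a d" "E d a" "d \<noteq> a" using d E_sym E_irrefl by (auto simp: AN_def)
    obtain v where v: "v \<in> AN b \<union> AN c" "v \<notin> {a, b, c}" using n by auto
    have vN: "v \<in> N" using v by (auto simp: AN_def)
    from v consider (b) "E b v" "E v b" | (c) "E c v" "E v c" using E_sym by (auto simp: AN_def)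
    then show False
    proof cases
      case b
      show False
      proof (cases "v = d")
        case True
        show False by (rule no4[of a d b c]) (use True b v vN d d' facts in_C in auto)
      next
        case False
        show False by (rule no_path5[of d a c b v]) (use False b v vN d d' facts in auto)
      qed
    next
      case c
      show False
      proof (cases "v = d")
        case True
        show False by (rule no4[of a d c b]) (use True c v vN d d' facts in_C in auto)
      next
        case False
        show False by (rule no_path5[of d a b c v]) (use False c v vN d d' facts in auto)
      qed
    qed
  qed
  define D where "D = AN a - {b, c}"
  have ANb: "AN b = {a, c}" and ANc: "AN c = {a, b}" and ANa: "AN a = {b, c} \<union> D"
    using bc facts E_irrefl by (auto simp: AN_def D_def)
  have AD: "AN d = {a}" if "d \<in> D" for d
  proof -
    have d: "d \<in> N" "E a d" "E d a" "d \<noteq> a" "d \<noteq> b" "d \<noteq> c" using that E_sym E_irrefl by (auto simp: AN_def D_def)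
    have "v = a" if v: "v \<in> AN d" for v
    proof (rule ccontr)
      assume na: "v \<noteq> a"
      have v': "v \<in> N" "E d v" "E v d" "v \<noteq> d" using v E_sym E_irrefl by (auto simp: AN_def)
      have vd: "d \<in> AN v" using AN_sym[OF d(1) v] .
      then have "v \<noteq> b" "v \<noteq> c" using ANb ANc d by auto
      then show False using v' d facts na by (intro no_path5[of v d a b c]) auto
    qed
    then have "AN d \<subseteq> {a}" by blast
    moreover have "a \<in> AN d" using d N by (auto simp: AN_def)
    ultimately show ?thesis by auto
  qed
  have "C \<subseteq> {a, b, c} \<union> D"
    by (rule comp_minimal[OF C in_C(1)]) (use ANa ANb ANc AD in auto)
  moreover have "D \<subseteq> C" using comp_closed[OF C in_C(1)] by (auto simp: D_def)
  ultimately have "C = {a, b, c} \<union> D" using in_C by auto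
  moreover have "a \<notin> D" using E_irrefl by (auto simp: D_def AN_def)
  then have "{a, b, c} \<inter> D = {}" by (auto simp: D_def)
  ultimately show ?thesis using ANa ANb ANc AD ne unfolding tri_def by (intro exI[of _ D]) simp
qed

text \<open>A corner with a neighbour outside the triangle takes the role of
  \<open>a\<close>.\<close>

lemma tri_comp:
  assumes C: "C \<in> comps" and n4: "\<not> four C" and in_C: "a \<in> C" "b \<in> C" "c \<in> C"
    and tr: "E a b" "E b c" "E a c"
  shows "\<exists>a b c D. tri C a b c D"
proof -
  have tr': "E b a" "E c b" "E c a" using tr E_sym by auto
  have irr: "b \<notin> AN b" "c \<notin> AN c" "a \<notin> AN a" using E_irrefl by (auto simp: AN_def)
  consider "AN b \<union> AN c \<subseteq> {a, b, c}" | "\<exists>d. d \<in> AN b - {a, c}" | "\<exists>d. d \<in> AN c - {a, b}"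
    using irr by blast
  then show ?thesis
  proof cases
    case 1 then show ?thesis using tri_comp_aux[OF C n4 in_C tr] by blast
  next
    case 2 then show ?thesis using tri_comp_aux[OF C n4 in_C(2,1,3)] tr tr' by blast
  next
    case 3 then show ?thesis using tri_comp_aux[OF C n4 in_C(3,1,2)] tr tr' by blast
  qed
qed

text \<open>Assembly of the shape once the two centres are known; a common neighbour of the centres
  would close a triangle, hence \<open>D1 \<inter> D2 = {}\<close>.\<close>

lemma dstar_comp_aux:
  assumes C: "C \<in> comps" and n3: "\<And>a b c. a \<in> C \<Longrightarrow> E a b \<Longrightarrow> E b c \<Longrightarrow> E a c \<Longrightarrow> b \<in> N \<Longrightarrow> c \<in> N \<Longrightarrow> False"
    and in_C: "a \<in> C" "b \<in> C" and ab: "E a b"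
    and D: "\<And>d. d \<in> AN a - {b} \<Longrightarrow> AN d = {a}" and D': "\<And>d. d \<in> AN b - {a} \<Longrightarrow> AN d = {b}"
  shows "\<exists>D D'. dstar C a b D D'"
proof -
  have N: "a \<in> N" "b \<in> N" using in_C C comp_N by auto
  have ab': "E b a" "a \<noteq> b" using ab E_sym E_irrefl by auto
  define D1 where "D1 = AN a - {b}"
  define D2 where "D2 = AN b - {a}"
  have A: "AN a = insert b D1" "AN b = insert a D2" using N ab ab' by (auto simp: D1_def D2_def AN_def)
  have "C \<subseteq> {a, b} \<union> D1 \<union> D2"
  proof (rule comp_minimal[OF C in_C(1)])
    fix w assume "w \<in> {a, b} \<union> D1 \<union> D2"
    moreover have "AN w = {a}" if "w \<in> D1" using D that unfolding D1_def .
    moreover have "AN w = {b}" if "w \<in> D2" using D' that unfolding D2_def .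
    ultimately show "AN w \<subseteq> {a, b} \<union> D1 \<union> D2" using A by auto
  qed simp
  moreover have "D1 \<subseteq> C" "D2 \<subseteq> C" using comp_closed[OF C in_C(1)] comp_closed[OF C in_C(2)] by (auto simp: D1_def D2_def)
  ultimately have "C = {a, b} \<union> D1 \<union> D2" using in_C by auto
  moreover have "a \<notin> D1" "b \<notin> D1" "a \<notin> D2" "b \<notin> D2" using E_irrefl by (auto simp: D1_def D2_def AN_def)
  moreover have "D1 \<inter> D2 = {}" using n3[OF in_C(1) ab] N by (auto simp: D1_def D2_def AN_def)
  moreover have "\<forall>d\<in>D1. AN d = {a}" "\<forall>d\<in>D2. AN d = {b}" using D D' unfolding D1_def D2_def by blast+
  ultimately show ?thesis using A ab' unfolding dstar_def
    by (intro exI[of _ D1] exI[of _ D2]) simp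
qed

text \<open>If the component contains a path on four vertices, its inner edge joins the two centres,
  because prolonging it or branching further creates a triangle, a 4-cycle or a path on five
  vertices. Otherwise the component is a star, and one end of any edge is a leaf.\<close>

lemma dstar_comp:
  assumes C: "C \<in> comps" and n4: "\<not> four C"
    and n3: "\<And>a b c. a \<in> C \<Longrightarrow> b \<in> C \<Longrightarrow> c \<in> C \<Longrightarrow> E a b \<Longrightarrow> E b c \<Longrightarrow> E a c \<Longrightarrow> False"
    and in_C: "a \<in> C" "b \<in> C" and ab: "E a b"
  shows "\<exists>a b D D'. dstar C a b D D'"
proof -
  have no4: False if "distinct [s, t, y, z]" "E s t" "E t y" "E y z" "E z s" "s \<in> C" "t \<in> N" "y \<in> N" "z \<in> N" for s t y z
    using four_comp[OF C, of s t y z] that n4 by (auto simp: four_def)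
  have cl: "w \<in> C" if "v \<in> C" "E v w" "w \<in> N" for v w
    using comp_closed[OF C that(1)] that by (auto simp: AN_def)
  have n3': False if "a \<in> C" "E a b" "E b c" "E a c" "b \<in> N" "c \<in> N" for a b c
    using n3[of a b c] that cl by blast
  have CN: "v \<in> N" if "v \<in> C" for v using that comp_N[OF C] by auto
  show ?thesis
  proof (cases "\<exists>d a b d'. distinct [d, a, b, d'] \<and> E d a \<and> E a b \<and> E b d' \<and> d \<in> C \<and> a \<in> C \<and> b \<in> C \<and> d' \<in> C")
    case True
    then obtain d a b d' where P: "distinct [d, a, b, d']" "E d a" "E a b" "E b d'"
      and PC: "d \<in> C" "a \<in> C" "b \<in> C" "d' \<in> C" by auto
    have P': "E a d" "E b a" "E d' b" using P E_sym by auto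
    \<comment> \<open>Stated for an arbitrary path so that reversing the path serves the other
      centre.\<close>
    have key: "AN e = {a}" if P: "distinct [a, b, d']" "E a b" "E b d'" and PC: "a \<in> C" "b \<in> C" "d' \<in> C"
      and e: "e \<in> AN a - {b}" for a b d' e
    proof -
      have e': "e \<in> N" "E a e" "E e a" "e \<noteq> a" "e \<noteq> b" using e E_sym E_irrefl by (auto simp: AN_def)
      have eC: "e \<in> C" using cl PC e' by blast
      have P': "E b a" "E d' b" using P E_sym by auto
      have ed': "e \<noteq> d'" using n3'[of a b d'] P PC CN e' by auto
      have "v = a" if v: "v \<in> AN e" for v
      proof (rule ccontr)
        assume na: "v \<noteq> a"
        have v': "v \<in> N" "E e v" "E v e" "v \<noteq> e" using v E_sym E_irrefl by (auto simp: AN_def)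
        have "v \<noteq> b" using n3'[of a e b] v' e' P PC CN by auto
        moreover have "v \<noteq> d'" using no4[of e a b d'] v' e' ed' P P' PC CN eC by auto
        ultimately show False using v' e' ed' P PC CN na by (intro no_path5[of v e a b d']) auto
      qed
      then have "AN e \<subseteq> {a}" by blast
      moreover have "a \<in> AN e" using e' PC CN by (auto simp: AN_def)
      ultimately show ?thesis by auto
    qed
    have "\<exists>D D'. dstar C a b D D'"
    proof (rule dstar_comp_aux[OF C _ PC(2,3) P(3)])
      show "False" if "a \<in> C" "E a b" "E b c" "E a c" "b \<in> N" "c \<in> N" for a b c
        using n3' that by blast
      show "AN e = {a}" if "e \<in> AN a - {b}" for e using key[of a b d' e] P P' PC that by auto
      show "AN e = {b}" if "e \<in> AN b - {a}" for e using key[of b a d e] P P' PC that by auto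
    qed
    then show ?thesis by blast
  next
    case False
    have nop: False if "distinct [d, a, b, d']" "E d a" "E a b" "E b d'" "a \<in> C" "d \<in> N" "b \<in> N" "d' \<in> N" for d a b d'
      using False that cl[of a] cl[of b] E_sym by blast
    \<comment> \<open>An edge with a leaf end \<open>b\<close> determines the star: \<open>a\<close>
      is the centre, and \<open>b\<close> plays the second centre without leaves of its own.\<close>
    have main: "\<exists>D D'. dstar C a b D D'" if in_C: "a \<in> C" "b \<in> C" and ab: "E a b" and ANb: "AN b = {a}" for a b
    proof (rule dstar_comp_aux[OF C _ in_C ab])
      show "False" if "a \<in> C" "E a b" "E b c" "E a c" "b \<in> N" "c \<in> N" for a b c
        using n3' that by blast
      fix d assume d: "d \<in> AN a - {b}"
      have d': "d \<in> N" "E a d" "E d a" "d \<noteq> a" "d \<noteq> b" using d E_sym E_irrefl by (auto simp: AN_def)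
      have ne: "a \<noteq> b" "E b a" using ab E_irrefl E_sym by auto
      have "v = a" if v: "v \<in> AN d" for v
      proof (rule ccontr)
        assume na: "v \<noteq> a"
        have v': "v \<in> N" "E d v" "E v d" "v \<noteq> d" using v E_sym E_irrefl by (auto simp: AN_def)
        have "v \<noteq> b" using n3'[of a d b] v' d' ab in_C CN by auto
        then show False using v' d' ne in_C CN na by (intro nop[of b a d v]) auto
      qed
      then have "AN d \<subseteq> {a}" by blast
      moreover have "a \<in> AN d" using d' in_C CN by (auto simp: AN_def)
      ultimately show "AN d = {a}" by auto
    qed (use ANb in auto)
    have ba: "E b a" "a \<noteq> b" using ab E_sym E_irrefl by auto
    show ?thesis
    proof (cases "AN b = {a}")
      case True then show ?thesis using main[OF in_C ab] by blast
    next
      case False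
      have "a \<in> AN b" using ba in_C CN by (auto simp: AN_def)
      then obtain c where c: "c \<in> AN b" "c \<noteq> a" using False by blast
      have c': "c \<in> N" "E b c" "E c b" "c \<noteq> b" using c E_sym E_irrefl by (auto simp: AN_def)
      have "v = b" if v: "v \<in> AN a" for v
      proof (rule ccontr)
        assume nb: "v \<noteq> b"
        have v': "v \<in> N" "E a v" "E v a" "v \<noteq> a" using v E_sym E_irrefl by (auto simp: AN_def)
        have "v \<noteq> c" using n3'[of a b c] v' c' ab ba in_C CN by auto
        then show False using v' c' ab ba in_C CN c nb by (intro nop[of v a b c]) auto
      qed
      then have "AN a \<subseteq> {b}" by blast
      moreover have "b \<in> AN a" using ab in_C CN by (auto simp: AN_def)
      ultimately have "AN a = {b}" by auto
      then show ?thesis using main[OF in_C(2,1) ba(1)] by blast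
    qed
  qed
qed

lemma comp_cases:
  assumes C: "C \<in> comps"
  obtains (single) v where "C = {v}" "AN v = {}"
  | (four) "four C"
  | (tri) a b c D where "tri C a b c D"
  | (dstar) a a' D D' where "dstar C a a' D D'"
proof -
  obtain v where v: "v \<in> C" using comp_nonempty[OF C] by auto
  show thesis
  proof (cases "AN v = {}")
    case True
    have "C \<subseteq> {v}" by (rule comp_minimal[OF C v]) (use True in auto)
    then show thesis using single[of v] v True by auto
  next
    case False
    then obtain w where w: "w \<in> AN v" by auto
    then have w': "w \<in> C" "E v w" using comp_closed[OF C v] by (auto simp: AN_def)
    show thesis
    proof (cases "four C")
      case n4: False
      show thesis
      proof (cases "\<exists>a b c. a \<in> C \<and> b \<in> C \<and> c \<in> C \<and> E a b \<and> E b c \<and> E a c")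
        case True
        then have "\<exists>a b c D. tri C a b c D" using tri_comp[OF C n4] by blast
        then obtain a b c D where "tri C a b c D" by blast
        then show thesis by (rule tri)
      next
        case False
        have "\<exists>a b D D'. dstar C a b D D'"
        proof (rule dstar_comp[OF C n4 _ v w'])
          fix a b c assume "a \<in> C" "b \<in> C" "c \<in> C" "E a b" "E b c" "E a c"
          then show "False" using False by blast
        qed
        then obtain a b D D' where "dstar C a b D D'" by blast
        then show thesis by (rule dstar)
      qed
    qed (rule four)
  qed
qed

end

section \<open>Contributions of the components\<close>

context perron begin

text \<open>
  \<open>attached C\<close> are the vertices of \<open>W\<close> whose weight \<open>p\<close> is charged to \<open>C\<close>. The bound \<open>dN w \<le> 3\<close> makes
  \<open>p w\<close> dominate the gain that \<open>w\<close> causes in \<open>C\<close> (\<open>p_ge_quarter\<close>).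
\<close>

definition "attached C = {w \<in> W. AN w \<noteq> {} \<and> AN w \<subseteq> C \<and> dN w \<le> 3}"
definition "contribution C = (\<Sum>v\<in>C. g v) - (\<Sum>w\<in>attached C. p w)"

lemma attached_W: "attached C \<subseteq> W" and fin_attached: "finite (attached C)"
  using finW by (auto simp: attached_def)

lemma sum_attached_nonneg: "0 \<le> (\<Sum>w\<in>attached C. p w)"
  using attached_W p_nonneg by (intro sum_nonneg) auto

text \<open>No vertex of \<open>W\<close> is charged twice, since the nonempty set
  \<open>AN w\<close> lies in one component only. Vertices that are not charged have nonnegative
  weight and are dropped.\<close>

lemma gap_le_contribution: "gap - 2 \<le> (\<Sum>C\<in>comps. contribution C)"
proof -
  have "attached C \<inter> attached C' = {}" if "C \<in> comps" "C' \<in> comps" "C \<noteq> C'" for C C'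
    using comps_disjoint[OF that(1,2)] that(3) unfolding attached_def by blast
  then have "(\<Sum>C\<in>comps. \<Sum>w\<in>attached C. p w) = (\<Sum>w\<in>(\<Union>C\<in>comps. attached C). p w)"
    by (intro sum.UNION_disjoint[symmetric]) (use comps_finite fin_attached in auto)
  also have "\<dots> \<le> (\<Sum>w\<in>W. p w)"
    using finW attached_W p_nonneg by (intro sum_mono2) auto
  finally show ?thesis
    unfolding gap_identity contribution_def sum_comps by (simp add: sum_subtractf)
qed

text \<open>Bounds what \<open>S\<close> receives from \<open>W\<close> in its eigenvalue equations
  by a quantity that the weights \<open>p\<close> can pay: the edges between \<open>S\<close> and
  \<open>W\<close> are counted from the side of \<open>W\<close>.\<close>

lemma sigma_eq:
  assumes "S \<subseteq> C" "finite C" and "\<And>w. w \<in> W \<Longrightarrow> AN w \<inter> S \<noteq> {} \<Longrightarrow> w \<in> attached C" "S \<subseteq> N"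
  shows "(\<Sum>v\<in>S. \<Sum>w\<in>AW v. x w) \<le> (\<Sum>w\<in>attached C. dN w * x w)"
proof -
  have "finite S" using assms finite_subset by blast
  then have "(\<Sum>v\<in>S. \<Sum>w\<in>AW v. x w) = (\<Sum>w\<in>W. real (card {v\<in>S. E w v}) * x w)"
    by (rule sum_AW_swap)
  also have "\<dots> = (\<Sum>w\<in>attached C. real (card {v\<in>S. E w v}) * x w)"
  proof (rule sum.mono_neutral_right[OF finW attached_W], safe)
    fix w assume w: "w \<in> W" "w \<notin> attached C"
    then have "{v\<in>S. E w v} = {}" using assms(3)[of w] assms(4) by (auto simp: AN_def)
    then show "real (card {v\<in>S. E w v}) * x w = 0" by (metis card.empty mult_zero_left of_nat_0)
  qed
  also have "\<dots> \<le> (\<Sum>w\<in>attached C. dN w * x w)"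
  proof (intro sum_mono mult_right_mono)
    fix w assume "w \<in> attached C"
    show "real (card {v\<in>S. E w v}) \<le> dN w"
      unfolding dN_def using finAN assms(4) by (intro of_nat_mono card_mono) (auto simp: AN_def)
    have "w \<in> W" using \<open>w \<in> attached C\<close> attached_W by auto
    then show "0 \<le> x w" by (rule x01)
  qed
  finally show ?thesis .
qed

section \<open>Weight of a component on a 4-cycle\<close>

lemma four_W:
  assumes "distinct [a, b, c, d]" "E a b" "E b c" "E c d" "E d a" "a \<in> N" "b \<in> N" "c \<in> N" "d \<in> N"
    and w: "w \<in> W" "E w a"
  shows "AN w = {a}"
proof -
  have s: "E b a" "E c b" "E d c" "E a d" "E a w" using assms E_sym by auto
  have ne: "w \<noteq> a" "w \<noteq> b" "w \<noteq> c" "w \<noteq> d" "w \<noteq> u" using w assms WN by auto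
  have "v = a" if v: "v \<in> AN w" for v
  proof (rule ccontr)
    assume na: "v \<noteq> a"
    have v': "v \<in> N" "E w v" "E v w" "w \<noteq> v" using v E_sym WN w by (auto simp: AN_def)
    \<comment> \<open>Wherever a second neighbour \<open>v\<close> of \<open>w\<close> lies, on the
      cycle or off it, a detour through \<open>w\<close> and \<open>u\<close> makes a
      hexagon.\<close>
    consider "v = b" | "v = c" | "v = d" | "v \<notin> {a, b, c, d}" using na by blast
    then show False
    proof cases
      case 1 show False by (rule no_hexagon[of w a d u c b]) (use 1 assms s ne v' uN in auto)
    next
      case 2 show False by (rule no_hexagon[of w a b u d c]) (use 2 assms s ne v' uN in auto)
    next
      case 3 show False by (rule no_hexagon[of w a b u c d]) (use 3 assms s ne v' uN in auto)
    next
      case 4 show False by (rule no_hexagon[of w a b c u v]) (use 4 assms s ne v' uN in auto)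
    qed
  qed
  then have "AN w \<subseteq> {a}" by blast
  moreover have "a \<in> AN w" using assms by (auto simp: AN_def)
  ultimately show ?thesis by auto
qed

lemma four_AN:
  assumes C: "{a, b, c, d} \<in> comps" "distinct [a, b, c, d]" "E a b" "E d a"
  shows "dN a = 2 + (if E a c then 1 else 0)"
    and "(\<Sum>v\<in>AN a. x v) = x b + x d + (if E a c then 1 else 0) * x c"
proof -
  have "AN a \<subseteq> {a, b, c, d}" using comp_closed[OF C(1)] by auto
  moreover have "E a d" using C E_sym by auto
  ultimately have "AN a = {b, d} \<union> (if E a c then {c} else {})"
    using comp_N[OF C(1)] C E_irrefl by (auto simp: AN_def)
  then show "dN a = 2 + (if E a c then 1 else 0)"
    and "(\<Sum>v\<in>AN a. x v) = x b + x d + (if E a c then 1 else 0) * x c"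
    using C(2) by (auto simp: dN_def)
qed

text \<open>By \<open>four_W\<close> an attached vertex has \<open>dN w = 1\<close>, so
  \<open>p w \<ge> x w\<close> repays its whole effect. The extreme case is K_4: with inflow
  \<open>s\<close> from \<open>W\<close> its total weight T satisfies 5 T \<le> 4 + 3 T + s, so its
  weights \<open>g\<close> sum to 2 T - 6 \<le> s - 2.\<close>

lemma contribution_four:
  assumes C: "C \<in> comps" and f: "four C"
  shows "contribution C \<le> -2"
proof -
  obtain a b c d where dist: "distinct [a, b, c, d]" and e: "E a b" "E b c" "E c d" "E d a" and Ce: "C = {a, b, c, d}"
    using f by (auto simp: four_def)
  have N: "a \<in> N" "b \<in> N" "c \<in> N" "d \<in> N" using C Ce comp_N by auto
  have V: "a \<in> V" "b \<in> V" "c \<in> V" "d \<in> V" using N N_V by auto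
  have one: "AN w = {v}" if "w \<in> W" "v \<in> C" "E w v" for w v
    using that four_W[of a b c d w] four_W[of b c d a w] four_W[of c d a b w] four_W[of d a b c w] dist e N
    unfolding Ce by auto
  have attached: "w \<in> attached C" if w: "w \<in> W" "AN w \<inter> C \<noteq> {}" for w
  proof -
    obtain v where "v \<in> C" "E w v" using w by (auto simp: AN_def)
    then show ?thesis using one[OF w(1)] w by (auto simp: attached_def dN_def)
  qed
  have dN1: "dN w = 1" if w: "w \<in> attached C" for w
  proof -
    obtain v where "v \<in> C" "E w v" using w by (auto simp: AN_def attached_def)
    then show ?thesis using one[of w v] w by (auto simp: attached_def dN_def)
  qed
  let ?s = "\<lambda>v. (\<Sum>w\<in>AW v. x w)"
  have "?s a + ?s b + ?s c + ?s d = (\<Sum>v\<in>C. ?s v)" using dist Ce by simp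
  also have "\<dots> \<le> (\<Sum>w\<in>attached C. dN w * x w)"
    by (rule sigma_eq) (use attached comp_N[OF C] comp_fin[OF C] in auto)
  also have "\<dots> \<le> (\<Sum>w\<in>attached C. p w)"
    using dN1 p_ge_x attached_W by (intro sum_mono) auto
  finally have sig: "?s a + ?s b + ?s c + ?s d \<le> (\<Sum>w\<in>attached C. p w)" .
  have s0: "?s v \<ge> 0" for v using x01 by (auto intro!: sum_nonneg simp: AW_def)
  have Cs: "{a, b, c, d} \<in> comps" "{b, c, d, a} \<in> comps" "{c, d, a, b} \<in> comps" "{d, a, b, c} \<in> comps"
    using C Ce by (auto simp: insert_commute)
  note A = four_AN[OF Cs(1)] four_AN[OF Cs(2)] four_AN[OF Cs(3)] four_AN[OF Cs(4)]
  have sym: "E c a = E a c" "E d b = E b d" using E_sym by auto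
  define h1 :: real where "h1 = (if E a c then 1 else 0)"
  define h2 :: real where "h2 = (if E b d then 1 else 0)"
  have dN: "dN a = 2 + h1" "dN b = 2 + h2" "dN c = 2 + h1" "dN d = 2 + h2"
    using A dist e by (auto simp: sym h1_def h2_def)
  have eqs: "l * x a = 1 + (x b + x d + h1 * x c) + ?s a" "l * x b = 1 + (x c + x a + h2 * x d) + ?s b"
     "l * x c = 1 + (x d + x b + h1 * x a) + ?s c" "l * x d = 1 + (x a + x c + h2 * x b) + ?s d"
    using A dist e eig_N N by (auto simp: sym h1_def h2_def)
  have h: "h1 \<in> {0, 1}" "h2 \<in> {0, 1}" by (auto simp: h1_def h2_def)
  have "(\<Sum>v\<in>C. g v) = (1 + h1) * (x a + x c) + (1 + h2) * (x b + x d) - 4 - h1 - h2"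
    using dist unfolding Ce by (simp add: g_def dN algebra_simps add_divide_distrib)
  then show ?thesis unfolding contribution_def
    using sig h eqs five[OF V(1)] five[OF V(2)] five[OF V(3)] five[OF V(4)] s0[of a] s0[of b] s0[of c] s0[of d]
    by auto
qed

section \<open>Weight of a triangle with pendant vertices\<close>

lemma tri_W:
  assumes t: "tri C a b c D" and N: "a \<in> N" "b \<in> N" "c \<in> N" and w: "w \<in> W" "E w b \<or> E w c"
  shows "AN w \<subseteq> {a, b, c}"
proof
  fix v assume v: "v \<in> AN w"
  have e: "E b c" "E c b" "E c a" "E b a" "distinct [a, b, c]"
    using t E_sym by (auto simp: tri_def AN_def)
  have v': "v \<in> N" "E w v" "E v w" "w \<noteq> v" using v E_sym WN w by (auto simp: AN_def)
  have ne: "w \<noteq> a" "w \<noteq> b" "w \<noteq> c" "w \<noteq> u" using w N WN by auto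
  show "v \<in> {a, b, c}"
  proof (rule ccontr)
    assume nv: "v \<notin> {a, b, c}"
    from w(2) show False
    proof
      assume "E w b"
      then show False using e v' ne N uN nv by (intro no_hexagon[of w b c a u v]) auto
    next
      assume "E w c"
      then show False using e v' ne N uN nv by (intro no_hexagon[of w c b a u v]) auto
    qed
  qed
qed

lemma tri_sum:
  fixes f :: "'a \<Rightarrow> real"
  assumes "C \<in> comps" and t: "tri C a b c D"
  shows "(\<Sum>v\<in>C. f v) = f a + f b + f c + (\<Sum>v\<in>D. f v)" and "finite D" and "card C = 3 + card D"
proof -
  have "finite C" using comp_fin assms by auto
  moreover have Ce: "C = {a, b, c} \<union> D" "distinct [a, b, c]" "{a, b, c} \<inter> D = {}" using t by (auto simp: tri_def)
  ultimately show D: "finite D" by simp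
  show "(\<Sum>v\<in>C. f v) = f a + f b + f c + (\<Sum>v\<in>D. f v)" "card C = 3 + card D"
    using Ce(2) D unfolding Ce(1)
    by (simp_all add: sum.union_disjoint[OF _ D Ce(3)] card_Un_disjoint[OF _ D Ce(3)] del: Un_insert_left)
qed

lemma tri_dN:
  assumes "C \<in> comps" and t: "tri C a b c D"
  shows "dN a = 2 + real (card D)" "dN b = 2" "dN c = 2" "d \<in> D \<Longrightarrow> dN d = 1"
  using t tri_sum(2)[OF assms] by (auto simp: tri_def dN_def)

text \<open>The leaves weigh exactly -1/2 each and combine with the corner \<open>a\<close> so that
  \<open>x a\<close> enters only through the loss \<open>1 - x a\<close>. Hence only the inflow from
  \<open>W\<close> to \<open>b\<close> and \<open>c\<close> has to be repaid.\<close>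

lemma tri_g:
  assumes C: "C \<in> comps" and t: "tri C a b c D"
  shows "(\<Sum>v\<in>C. g v) = x b + x c - 2 - (real (card D) + 1) * (1 - x a)"
proof -
  have "(\<Sum>v\<in>D. g v) = (\<Sum>v\<in>D. - 1 / 2)"
    by (rule sum.cong) (use tri_dN[OF assms] in \<open>auto simp: g_def\<close>)
  then show ?thesis
    by (simp add: tri_sum[OF assms] g_def tri_dN[OF assms] algebra_simps add_divide_distrib)
qed

text \<open>Adding the equations at \<open>b\<close> and \<open>c\<close> absorbs the edge
  \<open>bc\<close> into the factor \<open>l - 1\<close>.\<close>

lemma tri_eig:
  assumes C: "C \<in> comps" and t: "tri C a b c D"
  shows "(l - 1) * (x b + x c) = 2 + 2 * x a + (\<Sum>v\<in>{b, c}. \<Sum>w\<in>AW v. x w)"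
    and "l * x a = 1 + x b + x c + (\<Sum>v\<in>D. x v) + (\<Sum>w\<in>AW a. x w)"
proof -
  have d: "distinct [a, b, c]" "{a, b, c} \<inter> D = {}" and A: "AN a = {b, c} \<union> D" "AN b = {a, c}" "AN c = {a, b}"
    and N: "a \<in> N" "b \<in> N" "c \<in> N"
    using t comp_N[OF C] by (auto simp: tri_def)
  have "l * x b = 1 + (x a + x c) + (\<Sum>w\<in>AW b. x w)" "l * x c = 1 + (x a + x b) + (\<Sum>w\<in>AW c. x w)"
    using eig_N[OF N(2)] eig_N[OF N(3)] A d by auto
  then show "(l - 1) * (x b + x c) = 2 + 2 * x a + (\<Sum>v\<in>{b, c}. \<Sum>w\<in>AW v. x w)"
    using d by (simp add: algebra_simps)
  have "(\<Sum>v\<in>AN a. x v) = x b + x c + (\<Sum>v\<in>D. x v)"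
    unfolding A using d tri_sum(2)[OF assms] by (subst sum.union_disjoint) auto
  then show "l * x a = 1 + x b + x c + (\<Sum>v\<in>D. x v) + (\<Sum>w\<in>AW a. x w)"
    using eig_N[OF N(1)] by simp
qed

lemma tri_mem: "C \<in> comps \<Longrightarrow> tri C a b c D \<Longrightarrow> a \<in> N \<and> b \<in> N \<and> c \<in> N \<and> D \<subseteq> N"
  using comp_N by (auto simp: tri_def)

lemma card_le3: "AN w \<subseteq> {a, b, c} \<Longrightarrow> dN w \<le> 3"
  using card_mono[of "{a, b, c}" "AN w"] card_insert_le_m1[of 3 "{b, c}" a] by (auto simp: dN_def card_insert_if split: if_splits)

text \<open>As \<open>l - 1 > 4\<close>, the sum \<open>x b + x c\<close> is at most 1 plus a
  quarter of the inflow from \<open>W\<close>. By \<open>tri_W\<close> the vertices behind this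
  inflow have at most three neighbours in \<open>N\<close>, so \<open>p_ge_quarter\<close> repays
  that quarter.\<close>

lemma contribution_tri:
  assumes C: "C \<in> comps" and t: "tri C a b c D"
  shows "contribution C \<le> -1"
proof -
  have N: "a \<in> N" "b \<in> N" "c \<in> N" "a \<in> V" "b \<in> V" "c \<in> V" using tri_mem[OF assms] N_V by auto
  have abc: "{a, b, c} \<subseteq> C" using t by (auto simp: tri_def)
  let ?s = "\<Sum>v\<in>{b, c}. \<Sum>w\<in>AW v. x w"
  have "?s \<le> (\<Sum>w\<in>attached C. dN w * x w)"
  proof (rule sigma_eq)
    fix w assume w: "w \<in> W" "AN w \<inter> {b, c} \<noteq> {}"
    then have "AN w \<subseteq> {a, b, c}" using tri_W[OF t N(1-3)] by (auto simp: AN_def)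
    then show "w \<in> attached C" using w abc card_le3[of w a b c] by (auto simp: attached_def)
  qed (use abc comp_fin[OF C] N in auto)
  also have "\<dots> / 4 \<le> (\<Sum>w\<in>attached C. p w)"
    unfolding sum_divide_distrib using p_ge_quarter by (intro sum_mono) (auto simp: attached_def)
  finally have s: "?s / 4 \<le> (\<Sum>w\<in>attached C. p w)" by simp
  have "4 * (x b + x c) \<le> (l - 1) * (x b + x c)" using x01 N l_gt5 by (intro mult_right_mono) auto
  then have "4 * (x b + x c) \<le> 4 + ?s" unfolding tri_eig(1)[OF assms] using x01(2)[OF N(1)] by linarith
  moreover have "(real (card D) + 1) * (1 - x a) \<ge> 0" using x01 N by auto
  moreover have "y - 2 - T - P \<le> - 1" if "4 * y \<le> 4 + s" "0 \<le> T" "s / 4 \<le> P" for y s T P :: real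
    using that by (simp add: field_simps)
  ultimately show ?thesis using s unfolding contribution_def tri_g[OF assms] by blast
qed

section \<open>Weight of a star or a double star\<close>

lemma dstar_sum:
  fixes f :: "'a \<Rightarrow> real"
  assumes "C \<in> comps" and t: "dstar C a a' D D'"
  shows "(\<Sum>v\<in>C. f v) = f a + f a' + (\<Sum>v\<in>D. f v) + (\<Sum>v\<in>D'. f v)" and "finite D" and "finite D'"
    and "card C = 2 + card D + card D'"
proof -
  have "finite C" using comp_fin assms by auto
  moreover have Ce: "C = {a, a'} \<union> (D \<union> D')" "a \<noteq> a'" "{a, a'} \<inter> (D \<union> D') = {}" "D \<inter> D' = {}"
    using t by (auto simp: dstar_def)
  ultimately show D: "finite D" "finite D'" by simp_all
  show "(\<Sum>v\<in>C. f v) = f a + f a' + (\<Sum>v\<in>D. f v) + (\<Sum>v\<in>D'. f v)" "card C = 2 + card D + card D'"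
    using Ce(2,4) D unfolding Ce(1)
    by (simp_all add: sum.union_disjoint[OF _ _ Ce(3)] card_Un_disjoint[OF _ _ Ce(3)]
        sum.union_disjoint card_Un_disjoint del: Un_insert_left)
qed

lemma dstar_dN:
  assumes "C \<in> comps" and t: "dstar C a a' D D'"
  shows "dN a = 1 + real (card D)" "dN a' = 1 + real (card D')" "d \<in> D \<Longrightarrow> dN d = 1" "d \<in> D' \<Longrightarrow> dN d = 1"
  using t dstar_sum(2,3)[OF assms] by (auto simp: dstar_def dN_def)

text \<open>For a leaf the factor \<open>dN d - 1\<close> vanishes, so it weighs exactly -1/2.
  Grouped with its leaves, each centre contributes -1/2 minus its loss.\<close>

lemma dstar_g:
  assumes C: "C \<in> comps" and t: "dstar C a a' D D'"
  shows "(\<Sum>v\<in>C. g v) = - 1 - real (card D) * (1 - x a) - real (card D') * (1 - x a')"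
proof -
  have "(\<Sum>v\<in>D. g v) = (\<Sum>v\<in>D. - 1 / 2)" "(\<Sum>v\<in>D'. g v) = (\<Sum>v\<in>D'. - 1 / 2)"
    by (rule sum.cong; use dstar_dN[OF assms] in \<open>simp add: g_def\<close>)+
  then show ?thesis
    by (simp add: dstar_sum[OF assms] g_def dstar_dN[OF assms] algebra_simps add_divide_distrib)
qed

lemma dstar_mem: "C \<in> comps \<Longrightarrow> dstar C a a' D D' \<Longrightarrow> a \<in> N \<and> a' \<in> N \<and> D \<subseteq> N \<and> D' \<subseteq> N"
  using comp_N by (auto simp: dstar_def)

lemma contribution_dstar:
  assumes C: "C \<in> comps" and t: "dstar C a a' D D'"
  shows "contribution C \<le> -1"
proof -
  have "real (card D) * (1 - x a) \<ge> 0" "real (card D') * (1 - x a') \<ge> 0"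
    using x01 dstar_mem[OF assms] by auto
  then show ?thesis unfolding contribution_def dstar_g[OF assms] using sum_attached_nonneg[of C] by linarith
qed

lemma g_single: "AN v = {} \<Longrightarrow> g v = - x v"
  by (simp add: g_def dN_def)

lemma contribution_single:
  assumes "C = {v}" "AN v = {}" "v \<in> N"
  shows "contribution C \<le> - x v"
  using sum_attached_nonneg[of C] assms by (simp add: contribution_def g_single)

text \<open>Every component that is not a single vertex costs at least 1, and the total cost is less than 2.\<close>

lemma unique_component:
  obtains C where "C \<in> comps" "(\<exists>a b c D. tri C a b c D) \<or> (\<exists>a a' D D'. dstar C a a' D D')"
    "\<And>v. v \<in> N - C \<Longrightarrow> AN v = {}"
proof -
  define S where "S = {C \<in> comps. \<exists>v. C = {v} \<and> AN v = {}}"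
  have fin: "finite S" "finite (comps - S)" using comps_finite by (auto simp: S_def)
  have contribution_S: "contribution C \<le> - (\<Sum>v\<in>C. x v)" if "C \<in> S" for C
  proof -
    from that obtain v where v: "C \<in> comps" "C = {v}" "AN v = {}" unfolding S_def by blast
    then show ?thesis using contribution_single[of C v] comp_N[of C] by simp
  qed
  have S0: "contribution C \<le> 0" if "C \<in> S" for C
  proof -
    have "C \<subseteq> N" using that comp_N by (auto simp: S_def)
    then have "0 \<le> (\<Sum>v\<in>C. x v)" using x01 by (intro sum_nonneg) auto
    then show ?thesis using contribution_S[OF that] by linarith
  qed
  have contribution_n: "contribution C \<le> - 1" if "C \<in> comps - S" for C
  proof -
    have C: "C \<in> comps" using that by auto
    show ?thesis using C
      by (cases rule: comp_cases) (use that contribution_four[OF C] contribution_tri[OF C] contribution_dstar[OF C] in \<open>auto simp: S_def\<close>)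
  qed
  have tot: "- 2 < (\<Sum>C\<in>comps. contribution C)" using gap_le_contribution gap_pos by linarith
  have split: "(\<Sum>C\<in>comps. contribution C) = (\<Sum>C\<in>S. contribution C) + (\<Sum>C\<in>comps - S. contribution C)"
    using sum.subset_diff[of S comps contribution] comps_finite by (auto simp: S_def)
  have sS: "(\<Sum>C\<in>S. contribution C) \<le> 0" using S0 by (intro sum_nonpos) auto
  have "(\<Sum>C\<in>comps - S. contribution C) \<le> (\<Sum>C\<in>comps - S. - 1)" using contribution_n by (intro sum_mono) auto
  then have c1: "card (comps - S) < 2" using tot split sS by simp
  \<comment> \<open>If all components were single vertices, their entries, which sum to
    \<open>l\<close>, would all be lost.\<close>
  have "comps - S \<noteq> {}"
  proof
    assume e: "comps - S = {}"
    then have "comps = S" by (auto simp: S_def)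
    then have "(\<Sum>C\<in>comps. contribution C) \<le> (\<Sum>C\<in>comps. - (\<Sum>v\<in>C. x v))"
      using contribution_S by (intro sum_mono) auto
    also have "\<dots> = - l" unfolding eig_u sum_comps by (simp add: sum_negf)
    finally show False using tot l_gt5 by linarith
  qed
  then have "card (comps - S) = 1" using c1 fin by (metis One_nat_def card_gt_0_iff less_2_cases less_numeral_extra(3))
  then obtain C where CS: "comps - S = {C}" by (auto simp: card_1_singleton_iff)
  then have C: "C \<in> comps" "C \<notin> S" by auto
  have n4: "\<not> four C"
  proof
    assume "four C"
    then have "contribution C \<le> - 2" using contribution_four C by auto
    then show False using tot split sS CS by simp
  qed
  have "(\<exists>a b c D. tri C a b c D) \<or> (\<exists>a a' D D'. dstar C a a' D D')"
    using C(1)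
  proof (cases rule: comp_cases)
    case single then show ?thesis using C unfolding S_def by blast
  qed (use n4 in blast)+
  moreover have "AN v = {}" if v: "v \<in> N - C" for v
  proof -
    obtain C' where "C' \<in> comps" "v \<in> C'" using comps_Union v by blast
    moreover then have "C' \<in> S" using CS v by auto
    ultimately show ?thesis by (auto simp: S_def)
  qed
  ultimately show ?thesis using that C(1) by blast
qed

end

section \<open>A triangle with pendant vertices\<close>

context perron begin

lemma W_nbr: "w \<in> W \<Longrightarrow> AN w = {} \<Longrightarrow> AW w = {} \<Longrightarrow> False"
  using no_isolated[of w] nb_W[of w] W_V by auto

lemma dN_ge1: "AN w \<noteq> {} \<Longrightarrow> dN w \<ge> 1" and dW_ge1: "AW w \<noteq> {} \<Longrightarrow> dW w \<ge> 1"
  using finAN[of w] finAW[of w] by (auto simp: dN_def dW_def Suc_le_eq card_gt_0_iff simp flip: of_nat_1 of_nat_Suc)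

lemma x_single_ge: assumes "v \<in> N" shows "l * x v \<ge> 1"
proof -
  have "0 \<le> (\<Sum>w\<in>AN v. x w)" "0 \<le> (\<Sum>w\<in>AW v. x w)"
    using x01 by (intro sum_nonneg; auto simp: AN_def AW_def)+
  then show ?thesis using eig_N[OF assms] by linarith
qed

lemma x_single_eq: "v \<in> N \<Longrightarrow> AN v = {} \<Longrightarrow> W = {} \<Longrightarrow> l * x v = 1"
  using eig_N[of v] by (auto simp: AW_def)

text \<open>Serves to charge an edge inside \<open>W\<close> at both of its ends.\<close>

lemma W_pair:
  assumes "w \<in> W" "AW w \<noteq> {}"
  obtains w' where "w' \<in> W" "w' \<noteq> w" "AW w' \<noteq> {}"
proof -
  obtain w' where "w' \<in> AW w" using assms by auto
  then have "w' \<in> W" "w' \<noteq> w" "w \<in> AW w'" using assms E_sym E_irrefl by (auto simp: AW_def)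
  then show thesis using that by blast
qed

lemma sum_ge2:
  fixes f :: "'a \<Rightarrow> real"
  assumes "w \<in> W" "w' \<in> W" "w' \<noteq> w" "\<And>v. v \<in> W \<Longrightarrow> f v \<ge> 0"
  shows "f w + f w' \<le> (\<Sum>v\<in>W. f v)"
  using sum_mono2[OF finW, of "{w, w'}" f] assms by auto

lemma sum_ge1:
  fixes f :: "'a \<Rightarrow> real"
  assumes "w \<in> W" "\<And>v. v \<in> W \<Longrightarrow> f v \<ge> 0"
  shows "f w \<le> (\<Sum>v\<in>W. f v)"
  using sum_mono2[OF finW, of "{w}" f] assms by auto

end

section \<open>The unique nontrivial component and the single vertices\<close>

locale perron_comp = perron +
  fixes C :: "'a set"
  assumes C: "C \<in> comps" and rest: "\<And>v. v \<in> N - C \<Longrightarrow> AN v = {}"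
begin

definition "I = N - C"
definition "XI = (\<Sum>v\<in>I. x v)"

lemma N_split: "N = C \<union> I" "C \<inter> I = {}" "finite C" "finite I" "I \<subseteq> N"
  using comp_N[OF C] comp_fin[OF C] finN by (auto simp: I_def)

lemma AN_I: "v \<in> I \<Longrightarrow> AN v = {}"
  using rest by (simp add: I_def)

lemma sum_N: "(\<Sum>v\<in>N. f v) = (\<Sum>v\<in>C. f v) + (\<Sum>v\<in>I. f v)" for f :: "'a \<Rightarrow> real"
  unfolding N_split(1) using N_split by (subst sum.union_disjoint) auto

lemma XI_nonneg: "0 \<le> XI"
  unfolding XI_def using x01 N_split by (intro sum_nonneg) auto

lemma gap_eq: "gap = 2 + (\<Sum>v\<in>C. g v) - XI - (\<Sum>w\<in>W. p w)"
proof -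
  have "(\<Sum>v\<in>I. g v) = - XI" unfolding XI_def using AN_I by (simp add: g_single sum_negf)
  then show ?thesis using gap_identity sum_N[of g] by linarith
qed

lemma l_eq: "l = (\<Sum>v\<in>C. x v) + XI"
  unfolding XI_def by (subst eig_u) (rule sum_N)

lemma card_N: "card N = card C + card I"
  unfolding N_split(1) using N_split by (subst card_Un_disjoint) auto

lemma XI_W0: "W = {} \<Longrightarrow> l * XI = card I"
  unfolding XI_def sum_distrib_left using x_single_eq AN_I N_split by simp

lemma XI_ge: "I \<noteq> {} \<Longrightarrow> l * XI \<ge> 1"
proof -
  assume "I \<noteq> {}"
  then obtain v where v: "v \<in> I" by auto
  have "x v \<le> XI" unfolding XI_def using v x01 N_split by (intro member_le_sum) auto
  then have "l * x v \<le> l * XI" using l_gt5 by (intro mult_left_mono) auto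
  then show ?thesis using x_single_ge[of v] v N_split by auto
qed

lemma sum_sub_I: "A \<subseteq> I \<Longrightarrow> (\<Sum>v\<in>A. x v) \<le> XI"
  unfolding XI_def using x01 N_split by (intro sum_mono2) auto

lemma m_W0:
  assumes "W = {}"
  shows "real m = real (card C) + real (card I) + (\<Sum>v\<in>C. dN v) / 2"
proof -
  have "(\<Sum>v\<in>I. dN v) = 0" using AN_I by (simp add: dN_def)
  then show ?thesis using m_eq assms sum_N[of dN] card_N by simp
qed

end

locale perron_tri = perron_comp +
  fixes a b c :: 'a and D :: "'a set"
  assumes tri: "tri C a b c D"
begin

lemma tri_facts:
  "a \<in> N" "b \<in> N" "c \<in> N" "D \<subseteq> N" "distinct [a, b, c]" "{a, b, c} \<inter> D = {}" "C = {a, b, c} \<union> D"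
  "E a b" "E b a" "E b c" "E c b" "E a c" "E c a" "d \<in> D \<Longrightarrow> E a d" "d \<in> D \<Longrightarrow> E d a"
  using tri_mem[OF C tri] tri E_sym by (auto simp: tri_def AN_def)

lemma I_ne: "a \<notin> I" "b \<notin> I" "c \<notin> I" "v \<in> I \<Longrightarrow> v \<notin> D"
  "v \<in> I \<Longrightarrow> v \<in> N"
  unfolding I_def using tri_facts(7) by auto

lemma D_ne: "a \<notin> D" "b \<notin> D" "c \<notin> D" "v \<in> D \<Longrightarrow> v \<in> N"
  using tri_facts(4,6) by auto

lemma N_cases: "v \<in> N \<Longrightarrow> v = a \<or> v = b \<or> v = c \<or> v \<in> D \<or> v \<in> I"
  unfolding I_def using tri_facts(7) by auto

definition "r = real (card D)"
definition "sbc = (\<Sum>v\<in>{b, c}. \<Sum>w\<in>AW v. x w)"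

lemma r_nonneg: "r \<ge> 0" by (simp add: r_def)

lemma gap_tri: "gap = x b + x c - (r + 1) * (1 - x a) - XI - (\<Sum>w\<in>W. p w)"
  using gap_eq tri_g[OF C tri] by (simp add: r_def)

text \<open>Difference of the equations at \<open>u\<close> and \<open>a\<close>: common neighbours
  cancel, and the edge between the two turns \<open>l\<close> into \<open>l + 1\<close>.\<close>

lemma hub_tri: "(l + 1) * (1 - x a) = XI - (\<Sum>w\<in>AW a. x w)"
proof -
  have "l = x a + x b + x c + (\<Sum>v\<in>D. x v) + XI" using l_eq tri_sum(1)[OF C tri, of x] by simp
  then show ?thesis using tri_eig(2)[OF C tri] by (simp add: algebra_simps)
qed

lemma bc_tri: "(l - 1) * (x b + x c) = 2 + 2 * x a + sbc"
  using tri_eig(1)[OF C tri] by (simp add: sbc_def)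

text \<open>
  \<open>q w\<close> is what remains of the weight \<open>p w\<close> after paying for the gain of \<open>x b + x c\<close> caused by \<open>w\<close>;
  the factor 1/4 bounds \<open>1 / (l - 1)\<close>.
\<close>

definition "j w = real (card {v \<in> {b, c}. E w v})"
definition "q w = p w - j w * x w / 4"

lemma sbc_eq: "sbc = (\<Sum>w\<in>W. j w * x w)"
  unfolding sbc_def j_def by (rule sum_AW_swap) simp

lemma j_le: "j w \<le> dN w" "j w \<le> 2" "j w \<ge> 0"
proof -
  have "{v \<in> {b, c}. E w v} \<subseteq> AN w" using tri_facts by (auto simp: AN_def)
  then show "j w \<le> dN w" unfolding j_def dN_def using finAN by (intro of_nat_mono card_mono) auto
  have "card {v \<in> {b, c}. E w v} \<le> card {b, c}" by (intro card_mono) auto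
  also have "\<dots> \<le> 2" by (simp add: card_insert_if)
  finally show "j w \<le> 2" "j w \<ge> 0" by (auto simp: j_def)
qed

lemma j_pos:
  assumes w: "w \<in> W" "j w \<noteq> 0"
  shows "dN w \<in> {1, 2, 3}"
proof -
  have "E w b \<or> E w c" using w(2) by (auto simp: j_def)
  then have "AN w \<subseteq> {a, b, c}" "AN w \<noteq> {}"
    using tri_W[OF tri tri_facts(1-3) w(1)] tri_facts(2,3) by (auto simp: AN_def)
  then have "dN w \<le> 3" "dN w \<ge> 1" using card_le3 dN_ge1 by auto
  then show ?thesis by (auto simp: dN_def)
qed

lemma q_nonneg: assumes "w \<in> W" shows "q w \<ge> 0"
proof (cases "j w = 0")
  case False
  then have "dN w \<le> 3" using j_pos[OF assms] by auto
  then have "p w \<ge> dN w * x w / 4" using p_ge_quarter assms by auto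
  moreover have "j w * x w \<le> dN w * x w" using j_le x01 assms by (intro mult_right_mono) auto
  ultimately show ?thesis by (simp add: q_def)
qed (use p_nonneg assms in \<open>auto simp: q_def\<close>)

lemma j_x: "w \<in> W \<Longrightarrow> j w * x w \<le> 2 * x w" "w \<in> W \<Longrightarrow> j w * x w \<le> dN w * x w"
  using j_le x01 by (auto intro: mult_right_mono)

lemma q_half: assumes "w \<in> W" "AW w \<noteq> {}" shows "q w \<ge> 1 / 2"
proof (cases "j w = 0")
  case True
  have "dN w * (1 - x w) \<ge> 0" using dN_nonneg x01 assms by auto
  then show ?thesis using dW_ge1[OF assms(2)] True by (simp add: q_def p_def)
next
  case False
  define y where "y = j w * x w"
  show ?thesis
    using j_pos[OF assms(1) False] xW_le[OF assms(1)] dW_ge1[OF assms(2)] j_x[OF assms(1)] x01(3,4)[OF assms(1)]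
    unfolding q_def p_def y_def[symmetric] by auto
qed

lemma tri_W_leaf:
  assumes w: "w \<in> W" and d: "d \<in> AN w" "d \<in> D" and z: "z \<in> AN w" "z \<in> D \<union> I"
  shows "z = d"
proof (rule ccontr)
  assume ne: "z \<noteq> d"
  have z': "z \<in> N" "E w z" "E z w" "z \<noteq> w" using z E_sym WN w by (auto simp: AN_def)
  have d': "d \<in> N" "E w d" "E d w" "d \<noteq> w" using d E_sym WN w by (auto simp: AN_def)
  have ne2: "z \<notin> {a, b, c}" "d \<notin> {a, b, c}" "w \<notin> {a, b, c}" "w \<noteq> u"
    using z d tri_facts(1-3) I_ne D_ne WN w by auto
  show False
    by (rule no_hexagon[of u z w d a b]) (use ne z' d' ne2 tri_facts d uN in auto)
qed

lemma tri_W_hub: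
  assumes w: "w \<in> W" and a: "a \<in> AN w" and z: "z \<in> AN w"
  shows "z \<notin> I"
proof
  assume zI: "z \<in> I"
  have z': "z \<in> N" "E w z" "E z w" "z \<noteq> w" using z E_sym WN w by (auto simp: AN_def)
  have a': "E w a" using a by (auto simp: AN_def)
  have ne2: "z \<notin> {a, b, c}" "w \<notin> {a, b, c}" "w \<noteq> u"
    using zI tri_facts(1-3) I_ne WN w by auto
  show False
    by (rule no_hexagon[of u z w a b c]) (use z' a' ne2 tri_facts uN in auto)
qed

text \<open>An edge inside \<open>W\<close> costs 1/2 at each end. Otherwise a single vertex
  suffices; the value 3/4 comes from a vertex with no neighbour in \<open>W\<close> and only
  \<open>b\<close> or \<open>c\<close> as neighbour in \<open>N\<close>, where
  \<open>x w \<le> 1 / 5\<close> leaves 4/5 - 1/20.\<close>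

lemma tri_W_cost:
  assumes "W \<noteq> {}"
  shows "XI + (\<Sum>w\<in>W. q w) \<ge> 3 / 4"
proof (cases "\<exists>w\<in>W. AW w \<noteq> {}")
  case True
  then obtain w where w: "w \<in> W" "AW w \<noteq> {}" by auto
  obtain w' where w': "w' \<in> W" "w' \<noteq> w" "AW w' \<noteq> {}" using W_pair[OF w] .
  have "q w + q w' \<le> (\<Sum>v\<in>W. q v)" using sum_ge2[OF w(1) w'(1,2)] q_nonneg by auto
  then show ?thesis using q_half[OF w] q_half[OF w'(1,3)] XI_nonneg by linarith
next
  case False
  obtain w where w: "w \<in> W" using assms by auto
  have AW: "AW w = {}" using False w by auto
  have AN: "AN w \<noteq> {}" using W_nbr w AW by auto
  have dW: "dW w = 0" using AW by (simp add: dW_def)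
  have q: "q w \<le> (\<Sum>v\<in>W. q v)" by (rule sum_ge1[OF w q_nonneg])
  show ?thesis
  proof (cases "j w = 0")
    case j0: False
    define y where "y = j w * x w"
    have "q w \<ge> 3 / 4"
      using j_pos[OF w j0] xW_le[OF w] j_x[OF w] x01(3,4)[OF w]
      unfolding q_def p_def dW y_def[symmetric] by auto
    then show ?thesis using q XI_nonneg by linarith
  next
    case j0: True
    have bc: "b \<notin> AN w" "c \<notin> AN w" using j0 tri_facts(5) by (auto simp: j_def AN_def)
    have qp: "q w = dN w * (1 - x w)" by (simp add: q_def p_def dW j0)
    show ?thesis
    proof (cases "AN w \<subseteq> I")
      case True
      \<comment> \<open>If \<open>w\<close> sees single vertices only, the amount \<open>x w\<close>
        by which its cost falls short of 1 is covered by \<open>XI\<close>.\<close>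
      have "l * x w = (\<Sum>v\<in>AN w. x v)" using eig_W[OF w] AW by simp
      also have "\<dots> \<le> XI" by (rule sum_sub_I[OF True])
      finally have "x w \<le> XI" using five[of w] w W_V x01(3)[OF w] by force
      moreover have "1 * (1 - x w) \<le> dN w * (1 - x w)"
        using dN_ge1[OF AN] x01(4)[OF w] by (intro mult_right_mono) auto
      then have "1 - x w \<le> q w" unfolding qp mult_1 .
      ultimately show ?thesis using q by linarith
    next
      case False
      have sub: "AN w \<subseteq> {a} \<union> D \<union> I" using bc AN_N[of w] N_cases by blast
      have "\<exists>d. AN w \<subseteq> {a, d}"
      proof (cases "AN w \<inter> D = {}")
        case True
        then have "a \<in> AN w" using False sub by auto
        then show ?thesis using tri_W_hub[OF w] sub True by blast
      next
        case False
        then obtain d where "d \<in> AN w" "d \<in> D" by auto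
        then show ?thesis using tri_W_leaf[OF w] sub by blast
      qed
      then obtain d where d: "AN w \<subseteq> {a, d}" by auto
      have "card (AN w) \<le> card {a, d}" using d by (intro card_mono) auto
      also have "\<dots> \<le> 2" by (simp add: card_insert_if)
      finally have "dN w \<in> {1, 2}" using dN_ge1[OF AN] by (auto simp: dN_def)
      then have "q w \<ge> 3 / 4" using xW_le[OF w] unfolding qp dW by auto
      then show ?thesis using q XI_nonneg by linarith
    qed
  qed
qed

text \<open>The term \<open>4 / (l - 1)\<close> is the bound for \<open>x b + x c\<close> without
  inflow from \<open>W\<close>. The inflow is paid for by the passage from \<open>p\<close> to
  \<open>q\<close>, and what is left of the costs is at least 3/4.\<close>

lemma tri_W_bound:
  assumes "W \<noteq> {}"
  shows "gap \<le> 4 / (l - 1) - 3 / 4"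
proof -
  have l1: "l - 1 > 4" using l_gt5 by simp
  have a: "0 \<le> 1 - x a" "x a \<le> 1" using x01 tri_facts(1) by auto
  have sbc0: "sbc \<ge> 0" unfolding sbc_eq using j_le x01 by (intro sum_nonneg) auto
  have "x b + x c = (2 + 2 * x a + sbc) / (l - 1)" using bc_tri l1 by (simp add: field_simps)
  also have "\<dots> = (2 + 2 * x a) / (l - 1) + sbc / (l - 1)" by (simp add: add_divide_distrib)
  also have "(2 + 2 * x a) / (l - 1) \<le> 4 / (l - 1)" using l1 a by (intro divide_right_mono) auto
  also have "sbc / (l - 1) \<le> sbc / 4" using l1 sbc0 by (intro divide_left_mono) auto
  finally have "x b + x c \<le> 4 / (l - 1) + sbc / 4" by simp
  moreover have "(r + 1) * (1 - x a) \<ge> 0" using r_nonneg a by auto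
  moreover have "(\<Sum>w\<in>W. q w) = (\<Sum>w\<in>W. p w) - sbc / 4"
    unfolding q_def sbc_eq by (simp add: sum_subtractf sum_divide_distrib)
  ultimately show ?thesis using gap_tri tri_W_cost[OF assms] by linarith
qed

text \<open>Single vertices now have entry \<open>1 / l\<close>, so \<open>XI = i / l\<close> and
  the deficit \<open>t\<close> of the corner \<open>a\<close> is explicit. The gap becomes a
  function of \<open>l\<close>, \<open>r\<close> and \<open>i\<close>, ready to be compared with
  \<open>psi2\<close>.\<close>

lemma tri_W0:
  assumes W0: "W = {}"
  defines "i \<equiv> real (card I)" and "t \<equiv> 1 - x a"
  shows "real m = 2 * (r + 3) + i" "l * (l + 1) * t = i"
    "(l - 1) * gap = 4 - 2 * t - (l - 1) * ((r + 1) * t + i / l)"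
proof -
  have "(\<Sum>v\<in>D. dN v) = (\<Sum>v\<in>D. 1)" using tri_dN(4)[OF C tri] by (intro sum.cong) auto
  then show "real m = 2 * (r + 3) + i"
    unfolding m_W0[OF W0] i_def tri_sum(1,3)[OF C tri] tri_dN(1-3)[OF C tri] r_def
    by (simp add: tri_sum(3)[OF C tri] field_simps)
  have l0: "l > 0" using l_gt5 by simp
  have XI: "XI = i / l" using XI_W0[OF W0] l0 by (simp add: i_def field_simps)
  have AW: "AW v = {}" for v using W0 by (simp add: AW_def)
  have "(l + 1) * t = XI" using hub_tri by (simp add: t_def AW)
  then show "l * (l + 1) * t = i" using XI l0 by (simp add: field_simps)
  have "sbc = 0" by (simp add: sbc_def AW)
  then have "(l - 1) * (x b + x c) = 4 - 2 * t" using bc_tri by (simp add: t_def)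
  then show "(l - 1) * gap = 4 - 2 * t - (l - 1) * ((r + 1) * t + i / l)"
    unfolding gap_tri XI t_def W0 by (simp add: algebra_simps)
qed

end

section \<open>A star or a double star\<close>

lemma (in perron) dstar_swap: "dstar C a a' D D' \<Longrightarrow> dstar C a' a D' D"
  unfolding dstar_def by (simp add: Un_ac Int_ac insert_commute eq_commute[of a a'] conj_ac)

text \<open>The order of the centres is fixed by \<open>D_ge\<close>, which guarantees leaves at
  \<open>a\<close>; for a star \<open>D'\<close> is empty.\<close>

locale perron_dstar = perron_comp +
  fixes a a' :: 'a and D D' :: "'a set"
  assumes dstar: "dstar C a a' D D'" and D_ge: "card D' \<le> card D"
begin

lemma ds_facts:
  "a \<in> N" "a' \<in> N" "a \<noteq> a'" "E a a'" "E a' a" "d \<in> D \<Longrightarrow> E a d" "d \<in> D \<Longrightarrow> E d a"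
  "d \<in> D' \<Longrightarrow> E a' d" "d \<in> D' \<Longrightarrow> E d a'" "a \<notin> D" "a' \<notin> D" "a \<notin> D'" "a' \<notin> D'"
  "d \<in> D \<Longrightarrow> d \<in> N" "d \<in> D' \<Longrightarrow> d \<in> N"
  using dstar_mem[OF C dstar] dstar E_sym by (auto simp: dstar_def AN_def)

lemma ds_disj: "d \<in> D \<Longrightarrow> d' \<in> D' \<Longrightarrow> d \<noteq> d'"
  using dstar by (auto simp: dstar_def)

lemma C_eq: "C = {a, a'} \<union> D \<union> D'"
  using dstar by (auto simp: dstar_def)

lemma AN_ds: "AN a = insert a' D" "AN a' = insert a D'" "d \<in> D \<Longrightarrow> AN d = {a}" "d \<in> D' \<Longrightarrow> AN d = {a'}"
  using dstar by (auto simp: dstar_def)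

lemma fin_ds: "finite D" "finite D'"
  using dstar_sum(2,3)[OF C dstar] by auto

lemma I_ne: "a \<notin> I" "a' \<notin> I" "v \<in> I \<Longrightarrow> v \<notin> D" "v \<in> I \<Longrightarrow> v \<notin> D'" "v \<in> I \<Longrightarrow> v \<in> N"
  unfolding I_def using C_eq by auto

lemma N_cases: "v \<in> N \<Longrightarrow> v = a \<or> v = a' \<or> v \<in> D \<or> v \<in> D' \<or> v \<in> I"
  unfolding I_def using C_eq by auto

definition "s = real (card D)"
definition "s' = real (card D')"

lemma s_ge: "0 \<le> s'" "s' \<le> s"
  using D_ge by (auto simp: s_def s'_def)

lemma gap_ds: "gap = 1 - s * (1 - x a) - s' * (1 - x a') - XI - (\<Sum>w\<in>W. p w)"
  using gap_eq dstar_g[OF C dstar] by (simp add: s_def s'_def)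

text \<open>The losses in \<open>gap_ds\<close> are nonnegative and add up to
  \<open>1 - gap\<close>.\<close>

lemma cost_parts: "XI < 1" "(\<Sum>w\<in>W. p w) < 1" "XI + (\<Sum>w\<in>W. p w) \<le> 1 - gap"
    "s * (1 - x a) \<le> 1 - gap" "s' * (1 - x a') \<le> 1 - gap"
proof -
  have a: "s * (1 - x a) \<ge> 0" "s' * (1 - x a') \<ge> 0" using s_ge x01 ds_facts(1,2) by auto
  have P: "(\<Sum>w\<in>W. p w) \<ge> 0" using p_nonneg by (intro sum_nonneg) auto
  show "XI < 1" "(\<Sum>w\<in>W. p w) < 1" "XI + (\<Sum>w\<in>W. p w) \<le> 1 - gap"
    "s * (1 - x a) \<le> 1 - gap" "s' * (1 - x a') \<le> 1 - gap"
    using a P XI_nonneg gap_ds gap_pos by simp_all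
qed

text \<open>The entries on \<open>C\<close> sum to \<open>l - XI > 4\<close> and none exceeds 1, so
  \<open>C\<close> has at least five vertices. These supply the spare leaves for the hexagons
  below.\<close>

lemma s_sum: "s + s' \<ge> 3" "s \<ge> 2"
proof -
  have "(\<Sum>v\<in>C. x v) \<le> (\<Sum>v\<in>C. 1)" using x01 N_split by (intro sum_mono) auto
  also have "\<dots> = 2 + s + s'" using dstar_sum(4)[OF C dstar] by (simp add: s_def s'_def)
  finally have "2 + s + s' > 4" using l_eq cost_parts(1) l_gt5 by linarith
  then have "card D + card D' > 2" by (simp add: s_def s'_def)
  then show "s + s' \<ge> 3" "s \<ge> 2" using D_ge by (auto simp: s_def s'_def)
qed

lemma AW_empty: assumes w: "w \<in> W" shows "AW w = {}"
proof (rule ccontr)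
  assume n: "AW w \<noteq> {}"
  obtain w' where w': "w' \<in> W" "w' \<noteq> w" "AW w' \<noteq> {}" using W_pair[OF w n] .
  have half: "p v \<ge> 1 / 2" if "v \<in> W" "AW v \<noteq> {}" for v
  proof -
    have "dN v * (1 - x v) \<ge> 0" using dN_nonneg x01 that by auto
    then show ?thesis using dW_ge1[OF that(2)] by (simp add: p_def)
  qed
  have "p w + p w' \<le> (\<Sum>v\<in>W. p v)" using sum_ge2[OF w w'(1,2)] p_nonneg by auto
  then show False using half[OF w n] half[OF w'(1,3)] cost_parts(2) by linarith
qed

lemma D_ex: "\<exists>d. d \<in> D"
proof -
  have "card D \<noteq> 0" using s_sum(2) by (auto simp: s_def)
  then show ?thesis by (auto simp: card_eq_0_iff)
qed

lemma AN_w_N: "v \<in> AN w \<Longrightarrow> w \<in> W \<Longrightarrow> v \<in> N \<and> E w v \<and> E v w \<and> v \<noteq> w \<and> w \<noteq> v"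
  using E_sym WN by (auto simp: AN_def)

lemma W_ne: "w \<in> W \<Longrightarrow> w \<noteq> a" "w \<in> W \<Longrightarrow> w \<noteq> a'" "w \<in> W \<Longrightarrow> w \<noteq> u" "w \<in> W \<Longrightarrow> w \<notin> D" "w \<in> W \<Longrightarrow> w \<notin> D'"
  using WN(1)[of _ w] ds_facts(1,2,14,15) u_W by blast+

text \<open>Counting \<open>a'\<close>, the star has at least four leaves; one of them avoids
  \<open>v\<close> and \<open>z\<close> and closes a hexagon.\<close>

lemma star_leaf:
  assumes w: "w \<in> W" and D': "D' = {}" and v: "v \<in> AN w" "v \<in> insert a' D" and z: "z \<in> AN w"
  shows "z \<in> {a, v}"
proof (rule ccontr)
  assume nz: "z \<notin> {a, v}"
  have L: "E a y" "E y a" "y \<in> N" "y \<noteq> a" "y \<noteq> w" if "y \<in> insert a' D" for y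
    using that ds_facts W_ne[OF w] by auto
  have "card D + card D' \<ge> 3" using s_sum(1) by (simp add: s_def s'_def)
  then have c3: "card D \<ge> 3" using D' by simp
  have "\<exists>l. l \<in> insert a' D - {v, z}"
  proof -
    have "card (insert a' D) \<ge> 4" using c3 fin_ds ds_facts by simp
    moreover have "card {v, z} \<le> 2" by (simp add: card_insert_if)
    ultimately have "\<not> insert a' D \<subseteq> {v, z}" using card_mono[of "{v, z}" "insert a' D"] by auto
    then show ?thesis by auto
  qed
  then obtain l3 where l3: "l3 \<in> insert a' D" "l3 \<noteq> v" "l3 \<noteq> z" by auto
  have z': "z \<in> N \<and> E w z \<and> E z w \<and> z \<noteq> w \<and> w \<noteq> z" by (rule AN_w_N[OF z w])
  have v': "v \<in> N \<and> E w v \<and> E v w \<and> v \<noteq> w \<and> w \<noteq> v" by (rule AN_w_N[OF v(1) w])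
  show False
    by (rule no_hexagon[of u z w v a l3])
      (use nz L[OF v(2)] L[OF l3(1)] l3 z' v' uN W_ne[OF w] ds_facts(1) in auto)
qed

text \<open>If \<open>z = a'\<close>, a leaf of \<open>a'\<close> closes the hexagon; otherwise
  \<open>a'\<close> itself does.\<close>

lemma dstar_leaf:
  assumes w: "w \<in> W" and ne: "D' \<noteq> {}" and v: "v \<in> AN w" "v \<in> D" and z: "z \<in> AN w"
  shows "z \<in> {a, v}"
proof (rule ccontr)
  assume nz: "z \<notin> {a, v}"
  have z': "z \<in> N \<and> E w z \<and> E z w \<and> z \<noteq> w \<and> w \<noteq> z" by (rule AN_w_N[OF z w])
  have v': "v \<in> N \<and> E w v \<and> E v w \<and> v \<noteq> w \<and> w \<noteq> v" by (rule AN_w_N[OF v(1) w])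
  have va: "E v a" "E a v" "v \<noteq> a" "v \<noteq> a'" using v ds_facts by auto
  obtain d' where d': "d' \<in> D'" using ne by auto
  have d'': "E a' d'" "E d' a'" "d' \<in> N" "d' \<noteq> a" "d' \<noteq> a'" "d' \<noteq> v" "d' \<noteq> w"
    using d' v ds_facts W_ne[OF w] ds_disj[OF v(2) d'] by auto
  show False
  proof (cases "z = a'")
    case True
    show False
      by (rule no_hexagon[of u d' a' w v a])
        (use True d'' nz va z' v' uN W_ne[OF w] ds_facts(1-5) in auto)
  next
    case False
    show False
      by (rule no_hexagon[of u z w v a a'])
        (use False nz va z' v' uN W_ne[OF w] ds_facts(1-5) in auto)
  qed
qed

lemma dstar_leaf':
  assumes w: "w \<in> W" and v: "v \<in> AN w" "v \<in> D'" and z: "z \<in> AN w"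
  shows "z \<in> {a', v}"
proof (rule ccontr)
  assume nz: "z \<notin> {a', v}"
  have z': "z \<in> N \<and> E w z \<and> E z w \<and> z \<noteq> w \<and> w \<noteq> z" by (rule AN_w_N[OF z w])
  have v': "v \<in> N \<and> E w v \<and> E v w \<and> v \<noteq> w \<and> w \<noteq> v" by (rule AN_w_N[OF v(1) w])
  have va: "E v a'" "E a' v" "v \<noteq> a" "v \<noteq> a'" using v ds_facts by auto
  obtain d where d: "d \<in> D" using D_ex by auto
  have d'': "E a d" "E d a" "d \<in> N" "d \<noteq> a" "d \<noteq> a'" "d \<noteq> v" "d \<noteq> w"
    using d v ds_facts W_ne[OF w] ds_disj[OF d v(2)] by auto
  show False
  proof (cases "z = a")
    case True
    show False
      by (rule no_hexagon[of u d a w v a'])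
        (use True d'' nz va z' v' uN W_ne[OF w] ds_facts(1-5) in auto)
  next
    case False
    show False
      by (rule no_hexagon[of u z w v a' a])
        (use False nz va z' v' uN W_ne[OF w] ds_facts(1-5) in auto)
  qed
qed

lemma dstar_hubs:
  assumes w: "w \<in> W" and ne: "D' \<noteq> {}" and v: "a \<in> AN w" "a' \<in> AN w"
  shows False
proof -
  have v': "E w a" "E a w" "E w a'" "E a' w" using AN_w_N[OF v(1) w] AN_w_N[OF v(2) w] by auto
  obtain d where d: "d \<in> D" using D_ex by auto
  have d1: "E a d" "E d a" "d \<in> N" "d \<noteq> a" "d \<noteq> a'" "d \<noteq> w"
    using d v ds_facts W_ne[OF w] by auto
  obtain d' where d': "d' \<in> D'" using ne by auto
  have d'': "E a' d'" "E d' a'" "d' \<in> N" "d' \<noteq> a" "d' \<noteq> a'" "d' \<noteq> w" "d' \<noteq> d" "d \<noteq> d'"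
    using d' v ds_facts W_ne[OF w] ds_disj[OF d d'] by auto
  show False
    by (rule no_hexagon[of u d a w a' d'])
      (use d' d'' d1 v' uN W_ne[OF w] ds_facts(1-5) in auto)
qed

text \<open>By the hexagon arguments \<open>w\<close> has at most two neighbours in
  \<open>N\<close>, or at most one centre together with single vertices, whose entries sum to
  \<open>XI < 1\<close>.\<close>

lemma W_sum2: assumes w: "w \<in> W" shows "(\<Sum>v\<in>AN w. x v) \<le> 2"
proof -
  have sub2: "(\<Sum>v\<in>AN w. x v) \<le> 2" if "AN w \<subseteq> {y, z}" for y z
  proof -
    have "(\<Sum>v\<in>AN w. x v) \<le> (\<Sum>v\<in>AN w. 1)" using x01 by (intro sum_mono) (auto simp: AN_def)
    also have "\<dots> \<le> real (card {y, z})" using that card_mono[of "{y, z}" "AN w"] by simp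
    also have "\<dots> \<le> 2" by (simp add: card_insert_if)
    finally show ?thesis .
  qed
  have subI: "(\<Sum>v\<in>AN w. x v) \<le> 2" if A: "AN w \<subseteq> insert y I" and y: "y \<in> N" for y
  proof -
    have "(\<Sum>v\<in>AN w. x v) \<le> (\<Sum>v\<in>insert y I. x v)"
      using A x01 N_split y by (intro sum_mono2) auto
    also have "\<dots> \<le> x y + XI" unfolding XI_def using x01 y N_split(4) by (simp add: sum.insert_if)
    finally show ?thesis using cost_parts(1) x01(2)[OF y] by linarith
  qed
  have A: "AN w \<subseteq> N" by (rule AN_N)
  show ?thesis
  proof (cases "D' = {}")
    case True
    show ?thesis
    proof (cases "AN w \<inter> insert a' D = {}")
      case True
      then have "AN w \<subseteq> insert a I" using A N_cases \<open>D' = {}\<close> by blast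
      then show ?thesis using subI ds_facts(1) by blast
    next
      case False
      then obtain v where v: "v \<in> AN w" "v \<in> insert a' D" by auto
      have "AN w \<subseteq> {a, v}" using star_leaf[OF w True v] by auto
      then show ?thesis by (rule sub2)
    qed
  next
    case False
    consider v where "v \<in> AN w" "v \<in> D" | v where "v \<in> AN w" "v \<in> D'" | "AN w \<inter> (D \<union> D') = {}" by blast
    then show ?thesis
    proof cases
      case (1 v)
      have "AN w \<subseteq> {a, v}" using dstar_leaf[OF w False 1] by auto
      then show ?thesis by (rule sub2)
    next
      case (2 v)
      have "AN w \<subseteq> {a', v}" using dstar_leaf'[OF w 2] by auto
      then show ?thesis by (rule sub2)
    next
      case 3
      then have "AN w \<subseteq> insert a I \<or> AN w \<subseteq> insert a' I"
        using A N_cases dstar_hubs[OF w False] by blast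
      then show ?thesis using subI ds_facts(1,2) by blast
    qed
  qed
qed

lemma sum_dN_ds: "(\<Sum>v\<in>C. dN v) = 2 + 2 * s + 2 * s'"
proof -
  have "(\<Sum>v\<in>D. dN v) = s" "(\<Sum>v\<in>D'. dN v) = s'"
    using dstar_dN(3,4)[OF C dstar] by (simp_all add: s_def s'_def)
  then show ?thesis
    unfolding dstar_sum(1)[OF C dstar] dstar_dN(1,2)[OF C dstar] by (simp add: s_def s'_def)
qed

text \<open>Every vertex of \<open>W\<close> has entry at most 2/5 and costs at least 3/5, so there
  is only one and it has one neighbour in \<open>N\<close>. A single vertex in \<open>I\<close>
  would make \<open>XI \<ge> x w\<close> and push the cost to 1. What remains has an even number of
  edges and \<open>gap \<le> x w \<le> 1 / 5\<close>, contrary to \<open>even_half\<close>.\<close>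

lemma dstar_W:
  assumes ne: "W \<noteq> {}"
  shows "even m \<and> gap < 1 / 2"
proof -
  obtain w where w: "w \<in> W" using ne by auto
  have AN: "AN v \<noteq> {}" if "v \<in> W" for v using W_nbr AW_empty that by auto
  have dW: "dW v = 0" if "v \<in> W" for v using AW_empty that by (simp add: dW_def)
  have x25: "x v \<le> 2 / 5" if "v \<in> W" for v
    using eig_W[OF that] AW_empty[OF that] W_sum2[OF that] five[of v] that W_V by auto
  have p06: "p v \<ge> 3 / 5 * dN v" if "v \<in> W" for v
  proof -
    have "dN v * (1 - x v) \<ge> dN v * (3 / 5)" using x25[OF that] dN_nonneg by (intro mult_left_mono) auto
    then show ?thesis by (simp add: p_def dW[OF that] mult.commute)
  qed
  have W: "W = {w}"
  proof (rule ccontr)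
    assume "W \<noteq> {w}"
    then obtain w' where w': "w' \<in> W" "w' \<noteq> w" using w by auto
    have "p w + p w' \<le> (\<Sum>v\<in>W. p v)" using sum_ge2[OF w w'] p_nonneg by auto
    then show False using p06[OF w] p06[OF w'(1)] dN_ge1[OF AN[OF w]] dN_ge1[OF AN[OF w'(1)]] cost_parts(2)
      by linarith
  qed
  have pw: "p w < 1" using cost_parts(2) W by simp
  have "dN w < 2" using p06[OF w] pw by simp
  then have "card (AN w) = 1" using dN_ge1[OF AN[OF w]] by (simp add: dN_def)
  then obtain y where y: "AN w = {y}" by (auto simp: card_1_singleton_iff)
  have dNw: "dN w = 1" by (simp add: dN_def y)
  have yN: "y \<in> N" using y AN_N[of w] by auto
  have lx: "l * x w \<le> 1" using eig_W[OF w] AW_empty[OF w] y x01(2)[OF yN] by simp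
  have pw': "p w = 1 - x w" using dNw dW[OF w] by (simp add: p_def)
  have cost: "XI + (1 - x w) \<le> 1 - gap" using cost_parts(3) W pw' by simp
  have I: "I = {}"
  proof (rule ccontr)
    assume "I \<noteq> {}"
    then have "l * x w \<le> l * XI" using XI_ge lx by linarith
    then have "x w \<le> XI" using l_gt5 by simp
    then show False using cost gap_pos by linarith
  qed
  have "real m = real (card C) + (\<Sum>v\<in>C. dN v) / 2 + 1"
    using m_eq card_N I sum_N[of dN] W dNw dW[OF w] by simp
  also have "\<dots> = real (2 * (card D + card D' + 2))"
    unfolding sum_dN_ds dstar_sum(4)[OF C dstar] by (simp add: s_def s'_def)
  finally have "m = 2 * (card D + card D' + 2)" by (simp only: of_nat_eq_iff)
  then have "even m" by simp
  moreover have "5 * x w \<le> 1" using lx five[of w] w W_V by auto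
  then have "gap < 1 / 2" using cost XI_nonneg by simp
  ultimately show ?thesis by simp
qed

text \<open>Each centre equation is subtracted from the one at \<open>u\<close>; on the right remain
  the vertices seen by \<open>u\<close> only, that is, the leaves of the other centre and the single
  vertices.\<close>

lemma dstar_W0:
  assumes W0: "W = {}"
  defines "i \<equiv> real (card I)"
  shows "real m = 2 * (s + s') + 3 + i"
    and "l * (l + 1) * (1 - x a) = s' * (1 + x a') + i"
    and "l * (l + 1) * (1 - x a') = s * (1 + x a) + i"
    and "gap = 1 - s * (1 - x a) - s' * (1 - x a') - i / l"
proof -
  have l0: "l > 0" using l_gt5 by simp
  have XI: "XI = i / l" using XI_W0[OF W0] l0 by (simp add: i_def field_simps)
  show "real m = 2 * (s + s') + 3 + i"
    unfolding m_W0[OF W0] i_def sum_dN_ds by (simp add: dstar_sum(4)[OF C dstar] s_def s'_def)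
  show "gap = 1 - s * (1 - x a) - s' * (1 - x a') - i / l"
    unfolding gap_ds W0 XI by simp
  have AW: "AW v = {}" for v using W0 by (simp add: AW_def)
  have lD: "l * (\<Sum>v\<in>D. x v) = s * (1 + x a)"
    using eig_N ds_facts AN_ds(3) unfolding sum_distrib_left s_def by (simp add: AW)
  have lD': "l * (\<Sum>v\<in>D'. x v) = s' * (1 + x a')"
    using eig_N ds_facts AN_ds(4) unfolding sum_distrib_left s'_def by (simp add: AW)
  have la: "l * x a = 1 + x a' + (\<Sum>v\<in>D. x v)" "l * x a' = 1 + x a + (\<Sum>v\<in>D'. x v)"
    using eig_N[OF ds_facts(1)] eig_N[OF ds_facts(2)] fin_ds ds_facts unfolding AN_ds by (simp_all add: AW)
  have tot: "l = x a + x a' + (\<Sum>v\<in>D. x v) + (\<Sum>v\<in>D'. x v) + XI"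
    using l_eq dstar_sum(1)[OF C dstar, of x] by simp
  have "(l + 1) * (1 - x a) = (\<Sum>v\<in>D'. x v) + XI" "(l + 1) * (1 - x a') = (\<Sum>v\<in>D. x v) + XI"
    using la tot by (simp_all add: algebra_simps)
  then have "l * ((l + 1) * (1 - x a)) = l * (\<Sum>v\<in>D'. x v) + l * XI"
    "l * ((l + 1) * (1 - x a')) = l * (\<Sum>v\<in>D. x v) + l * XI"
    by (simp_all only: distrib_left)
  then show "l * (l + 1) * (1 - x a) = s' * (1 + x a') + i" "l * (l + 1) * (1 - x a') = s * (1 + x a) + i"
    unfolding lD lD' using XI_W0[OF W0] by (simp_all add: i_def mult.assoc)
qed

end

section \<open>Consequences of \<open>\<psi>\<^sub>2(\<lambda>) \<ge> 0\<close>\<close>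

text \<open>In terms of \<open>d = l\<^sup>2 - l - m + 2\<close> the four polynomials become linear in \<open>d\<close>.\<close>

lemma psi2_even_small:
  assumes "even m" "m \<le> 72"
  shows "psi2 m l = (l - 1) * (l^2 - l - real m + 2) - 4"
  using assms by (simp add: psi2_def algebra_simps power2_eq_square power3_eq_cube)

lemma psi2_even_large:
  fixes l :: real
  assumes "even m" "\<not> m \<le> 72"
  defines "d \<equiv> l^2 - l - real m + 2" and "L \<equiv> l * (l + 1)"
  shows "2 * psi2 m l = 2 * (d * L) - (L + d)"
  using assms by (simp add: psi2_def algebra_simps power2_eq_square power4_eq_xxxx)

lemma psi2_odd_small:
  fixes l :: real
  assumes "odd m" "m \<le> 71"
  defines "d \<equiv> l^2 - l - real m + 2" and "L \<equiv> l * (l + 1)"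
  shows "2 * psi2 m l = 2 * (l - 1) * (d * L) - (8 * L - (l - 1) * L - 4 + (l - 1) * (1 + d))"
  using assms by (simp add: psi2_def algebra_simps numeral_eq_Suc add_divide_distrib diff_divide_distrib)

lemma psi2_odd_large:
  fixes l :: real
  assumes "odd m" "\<not> m \<le> 71"
  defines "d \<equiv> l^2 - l - real m + 2" and "L \<equiv> l * (l + 1)"
  shows "psi2 m l = d * L - (1 + d)"
  using assms by (simp add: psi2_def algebra_simps power2_eq_square power4_eq_xxxx)

lemma sq_gap_ge:
  fixes l c :: real
  assumes "l^2 - l \<ge> c^2 - c" "c \<ge> 1" "l \<ge> 1"
  shows "l \<ge> c"
proof (rule ccontr)
  assume "\<not> l \<ge> c"
  then have "(c - l) * (c + l - 1) > 0" using assms by (intro mult_pos_pos) auto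
  then show False using assms(1) by (simp add: algebra_simps power2_eq_square)
qed

text \<open>Here the graph is forgotten: \<open>d\<close> stands for \<open>gap\<close>, and the
  comparison with \<open>psi2\<close> is a matter of real numbers.\<close>

locale large_root =
  fixes m :: nat and l d L :: real
  assumes l5: "l > 5" and d_pos: "d > 0" and d_def: "d = l^2 - l - real m + 2" and psi: "psi2 m l \<ge> 0"
    and L_def: "L = l * (l + 1)"
begin

lemma L30: "L > 30"
proof -
  have "5 * 6 < l * (l + 1)" using l5 by (intro mult_strict_mono) auto
  then show ?thesis by (simp add: L_def)
qed

lemma m_eq_d: "real m = l^2 - l + 2 - d"
  by (simp add: d_def)

lemma L_sq: "L = l^2 + l"
  by (simp add: L_def power2_eq_square algebra_simps)

lemma even_small: "even m \<Longrightarrow> m \<le> 72 \<Longrightarrow> (l - 1) * d \<ge> 4"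
  using psi psi2_even_small by (simp add: d_def)

lemma even_large: "even m \<Longrightarrow> \<not> m \<le> 72 \<Longrightarrow> L + d \<le> 2 * (d * L)"
  using psi psi2_even_large[of m l] by (simp add: d_def L_def)

lemma odd_small: "odd m \<Longrightarrow> m \<le> 71 \<Longrightarrow> 8 * L - (l - 1) * L - 4 + (l - 1) * (1 + d) \<le> 2 * (l - 1) * (d * L)"
  using psi psi2_odd_small[of m l] by (simp add: d_def L_def)

lemma odd_large: "odd m \<Longrightarrow> \<not> m \<le> 71 \<Longrightarrow> 1 + d \<le> d * L"
  using psi psi2_odd_large[of m l] by (simp add: d_def L_def)

lemma even_large_half:
  assumes "even m" "\<not> m \<le> 72"
  shows "d > 1 / 2" "l > 9"
proof -
  have "0 < (2 * d - 1) * L" using even_large[OF assms] d_pos by (simp add: algebra_simps)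
  then show d: "d > 1 / 2" using L30 by (simp add: zero_less_mult_iff)
  have "m \<ge> 74" using assms by presburger
  \<comment> \<open>The left side is \<open>m - 2 + d > 72.5\<close>, while 9.01^2 - 9.01 <
    72.2.\<close>
  then have "l^2 - l \<ge> (9.01::real)^2 - 9.01" using m_eq_d d by (simp add: power2_eq_square)
  then have "l \<ge> 9.01" by (rule sq_gap_ge) (use l5 in auto)
  then show "l > 9" by simp
qed

lemma odd_large_l:
  assumes "odd m" "\<not> m \<le> 71"
  shows "l > 8.9"
proof -
  have "m \<ge> 73" using assms by presburger
  then have "l^2 - l \<ge> (8.94::real)^2 - 8.94" using m_eq_d d_pos by (simp add: power2_eq_square)
  then have "l \<ge> 8.94" by (rule sq_gap_ge) (use l5 in auto)
  then show ?thesis by simp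
qed

text \<open>The discarded terms \<open>(l - 1) * (1 + d) - 4\<close> are nonnegative because
  \<open>l - 1 > 4\<close>; then \<open>L\<close> is cancelled.\<close>

lemma odd_small_gap:
  assumes "odd m" "m \<le> 71"
  shows "2 * ((l - 1) * d) \<ge> 9 - l"
proof -
  have "4 * (1 + 0) \<le> (l - 1) * (1 + d)" using l5 d_pos by (intro mult_mono) auto
  then have "(9 - l) * L \<le> 2 * ((l - 1) * d) * L"
    using odd_small[OF assms] by (simp add: algebra_simps)
  then show ?thesis using L30 by (simp only: mult_le_cancel_right_pos)
qed

text \<open>For \<open>m \<le> 72\<close> the assumption \<open>d \<le> 1\<close> keeps
  \<open>l\<close> below 9, so \<open>(l - 1) * d \<ge> 4\<close> gives more than 4/8.\<close>

lemma even_half: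
  assumes "even m" "d \<le> 1"
  shows "d > 1 / 2"
proof (cases "m \<le> 72")
  case True
  have "l < 9"
  proof (rule ccontr)
    assume "\<not> l < 9"
    then have "9 * 8 \<le> l * (l - 1)" by (intro mult_mono) auto
    moreover have "real m \<le> 72" using True by simp
    ultimately show False using m_eq_d assms(2) by (simp add: power2_eq_square algebra_simps)
  qed
  have "4 \<le> (l - 1) * d" by (rule even_small[OF assms(1) True])
  moreover have "(l - 1) * d < 8 * d" using d_pos \<open>l < 9\<close> by simp
  ultimately show ?thesis by simp
qed (use even_large_half assms in auto)

text \<open>Cleared of denominators the hypothesis reads \<open>4 * y \<le> 19 - 3 * l\<close> with
  \<open>y = (l - 1) * d\<close>. For large \<open>m\<close> the right side is negative; for small
  \<open>m\<close> the lower bounds 4 and (9 - l) / 2 on \<open>y\<close> force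
  \<open>l \<le> 1\<close>.\<close>

lemma tri_W_False:
  assumes h: "d \<le> 4 / (l - 1) - 3 / 4"
  shows False
proof -
  have h': "4 * ((l - 1) * d) \<le> 19 - 3 * l" using h l5 by (simp add: field_simps)
  have pos: "(l - 1) * d > 0" using l5 d_pos by simp
  define y where "y = (l - 1) * d"
  note h' = h'[folded y_def] and pos = pos[folded y_def]
  consider "even m" "m \<le> 72" | "even m" "\<not> m \<le> 72" | "odd m" "m \<le> 71" | "odd m" "\<not> m \<le> 71" by blast
  then show False
  proof cases
    case 1 then show False using even_small[OF 1, folded y_def] h' l5 by linarith
  next
    case 2 then show False using even_large_half[OF 2] pos h' by linarith
  next
    case 3 then show False using odd_small_gap[OF 3, folded y_def] h' l5 by linarith
  next
    case 4 then show False using odd_large_l[OF 4] pos h' by linarith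
  qed
qed

section \<open>Admissible numbers of pendant vertices for a triangle\<close>

lemma tri_expand:
  assumes m: "real m = 2 * (r + 3) + i" and t: "L * t = i"
    and e: "(l - 1) * d = 4 - 2 * t - (l - 1) * ((r + 1) * t + i / l)"
  shows "2 * (l - 1) * (d * L) = 8 * L - 4 * i - (l - 1) * (i * (real m - 4 - i + 2 * l + 2))"
proof -
  have "2 * (l - 1) * (d * L) = 2 * L * ((l - 1) * d)" by simp
  also have "\<dots> = 8 * L - 4 * (L * t) - (l - 1) * (2 * (r + 1) * (L * t) + 2 * (L * (i / l)))"
    unfolding e by (simp add: algebra_simps)
  also have "L * (i / l) = i * (l + 1)" using l5 by (simp add: L_def)
  also have "2 * (r + 1) = real m - 4 - i" using m by simp
  finally show ?thesis unfolding t by (simp add: algebra_simps)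
qed

text \<open>For \<open>i = 0\<close> one has \<open>(l - 1) * d = 4\<close>, the equality case of
  \<open>even_small\<close>, and every \<open>i \<ge> 1\<close> lowers the value. For large
  \<open>m\<close> the bounds \<open>l > 9\<close> and \<open>d > 1 / 2\<close> demand more than
  4.\<close>

lemma tri_even:
  assumes ev: "even m" and r: "r \<ge> 0" and i: "i = 0 \<or> i \<ge> 1"
    and m: "real m = 2 * (r + 3) + i" and t: "L * t = i"
    and e: "(l - 1) * d = 4 - 2 * t - (l - 1) * ((r + 1) * t + i / l)"
  shows "m \<le> 72" "i = 0"
proof -
  define Q where "Q = (l - 1) * (i * (real m - 4 - i + 2 * l + 2))"
  have nn: "Q \<ge> 0" unfolding Q_def using l5 i r m by auto
  have x: "2 * ((l - 1) * d * L) = 8 * L - 4 * i - Q"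
    using tri_expand[OF m t e] by (simp only: Q_def mult.assoc)
  have le': "((l - 1) * d) * L \<le> 4 * L - 2 * i" using x nn by linarith
  then have "((l - 1) * d) * L \<le> 4 * L" using i by linarith
  then have le: "(l - 1) * d \<le> 4" using L30 by (simp only: mult_le_cancel_right_pos)
  show m72: "m \<le> 72"
  proof (rule ccontr)
    assume n: "\<not> m \<le> 72"
    have "8 * (1 / 2) < (l - 1) * d" using even_large_half[OF ev n] by (intro mult_strict_mono) auto
    then show False using le by simp
  qed
  show "i = 0"
  proof (rule ccontr)
    assume "i \<noteq> 0"
    then have "((l - 1) * d) * L < 4 * L" using le' i by linarith
    then have "(l - 1) * d < 4" using L30 by (simp only: mult_less_cancel_right_pos)
    then show False using even_small[OF ev m72] by simp
  qed
qed

lemma tri_odd: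
  assumes od: "odd m" and r: "r \<ge> 0" and i: "i = 1 \<or> i \<ge> 3"
    and m: "real m = 2 * (r + 3) + i" and t: "L * t = i"
    and e: "(l - 1) * d = 4 - 2 * t - (l - 1) * ((r + 1) * t + i / l)"
  shows "m \<le> 71" "i = 1"
proof -
  have x: "2 * (l - 1) * (d * L) = 8 * L - 4 * i - (l - 1) * (i * (real m - 4 - i + 2 * l + 2))"
    by (rule tri_expand[OF m t e])
  have y: "8 * L - 4 - (l - 1) * (real m - 5 + 2 * l + 2) = 8 * L - (l - 1) * L - 4 + (l - 1) * (1 + d)"
    unfolding m_eq_d L_sq by (simp add: algebra_simps)
  \<comment> \<open>The loss is compared with its value at \<open>i = 1\<close>, where
    \<open>odd_small\<close> becomes an equality; the excess splits off as a nonnegative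
    product.\<close>
  have mono: "i * (real m - 4 - i + 2 * l + 2) = (real m - 5 + 2 * l + 2) + (i - 1) * (real m - i - 5 + 2 * l + 2)"
    by (simp add: algebra_simps)
  have z0: "(i - 1) * (real m - i - 5 + 2 * l + 2) \<ge> 0"
    using i m r l5 by (intro mult_nonneg_nonneg) auto
  then have z: "(l - 1) * ((i - 1) * (real m - i - 5 + 2 * l + 2)) \<ge> 0" using l5 by simp
  have split: "(l - 1) * (i * (real m - 4 - i + 2 * l + 2)) =
      (l - 1) * (real m - 5 + 2 * l + 2) + (l - 1) * ((i - 1) * (real m - i - 5 + 2 * l + 2))"
    unfolding mono by (rule distrib_left)
  have le: "2 * (l - 1) * (d * L) \<le> 8 * L - (l - 1) * L - 4 + (l - 1) * (1 + d) - 4 * (i - 1)"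
    unfolding y[symmetric] x split using z by simp
  show m71: "m \<le> 71"
  proof (rule ccontr)
    assume n: "\<not> m \<le> 71"
    have l89: "l > 8.9" by (rule odd_large_l[OF od n])
    have "(l - 1) * (1 + d) \<le> (l - 1) * (d * L)" using odd_large[OF od n] l5 by (intro mult_left_mono) auto
    moreover have "2 * ((l - 1) * (d * L)) \<le> (9 - l) * L - 4 + (l - 1) * (1 + d) - 4 * (i - 1)"
      using le by (simp add: algebra_simps)
    ultimately have "(l - 1) * (1 + d) \<le> (9 - l) * L - 4" using i by argo
    moreover have "7.9 * 1 \<le> (l - 1) * (1 + d)" using l89 d_pos by (intro mult_mono) auto
    ultimately have c: "(9 - l) * L \<ge> 11" by simp
    then have "0 < (9 - l) * L" by simp
    then have "l < 9" using L30 by (simp add: zero_less_mult_iff)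
    \<comment> \<open>For \<open>l\<close> between 8.9 and 9 the product is at most 0.1 * 90 = 9,
      below the required 11.\<close>
    then have "(9 - l) * L \<le> 0.1 * (9 * 10)" unfolding L_def using l89 by (intro mult_mono) auto
    then show False using c by simp
  qed
  show "i = 1" using odd_small[OF od m71] le i by auto
qed

end

section \<open>Excluding double stars and bounding the pendant vertices of a star\<close>

locale dstar_root = large_root +
  fixes s s' i y y' :: real
  assumes s_ge: "s' \<le> s" and s'_cases: "s' = 0 \<or> s' \<ge> 1" and s_sum: "s + s' \<ge> 3"
    and i_nonneg: "i \<ge> 0" and y01: "0 \<le> y" "0 \<le> y'" "y \<le> 1" "y' \<le> 1"
    and m_ds: "real m = 2 * s + 2 * s' + 3 + i"
    and y_eq: "L * (1 - y) = s' * (1 + y') + i"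
    and y'_eq: "L * (1 - y') = s * (1 + y) + i"
    and d_eq: "d = 1 - s * (1 - y) - s' * (1 - y') - i / l"
begin

text \<open>The part free of \<open>i\<close> in \<open>L\<close> times the losses of the two
  centres, whose entries are \<open>y\<close> and \<open>y'\<close>; it vanishes for a star.\<close>

definition "K = s * s' * (2 + y + y')"

lemma dL: "d * L = L - K - i * (s + s' + l + 1)"
proof -
  have "d * L = L - s * (L * (1 - y)) - s' * (L * (1 - y')) - (i / l) * L"
    unfolding d_eq by (simp add: algebra_simps)
  also have "(i / l) * L = i * (l + 1)" using l5 by (simp add: L_def)
  finally show ?thesis unfolding y_eq y'_eq K_def by (simp add: algebra_simps)
qed

lemma d_le1: "d \<le> 1"
proof -
  have "0 \<le> s * (1 - y)" "0 \<le> s' * (1 - y')" "0 \<le> i / l"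
    using s_ge s'_cases y01 i_nonneg l5 by auto
  then show ?thesis using d_eq by simp
qed

lemma dL_pos: "d * L > 0"
  using d_pos L30 by simp

lemma m_L: "real m = L - 2 * l + 2 - d"
  unfolding L_sq using m_eq_d by simp

text \<open>From \<open>(s - 1) * (s' - 1) \<ge> 0\<close> the product becomes linear in
  \<open>s + s'\<close>, and the bound equals \<open>m - 5 - i\<close> by
  \<open>m_ds\<close>.\<close>

lemma K_ge:
  assumes "s' \<ge> 1"
  shows "K \<ge> 2 * s + 2 * s' - 2"
proof -
  have "(s - 1) * (s' - 1) \<ge> 0" using assms s_ge by simp
  then have "s * s' \<ge> s + s' - 1" by (simp add: algebra_simps)
  then have "(s + s' - 1) * 2 \<le> s * s' * (2 + y + y')"
    using y01 assms s_ge by (intro mult_mono) auto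
  then show ?thesis by (simp add: K_def)
qed

text \<open>The losses leave only \<open>d * L \<le> l + d\<close>, whereas \<open>d > 1 / 2\<close>
  and \<open>L > 6 * l\<close> require more than \<open>3 * l\<close>.\<close>

lemma two_centres_even:
  assumes "even m" "s' \<ge> 1" "i \<ge> 1"
  shows False
proof -
  have "1 * (s + s' + l) \<le> i * (s + s' + l)" using assms s_ge l5 by (intro mult_right_mono) auto
  then have "i * (s + s' + l + 1) \<ge> s + s' + l + i" by (simp add: algebra_simps)
  then have "d * L \<le> L - (real m - 5 - i) - (s + s' + l + i)"
    using dL K_ge[OF assms(2)] m_ds by linarith
  then have gap: "d * L \<le> l + d" using m_L s_sum by linarith
  have "d > 1 / 2" using even_half[OF assms(1)] d_le1 by simp
  then have "(1 / 2) * L \<le> d * L" using L30 by (intro mult_right_mono) auto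
  moreover have "6 * l < L" unfolding L_def using l5 by (simp add: algebra_simps)
  ultimately show False using gap d_le1 l5 by linarith
qed

text \<open>Two pendant vertices at \<open>u\<close> bring the losses above \<open>L\<close>: they
  leave \<open>d * L \<le> d - 3 < 0\<close>.\<close>

lemma two_centres_odd:
  assumes "s' \<ge> 1" "i \<ge> 2"
  shows False
proof -
  have "2 * (s + s' + l) \<le> i * (s + s' + l)" using assms s_ge l5 by (intro mult_right_mono) auto
  then have "i * (s + s' + l + 1) \<ge> 2 * s + 2 * s' + 2 * l + i" by (simp add: algebra_simps)
  then have "d * L \<le> L - (real m - 5 - i) - (2 * s + 2 * s' + 2 * l + i)"
    using dL K_ge[OF assms(1)] m_ds by linarith
  then have "d * L \<le> d - 3" using m_L s_sum by linarith
  then show False using dL_pos d_le1 by linarith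
qed

text \<open>As \<open>d > 0\<close>, the loss \<open>s * (1 - y)\<close> stays below 1, so many
  leaves force \<open>y\<close> close to 1.\<close>

lemma y_ge:
  assumes "s \<ge> k" "k > 0"
  shows "y \<ge> 1 - 1 / k"
proof -
  have "0 \<le> s' * (1 - y')" "0 \<le> i / l" using s'_cases y01 i_nonneg l5 by auto
  then have "s * (1 - y) \<le> 1" using d_eq d_pos by linarith
  moreover have "k * (1 - y) \<le> s * (1 - y)" using assms y01 by (intro mult_right_mono) auto
  ultimately have "k * (1 - y) \<le> 1" by linarith
  then show ?thesis using assms(2) by (simp add: field_simps)
qed

lemma K_ge':
  assumes "s' \<ge> 1" "y \<ge> c" "c \<ge> 0"
  shows "K \<ge> (s + s' - 1) * (2 + c)"
proof -
  have "(s - 1) * (s' - 1) \<ge> 0" using assms s_ge by simp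
  then have "s * s' \<ge> s + s' - 1" by (simp add: algebra_simps)
  then show ?thesis unfolding K_def
    using y01 assms s_ge by (intro mult_mono) auto
qed

text \<open>The delicate case: \<open>K_ge\<close> alone leaves
  \<open>d * L \<le> 2 * l + 3 + d\<close>, which is not enough. Therefore \<open>y_ge\<close> is
  used to raise the factor 2 in that bound to 2.8 or 2.9. For \<open>l < 7.5\<close> the result
  contradicts \<open>odd_small_gap\<close>, for larger \<open>l\<close> already
  \<open>d > 0\<close>.\<close>

lemma two_centres_none:
  assumes od: "odd m" and m: "m \<ge> 23" and "s' \<ge> 1" "i = 0"
  shows False
proof -
  have dL: "d * L = L - K" using dL assms(4) by simp
  have n: "2 * s + 2 * s' - 2 = L - 2 * l - 3 - d" using m_L m_ds assms(4) by simp
  show False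
  proof (cases "l < 7.5")
    case True
    have "real m \<ge> 23" using m by simp
    then have "s \<ge> 5" using m_ds assms(4) s_ge by linarith
    then have y: "y \<ge> 0.8" using y_ge[of 5] by simp
    have "K \<ge> (s + s' - 1) * 2.8" using K_ge'[OF assms(3) y] by simp
    then have "d * L \<le> L - 1.4 * (L - 2 * l - 4)" using dL n d_le1 by (simp add: field_simps)
    then have "2 * ((l - 1) * (d * L)) \<le> 2 * ((l - 1) * (L - 1.4 * (L - 2 * l - 4)))"
      using l5 by (intro mult_left_mono) auto
    moreover have "m \<le> 71"
    proof -
      have "l * (l - 1) \<le> 7.5 * 6.5" using True l5 by (intro mult_mono) auto
      then have "real m \<le> 71" unfolding m_L L_def using d_pos by (simp add: algebra_simps)
      then show ?thesis by simp
    qed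
    then have "(9 - l) * L \<le> 2 * ((l - 1) * d) * L"
      using odd_small_gap[OF od] L30 by (intro mult_right_mono) auto
    then have "(9 - l) * L \<le> 2 * ((l - 1) * (d * L))" by (simp only: mult.assoc)
    ultimately have "(9 - l) * L \<le> 2 * ((l - 1) * (L - 1.4 * (L - 2 * l - 4)))"
      by (rule order_trans[rotated])
    then have *: "0 \<le> 2 * (l^2 * l) - 24 * l^2 - 26 * l - 112"
      unfolding L_sq by (simp add: field_simps power2_eq_square)
    \<comment> \<open>The cubic term is at most \<open>15 * l^2\<close>, less than the
      \<open>24 * l^2\<close> subtracted.\<close>
    have "l^2 * l \<le> l^2 * 7.5" using True by (intro mult_left_mono) auto
    then show False using * l5 zero_le_power2[of l] by linarith
  next
    case False
    then have "7.5 * 6.5 \<le> l * (l - 1)" by (intro mult_mono) auto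
    then have "L - 2 * l \<ge> 48" unfolding L_def by (simp add: algebra_simps)
    then have "s + s' \<ge> 22" using n d_le1 by linarith
    then have "s \<ge> 11" using s_ge by linarith
    then have "1 - 1 / 11 \<le> y" using y_ge[of 11] by simp
    then have y: "y \<ge> 0.9" by simp
    have "K \<ge> (s + s' - 1) * 2.9" using K_ge'[OF assms(3) y] by simp
    then have "20 * (d * L) \<le> 116 + 58 * l - 9 * L" using dL n d_le1 by (simp add: field_simps)
    moreover have "8.5 * l \<le> L" unfolding L_def using False by (simp add: algebra_simps)
    then have "17 * l \<le> 2 * L" by simp
    moreover have "15 \<le> 2 * l" using False by simp
    ultimately show False using dL_pos by linarith
  qed
qed

lemma one_centre:
  assumes "s' = 0"
  shows "d * L = L - i * (s + l + 1)" "2 * s = real m - 3 - i"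
proof -
  have "K = 0" unfolding K_def using assms by simp
  then show "d * L = L - i * (s + l + 1)" "2 * s = real m - 3 - i" using dL m_ds assms by simp_all
qed

text \<open>For \<open>i \<ge> 3\<close> the loss contradicts \<open>d > 1 / 2\<close>. For
  \<open>i = 1\<close> one gets \<open>2 * (d * L) = L + d\<close>, the zero equation of the large
  even range, which has to be refuted for \<open>m \<le> 72\<close>.\<close>

lemma one_centre_even:
  assumes ev: "even m" and s': "s' = 0" and i: "i = 1 \<or> i \<ge> 3"
  shows "m \<ge> 74" "i = 1"
proof -
  have half: "d > 1 / 2" using even_half[OF ev] d_le1 by simp
  show i1: "i = 1"
  proof (rule ccontr)
    assume "i \<noteq> 1"
    then have i3: "i \<ge> 3" using i by simp
    have "0 \<le> (i - 1) * (real m - 4 - i)"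
      using i3 s' m_ds s_sum by (intro mult_nonneg_nonneg) auto
    then have "i * (real m - 3 - i) \<ge> real m - 4" by (simp add: algebra_simps)
    moreover have "i * (2 * l + 2) \<ge> 3 * (2 * l + 2)" using i3 l5 by (intro mult_right_mono) auto
    ultimately have "i * (2 * s + (2 * l + 2)) \<ge> real m - 4 + 6 * l + 6"
      unfolding one_centre(2)[OF s'] distrib_left by linarith
    moreover have "2 * (d * L) = 2 * L - i * (2 * s + (2 * l + 2))"
      unfolding one_centre(1)[OF s'] by (simp add: algebra_simps)
    ultimately have "2 * (d * L) \<le> L - 4 * l - 4 + d" using m_L by linarith
    moreover have "(1 / 2) * L \<le> d * L" using half L30 by (intro mult_right_mono) auto
    ultimately show False using d_le1 l5 by linarith
  qed
  have eq: "2 * (d * L) = L + d"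
    using one_centre[OF s'] m_L i1 by simp
  show "m \<ge> 74"
  proof (rule ccontr)
    assume "\<not> m \<ge> 74"
    then have m72: "m \<le> 72" using ev by presburger
    have h: "4 \<le> (l - 1) * d" by (rule even_small[OF ev m72])
    txt \<open>Bootstrap: upper bounds for \<open>d\<close> and lower bounds for \<open>l\<close> improve each other.\<close>
    have d_up: "d \<le> k" if "L \<ge> L0" "L0 \<le> (2 * L0 - 1) * k" "k \<ge> 1 / 2" "L0 \<ge> 1" for k L0
    proof (rule ccontr)
      assume "\<not> d \<le> k"
      then have "(2 * L - 1) * k < (2 * L - 1) * d" using L30 by (intro mult_strict_left_mono) auto
      also have "\<dots> = L" using eq by (simp add: algebra_simps)
      finally have "(2 * k - 1) * L < k" by (simp add: algebra_simps)
      moreover have "(2 * k - 1) * L0 \<le> (2 * k - 1) * L" using that by (intro mult_left_mono) auto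
      ultimately show False using that(2) by (simp add: algebra_simps)
    qed
    have l_lo: "l \<ge> 1 + 4 / k" if "d \<le> k" "k > 0" for k
    proof -
      have "(l - 1) * d \<le> (l - 1) * k" using that l5 by (intro mult_left_mono) auto
      then have "4 \<le> (l - 1) * k" using h by linarith
      then show ?thesis using that(2) by (simp add: field_simps)
    qed
    \<comment> \<open>Two rounds suffice: \<open>l \<ge> 8.95\<close> and
      \<open>d \<le> 0.503\<close> give \<open>m = l^2 - l + 2 - d > 72\<close>.\<close>
    have "d \<le> 0.51" using d_up[of 30 "0.51"] L30 by simp
    then have l1: "l \<ge> 8.84" using l_lo[of "0.51"] by simp
    have "8.84 * 9.84 \<le> L" unfolding L_def using l1 by (intro mult_mono) auto
    then have "d \<le> 0.503" using d_up[of 86 "0.503"] by simp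
    then have l2: "l \<ge> 8.95" and d5: "d \<le> 0.503" using l_lo[of "0.503"] by simp_all
    have "8.95 * 7.95 \<le> l * (l - 1)" using l2 by (intro mult_mono) auto
    then have "71 \<le> L - 2 * l" unfolding L_def by (simp add: algebra_simps)
    moreover have "real m \<le> 72" using m72 by simp
    ultimately show False using m_L d5 by simp
  qed
qed

text \<open>The value \<open>i = 0\<close> belongs to the excluded graph and stays possible. For
  \<open>i \<ge> 4\<close> the losses exceed \<open>L\<close>; for \<open>i = 2\<close> one gets
  \<open>d * L = 1 + d\<close>, which is incompatible with \<open>odd_small\<close>.\<close>

lemma one_centre_odd:
  assumes od: "odd m" and s': "s' = 0" and i: "i = 0 \<or> i = 2 \<or> i \<ge> 4"
  shows "i = 0 \<or> (i = 2 \<and> m \<ge> 73)"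
proof -
  have "\<not> i \<ge> 4"
  proof
    assume i4: "i \<ge> 4"
    have "0 \<le> (i - 2) * (real m - 5 - i)"
      using i4 s' m_ds s_sum by (intro mult_nonneg_nonneg) auto
    then have "i * (real m - 3 - i) \<ge> 2 * real m - 10" by (simp add: algebra_simps)
    moreover have "i * (2 * l + 2) \<ge> 4 * (2 * l + 2)" using i4 l5 by (intro mult_right_mono) auto
    ultimately have "i * (2 * s + (2 * l + 2)) \<ge> 2 * real m - 10 + 8 * l + 8"
      unfolding one_centre(2)[OF s'] distrib_left by linarith
    moreover have "2 * (d * L) = 2 * L - i * (2 * s + (2 * l + 2))"
      unfolding one_centre(1)[OF s'] by (simp add: algebra_simps)
    ultimately have "d * L \<le> - 2 * l - 1 + d" using m_L by linarith
    then show False using dL_pos d_le1 l5 by linarith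
  qed
  moreover have "m \<ge> 73" if i2: "i = 2"
  proof (rule ccontr)
    assume "\<not> m \<ge> 73"
    then have m71: "m \<le> 71" using od by presburger
    have eq: "d * L = 1 + d" using one_centre[OF s'] m_L i2 by simp
    have d_small: "d \<le> 0.04"
    proof (rule ccontr)
      assume "\<not> d \<le> 0.04"
      then have "0.04 * 29 < d * (L - 1)" using L30 by (intro mult_strict_mono) auto
      then show False using eq by (simp add: algebra_simps)
    qed
    have "(9 - l) * L - 4 \<le> (l - 1) * (1 + d)"
      using odd_small[OF od m71] unfolding eq by (simp add: algebra_simps)
    also have "(l - 1) * (1 + d) \<le> (l - 1) * 1.04" using l5 d_small by (intro mult_left_mono) auto
    finally have le: "25 * ((9 - l) * L) \<le> 74 + 26 * l" by (simp add: field_simps)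
    have l_lt: "l < 8.83"
    proof (rule ccontr)
      assume "\<not> l < 8.83"
      then have "8.83 * 7.83 \<le> l * (l - 1)" by (intro mult_mono) auto
      then have "691 / 10 \<le> L - 2 * l" unfolding L_def by (simp add: algebra_simps)
      moreover have "real m \<le> 71" using m71 by simp
      ultimately show False using m_L d_small by simp
    qed
    have "5 * l < l^2" using l5 by (simp add: power2_eq_square)
    \<comment> \<open>This quadratic is the quotient of
      \<open>25 * ((9 - l) * L) - 74 - 26 * l\<close> by \<open>8.83 - l\<close>. The remainder is a
      positive constant, so a positive product contradicts \<open>le\<close>.\<close>
    then have "0 < 25 * l^2 + 20.75 * l - 15.7775" using l5 by simp
    then have "0 < (8.83 - l) * (25 * l^2 + 20.75 * l - 15.7775)"
      using l_lt by (intro mult_pos_pos) auto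
    then show False using le unfolding L_sq by (simp add: field_simps power2_eq_square)
  qed
  ultimately show ?thesis using i by auto
qed

end

section \<open>Hub graphs\<close>

text \<open>
  All graphs in the theorem have the following form: a vertex \<open>u\<close> adjacent to all others, a vertex \<open>a\<close>
  adjacent to the vertices of \<open>S\<close>, pendant vertices \<open>I\<close> at \<open>u\<close>, and, if \<open>f\<close> holds, one edge \<open>bc\<close>
  inside \<open>S\<close>. If \<open>f\<close> does not hold, \<open>b\<close> and \<open>c\<close> are irrelevant.
\<close>

definition hub_adj :: "bool \<Rightarrow> 'a \<Rightarrow> 'a \<Rightarrow> 'a set \<Rightarrow> 'a set \<Rightarrow> 'a \<Rightarrow> 'a \<Rightarrow> 'a \<Rightarrow> 'a \<Rightarrow> bool" where
  "hub_adj f u a S I b c v w \<longleftrightarrow>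
     v = u \<and> w \<in> insert a (S \<union> I) \<or> w = u \<and> v \<in> insert a (S \<union> I) \<or>
     v = a \<and> w \<in> S \<or> w = a \<and> v \<in> S \<or> f \<and> (v = b \<and> w = c \<or> v = c \<and> w = b)"

definition hub_frame :: "bool \<Rightarrow> nat \<Rightarrow> nat \<Rightarrow> 'a \<Rightarrow> 'a \<Rightarrow> 'a set \<Rightarrow> 'a set \<Rightarrow> 'a \<Rightarrow> 'a \<Rightarrow> bool" where
  "hub_frame f s i u a S I b c \<longleftrightarrow> u \<noteq> a \<and> u \<notin> S \<union> I \<and> a \<notin> S \<union> I \<and> S \<inter> I = {} \<and>
     finite S \<and> finite I \<and> card S = s \<and> card I = i \<and> (f \<longrightarrow> b \<in> S \<and> c \<in> S \<and> b \<noteq> c)"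

definition hub :: "bool \<Rightarrow> nat \<Rightarrow> nat \<Rightarrow> 'a set \<Rightarrow> ('a \<Rightarrow> 'a \<Rightarrow> bool) \<Rightarrow> bool" where
  "hub f s i V E \<longleftrightarrow> (\<exists>u a S I b c. hub_frame f s i u a S I b c \<and> V = {u, a} \<union> S \<union> I \<and>
     (\<forall>v w. E v w \<longleftrightarrow> hub_adj f u a S I b c v w))"

text \<open>The parameters of the extremal graph in the four ranges; \<open>s\<close> is then fixed
  by the number of edges.\<close>

definition "target f i m \<longleftrightarrow>
  (if even m then if m \<le> 72 then f \<and> i = 0 else \<not> f \<and> i = 1
   else if m \<le> 71 then f \<and> i = 1 else \<not> f \<and> i = (2::nat))"

lemma odd_nat_cases: "odd n \<Longrightarrow> n = 1 \<or> n \<ge> 3" and even_nat_cases: "even n \<Longrightarrow> n = 0 \<or> n = 2 \<or> n \<ge> 4"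
  for n :: nat
  by presburger+

context perron begin

lemma E_W0:
  assumes "W = {}"
  shows "E v w \<longleftrightarrow> v = u \<and> w \<in> N \<or> w = u \<and> v \<in> N \<or> v \<in> N \<and> w \<in> AN v"
proof -
  have V: "V = insert u N" using V_eq assms by auto
  consider "v = u" | "w = u" "v \<noteq> u" | "v \<noteq> u" "w \<noteq> u" by blast
  then show ?thesis
  proof cases
    case 1 then show ?thesis using u_N by (simp add: N_def)
  next
    case 2 then show ?thesis using u_N E_commute[of v u] by (simp add: N_def AN_def)
  next
    case 3
    have "v \<in> N" "w \<in> N" if "E v w" using E_in[OF that] E_in2[OF that] 3 unfolding V by auto
    then show ?thesis using 3 by (auto simp: AN_def)
  qed
qed

lemma root: "psi2 m l \<ge> 0 \<Longrightarrow> large_root m l gap (l * (l + 1))"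
  using l_gt5 gap_pos by unfold_locales (simp_all add: gap_def)

end

text \<open>The corners \<open>b\<close> and \<open>c\<close> join \<open>D\<close> as common
  neighbours of the hubs \<open>u\<close> and \<open>a\<close>, and their edge is the extra edge of
  the hub graph.\<close>

lemma (in perron_tri) hub_conclusion:
  assumes psi: "psi2 m l \<ge> 0"
  shows "\<exists>f s i. hub f s i V E \<and> m = 1 + 2 * s + i + (if f then 1 else 0) \<and> target f i m"
proof -
  interpret root: large_root m l gap "l * (l + 1)" by (rule root[OF psi])
  have W0: "W = {}" using tri_W_bound root.tri_W_False by blast
  note eqs = tri_W0[OF W0]
  have "real m = real (2 * (card D + 3) + card I)" using eqs(1) by (simp add: r_def)
  then have m_nat: "m = 2 * (card D + 3) + card I" by (simp only: of_nat_eq_iff)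
  have i: "target True (card I) m"
  proof (cases "even m")
    case True
    have "real (card I) = 0 \<or> real (card I) \<ge> 1" by auto
    then show ?thesis using root.tri_even[OF True r_nonneg _ eqs] True by (simp add: target_def)
  next
    case False
    then have "odd (card I)" using m_nat by simp
    then have "card I = 1 \<or> card I \<ge> 3" by (rule odd_nat_cases)
    then have "real (card I) = 1 \<or> real (card I) \<ge> 3" by auto
    then show ?thesis using root.tri_odd[OF False r_nonneg _ eqs] False by (simp add: target_def)
  qed
  have fin: "finite D" by (rule tri_sum(2)[OF C tri])
  have frame: "hub_frame True (2 + card D) (card I) u a ({b, c} \<union> D) I b c"
    using tri_facts(5,6) I_ne D_ne fin N_split(4) uN(3)[of a] uN(3)[of b] uN(3)[of c] tri_facts(1-4) u_N N_split(5)
    by (auto simp: hub_frame_def)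
  have V: "V = {u, a} \<union> ({b, c} \<union> D) \<union> I"
    using V_eq W0 N_cases tri_facts(1-4) N_split(5) by auto
  have A: "AN a = {b, c} \<union> D" "AN b = {a, c}" "AN c = {a, b}" "\<And>d. d \<in> D \<Longrightarrow> AN d = {a}"
    using tri by (auto simp: tri_def)
  have N: "N = insert a ({b, c} \<union> D \<union> I)"
    using N_cases tri_facts(1-4) N_split(5) by auto
  have "E v w \<longleftrightarrow> hub_adj True u a ({b, c} \<union> D) I b c v w" for v w
  proof -
    have k: "v \<in> N \<and> w \<in> AN v \<longleftrightarrow> v = a \<and> w \<in> {b, c} \<union> D \<or> w = a \<and> v \<in> {b, c} \<union> D \<or> v = b \<and> w = c \<or> v = c \<and> w = b"
      using A AN_I[of v] N_cases[of v] tri_facts(1-4) N_split(5) by auto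
    show ?thesis by (simp only: E_W0[OF W0, of v w] hub_adj_def N[symmetric] k simp_thms disj_assoc)
  qed
  then have "hub True (2 + card D) (card I) V E"
    using frame V unfolding hub_def by blast
  moreover have "m = 1 + 2 * (2 + card D) + card I + (if True then 1 else 0)" using m_nat by simp
  ultimately show ?thesis using i by blast
qed

text \<open>Once \<open>D'\<close> is empty, \<open>a'\<close> is a leaf like those in
  \<open>D\<close>. The second alternative of the conclusion describes the excluded graph.\<close>

lemma (in perron_dstar) hub_conclusion:
  assumes psi: "psi2 m l \<ge> 0" and m22: "m \<ge> 22"
  shows "\<exists>f s i. hub f s i V E \<and> m = 1 + 2 * s + i + (if f then 1 else 0) \<and>
    (target f i m \<or> odd m \<and> \<not> f \<and> i = 0)"
proof -
  interpret root: large_root m l gap "l * (l + 1)" by (rule root[OF psi])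
  have dl1: "gap \<le> 1" using cost_parts(3) XI_nonneg sum_nonneg[of W p] p_nonneg by fastforce
  have W0: "W = {}"
    using dstar_W root.even_half dl1 by fastforce
  note eqs = dstar_W0[OF W0]
  have "real m = real (2 * (card D + card D') + 3 + card I)" using eqs(1) by (simp add: s_def s'_def)
  then have m_nat: "m = 2 * (card D + card D') + 3 + card I" by (simp only: of_nat_eq_iff)
  have s'_cases: "s' = 0 \<or> s' \<ge> 1" by (auto simp: s'_def)
  interpret ds: dstar_root m l gap "l * (l + 1)" s s' "real (card I)" "x a" "x a'"
    using s_ge s'_cases s_sum eqs x01(1,2)[OF ds_facts(1)] x01(1,2)[OF ds_facts(2)]
    by unfold_locales auto
  have s'0: "s' = 0"
  proof (rule ccontr)
    assume "s' \<noteq> 0"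
    then have s'1: "s' \<ge> 1" using s'_cases by auto
    show False
    proof (cases "even m")
      case True
      then have "odd (card I)" using m_nat by simp
      then have "card I \<ge> 1" using odd_nat_cases by force
      then show False using ds.two_centres_even[OF True s'1] by simp
    next
      case False
      then have ev: "even (card I)" using m_nat by simp
      show False
      proof (cases "card I = 0")
        case True
        have "m \<ge> 23" using m22 False by presburger
        then show False using ds.two_centres_none[OF False _ s'1] True by simp
      next
        case n: False
        then have "card I \<ge> 2" using even_nat_cases[OF ev] by auto
        then show False using ds.two_centres_odd[OF s'1] by simp
      qed
    qed
  qed
  then have D'0: "D' = {}" using fin_ds by (simp add: s'_def)
  have i: "target False (card I) m \<or> odd m \<and> card I = 0"
  proof (cases "even m")
    case True
    then have "odd (card I)" using m_nat by simp
    then have "card I = 1 \<or> card I \<ge> 3" by (rule odd_nat_cases)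
    then have "real (card I) = 1 \<or> real (card I) \<ge> 3" by auto
    then show ?thesis using ds.one_centre_even[OF True s'0] True by (simp add: target_def)
  next
    case False
    then have "even (card I)" using m_nat by simp
    then have "card I = 0 \<or> card I = 2 \<or> card I \<ge> 4" by (rule even_nat_cases)
    then have "real (card I) = 0 \<or> real (card I) = 2 \<or> real (card I) \<ge> 4" by auto
    then show ?thesis using ds.one_centre_odd[OF False s'0] False by (auto simp: target_def)
  qed
  have frame: "hub_frame False (1 + card D) (card I) u a (insert a' D) I undefined undefined"
    using ds_facts(1-3,10,11) I_ne fin_ds(1) N_split(4,5) u_N ds_facts(14) uN(3)[of a] uN(3)[of a']
    by (auto simp: hub_frame_def)
  have N: "N = insert a (insert a' D \<union> I)"
    using N_cases D'0 ds_facts(1,2,14) N_split(5) by auto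
  have V: "V = {u, a} \<union> (insert a' D) \<union> I"
    using V_eq W0 N by auto
  have "E v w \<longleftrightarrow> hub_adj False u a (insert a' D) I undefined undefined v w" for v w
  proof -
    have A: "AN a = insert a' D" "AN a' = {a}" "\<And>d. d \<in> D \<Longrightarrow> AN d = {a}"
      using AN_ds D'0 by auto
    have k: "v \<in> N \<and> w \<in> AN v \<longleftrightarrow> v = a \<and> w \<in> insert a' D \<or> w = a \<and> v \<in> insert a' D"
      using A AN_I[of v] N_cases[of v] D'0 ds_facts(1,2,14) N_split(5) by auto
    show ?thesis by (simp only: E_W0[OF W0, of v w] hub_adj_def N[symmetric] k simp_thms disj_assoc)
  qed
  then have "hub False (1 + card D) (card I) V E"
    using frame V unfolding hub_def by blast
  moreover have "m = 1 + 2 * (1 + card D) + card I + (if False then 1 else 0)" using m_nat D'0 by simp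
  ultimately show ?thesis using i by blast
qed

lemma (in perron) hub_conclusion:
  assumes psi: "psi2 m l \<ge> 0" and m22: "m \<ge> 22"
  shows "\<exists>f s i. hub f s i V E \<and> m = 1 + 2 * s + i + (if f then 1 else 0) \<and>
    (target f i m \<or> odd m \<and> \<not> f \<and> i = 0)"
proof -
  obtain C where C: "C \<in> comps" and cases: "(\<exists>a b c D. tri C a b c D) \<or> (\<exists>a a' D D'. dstar C a a' D D')"
    and rest: "\<And>v. v \<in> N - C \<Longrightarrow> AN v = {}"
    by (rule unique_component) blast
  interpret perron_comp V E x l u m C using C rest by unfold_locales auto
  from cases show ?thesis
  proof (elim disjE exE)
    fix a b c D assume "tri C a b c D"
    then interpret perron_tri V E x l u m C a b c D by unfold_locales
    show ?thesis using hub_conclusion[OF psi] by blast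
  next
    fix a a' D D' assume ds: "dstar C a a' D D'"
    show ?thesis
    proof (cases "card D' \<le> card D")
      case True
      interpret perron_dstar V E x l u m C a a' D D' using ds True by unfold_locales
      show ?thesis by (rule hub_conclusion[OF psi m22])
    next
      case False
      interpret perron_dstar V E x l u m C a' a D' D
        using dstar_swap[OF ds] False by unfold_locales auto
      show ?thesis by (rule hub_conclusion[OF psi m22])
    qed
  qed
qed

section \<open>The largest root of \<open>\<psi>\<^sub>2\<close>\<close>

text \<open>Being monic makes the set of zeros finite and yields a zero above every point with a
  negative value.\<close>

lemma psi2_poly: "\<exists>p. lead_coeff p = 1 \<and> psi2 m = poly p"
proof -
  consider "even m" "m \<le> 72" | "even m" "\<not> m \<le> 72" | "odd m" "m \<le> 71" | "odd m" "\<not> m \<le> 71" by blast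
  then show ?thesis
  proof cases
    case 1
    then show ?thesis
      by (intro exI[of _ "[:real m - 6, - (real m - 3), - 2, 1:]"])
        (auto simp: psi2_def fun_eq_iff algebra_simps power2_eq_square power3_eq_cube)
  next
    case 2
    then show ?thesis
      by (intro exI[of _ "[:real m / 2 - 1, - (real m - 2), - real m, 0, 1:]"])
        (auto simp: psi2_def fun_eq_iff algebra_simps power2_eq_square power4_eq_xxxx)
  next
    case 3
    then show ?thesis
      by (intro exI[of _ "[:- (real m - 7) / 2, (3 * real m - 17) / 2, - 2, - (real m - 1), - 1, 1:]"])
        (simp add: psi2_def fun_eq_iff, simp add: field_simps numeral_eq_Suc)
  next
    case 4
    then show ?thesis
      by (intro exI[of _ "[:real m - 3, - (real m - 3), - real m, 0, 1:]"])
        (auto simp: psi2_def fun_eq_iff algebra_simps power2_eq_square power4_eq_xxxx)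
  qed
qed

lemma finite_psi2_roots: "finite {x. psi2 m x = 0}"
proof -
  obtain p where p: "lead_coeff p = 1" "psi2 m = poly p" using psi2_poly by blast
  then have "p \<noteq> 0" by auto
  then show ?thesis using poly_roots_finite p(2) by simp
qed

lemma psi2_root_above:
  assumes "psi2 m x < 0"
  shows "\<exists>y>x. psi2 m y = 0"
proof -
  obtain p where p: "lead_coeff p = 1" "psi2 m = poly p" using psi2_poly by blast
  obtain n where n: "\<And>y. y \<ge> n \<Longrightarrow> poly p y \<ge> 1" using poly_pinfty_gt_lc[of p] p(1) by auto
  define z where "z = max n (x + 1)"
  have "poly p z > 0" using n[of z] by (auto simp: z_def)
  moreover have "x < z" by (simp add: z_def)
  ultimately show ?thesis using poly_IVT_pos[of x z p] assms p(2) by auto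
qed

lemma rho2_greatest: "psi2 m x = 0 \<Longrightarrow> x \<le> rho2 m"
  unfolding rho2_def using finite_psi2_roots by simp

lemma psi2_nonneg: "rho2 m \<le> x \<Longrightarrow> psi2 m x \<ge> 0"
  using psi2_root_above[of m x] rho2_greatest[of m] by force

text \<open>The point \<open>y\<close> solves \<open>y^2 - y = m - 2\<close>, that is
  \<open>d = 0\<close>, and \<open>y = 5\<close> for \<open>m = 22\<close>. There
  \<open>psi2\<close> is negative, so its largest zero lies beyond \<open>y\<close>.\<close>

lemma rho2_bounds:
  assumes "m \<ge> 22"
  shows "rho2 m > 5" "(rho2 m)^2 - rho2 m > real m - 2" "psi2 m (rho2 m) = 0"
proof -
  define y where "y = (1 + sqrt (4 * real m - 7)) / 2"
  have m: "real m \<ge> 22" using assms by simp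
  then have y2: "y^2 - y = real m - 2" by (simp add: y_def power2_eq_square field_simps)
  have "9 \<le> sqrt (4 * real m - 7)" using m by (intro real_le_rsqrt) simp
  then have y5: "y \<ge> 5" by (simp add: y_def)
  have L: "y * (y + 1) > 0" using y5 by simp
  have neg: "psi2 m y < 0"
  proof -
    consider "even m" "m \<le> 72" | "even m" "\<not> m \<le> 72" | "odd m" "m \<le> 71" | "odd m" "\<not> m \<le> 71" by blast
    then show ?thesis
    proof cases
      case 1 then show ?thesis using psi2_even_small[of m y] y2 by simp
    next
      case 2 then show ?thesis using psi2_even_large[of m y] y2 L by simp
    next
      case 3
      \<comment> \<open>The sign depends on the factor \<open>9 - y\<close>, which the bound 71 on
        \<open>m\<close> keeps positive.\<close>
      have "y < 9"
      proof (rule ccontr)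
        assume "\<not> y < 9"
        then have "9 * 8 \<le> y * (y - 1)" by (intro mult_mono) auto
        then show False using y2 3 by (simp add: algebra_simps power2_eq_square)
      qed
      then have "0 < (9 - y) * (y * (y + 1))" using L by simp
      then have "0 < 8 * (y * (y + 1)) - (y - 1) * (y * (y + 1)) - 4 + (y - 1)"
        using y5 by (simp add: algebra_simps)
      then show ?thesis using psi2_odd_small[OF 3, of y] y2 by simp
    next
      case 4 then show ?thesis using psi2_odd_large[of m y] y2 by simp
    qed
  qed
  then obtain z where z: "z > y" "psi2 m z = 0" using psi2_root_above by blast
  then have zr: "y < rho2 m" using rho2_greatest[of m z] by simp
  then show "rho2 m > 5" using y5 by simp
  have "0 < (rho2 m - y) * (rho2 m + y - 1)" using zr y5 by (intro mult_pos_pos) auto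
  then show "(rho2 m)^2 - rho2 m > real m - 2" using y2 by (simp add: algebra_simps power2_eq_square)
  have "rho2 m \<in> {x. psi2 m x = 0}"
    unfolding rho2_def using finite_psi2_roots z(2) by (intro Max_in) auto
  then show "psi2 m (rho2 m) = 0" by simp
qed

section \<open>Perron vectors\<close>

text \<open>The bilinear form of the adjacency operator; on the diagonal it is the numerator of the
  Rayleigh quotient.\<close>

definition quad :: "'a set \<Rightarrow> ('a \<Rightarrow> 'a \<Rightarrow> bool) \<Rightarrow> ('a \<Rightarrow> real) \<Rightarrow> ('a \<Rightarrow> real) \<Rightarrow> real" where
  "quad V E y z = (\<Sum>v\<in>V. y v * (\<Sum>w | w \<in> V \<and> E v w. z w))"

lemma quad_alt: "finite V \<Longrightarrow> quad V E y z = (\<Sum>v\<in>V. \<Sum>w\<in>V. if E v w then y v * z w else 0)"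
  unfolding quad_def sum_distrib_left by (simp add: sum.inter_filter[symmetric] conj_commute)

lemma quad_sym:
  assumes "finite V" "\<And>v w. E v w \<Longrightarrow> E w v"
  shows "quad V E y z = quad V E z y"
proof -
  have "E v w = E w v" for v w using assms(2) by blast
  then show ?thesis unfolding quad_alt[OF assms(1)]
    by (subst sum.swap) (auto intro!: sum.cong)
qed

lemma quad_add_right:
  "quad V E y (\<lambda>v. z v + t * z' v) = quad V E y z + t * quad V E y z'"
  by (simp add: quad_def sum.distrib sum_distrib_left algebra_simps)

lemma quad_add_left:
  "quad V E (\<lambda>v. z v + t * z' v) y = quad V E z y + t * quad V E z' y"
  by (simp add: quad_def sum.distrib sum_distrib_left algebra_simps)

lemma quad_abs: "finite V \<Longrightarrow> quad V E y y \<le> quad V E (\<lambda>v. \<bar>y v\<bar>) (\<lambda>v. \<bar>y v\<bar>)"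
  unfolding quad_alt by (intro sum_mono) (auto simp flip: abs_mult)

text \<open>The vertex type may be infinite, so vectors are functions pinned to 0 outside
  \<open>V\<close>. The unit sphere is then a closed part of a product of compact sets, and the form
  attains its maximum on it.\<close>

lemma sphere_max:
  fixes V :: "'a set"
  assumes V: "finite V" "V \<noteq> {}"
  shows "\<exists>y. (\<Sum>v\<in>V. (y v)^2) = 1 \<and> (\<forall>z. (\<Sum>v\<in>V. (z v)^2) = 1 \<longrightarrow> quad V E z z \<le> quad V E y y)"
proof -
  define K :: "('a \<Rightarrow> real) set" where "K = (\<Pi>\<^sub>E v\<in>UNIV. if v \<in> V then {-1..1} else {0})"
  define S where "S = K \<inter> {y. (\<Sum>v\<in>V. (y v)^2) = 1}"
  have cont: "continuous_on UNIV (\<lambda>y :: 'a \<Rightarrow> real. y v)" for v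
    by (rule continuous_on_product_coordinates)
  have "compactin (product_topology (\<lambda>_. euclidean) UNIV) K"
    unfolding K_def by (auto simp: compactin_PiE)
  then have K: "compact K" by (simp add: euclidean_product_topology)
  have "closed {y :: 'a \<Rightarrow> real. (\<Sum>v\<in>V. (y v)^2) = 1}"
    by (intro closed_Collect_eq continuous_intros cont)
  then have cS: "compact S" unfolding S_def using K by (intro compact_Int_closed)
  obtain v0 where v0: "v0 \<in> V" using V by auto
  have "(\<lambda>v. if v = v0 then 1 else 0) \<in> S"
    using v0 V by (auto simp: S_def K_def if_distrib[of "\<lambda>x. x^2"] split: if_splits cong: if_cong)
  then have ne: "S \<noteq> {}" by auto
  have cq: "continuous_on S (\<lambda>y. quad V E y y)"
    unfolding quad_def by (intro continuous_intros continuous_on_subset[OF cont]) auto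
  obtain y where y: "y \<in> S" "\<And>z. z \<in> S \<Longrightarrow> quad V E z z \<le> quad V E y y"
    using continuous_attains_sup[OF cS ne cq] by auto
  have "quad V E z z \<le> quad V E y y" if z: "(\<Sum>v\<in>V. (z v)^2) = 1" for z
  proof -
    define z' where "z' v = (if v \<in> V then z v else 0)" for v
    have "- 1 \<le> z v \<and> z v \<le> 1" if "v \<in> V" for v
    proof -
      have "(z v)^2 \<le> 1" using member_le_sum[of v V "\<lambda>v. (z v)^2"] that V z by auto
      then show ?thesis by (simp add: abs_square_le_1 abs_le_iff)
    qed
    then have "z' \<in> S" using z by (auto simp: S_def K_def z'_def)
    moreover have "quad V E z' z' = quad V E z z"
      unfolding quad_def z'_def by (intro sum.cong) auto
    ultimately show ?thesis using y(2) by metis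
  qed
  then show ?thesis using y(1) by (auto simp: S_def)
qed

text \<open>
  The absolute value of a maximiser of the Rayleigh quotient is again a maximiser, and the first-order
  condition at a maximiser is the eigenvalue equation.
\<close>

lemma perron_exists:
  fixes V :: "'a set"
  assumes V: "finite V" "V \<noteq> {}" and sym: "\<And>v w. E v w \<Longrightarrow> E w v"
  shows "\<exists>(M :: real) y. (\<forall>v. y v \<ge> 0) \<and> (\<exists>v\<in>V. y v > 0) \<and> (\<forall>v\<in>V. M * y v = (\<Sum>w | w \<in> V \<and> E v w. y w)) \<and>
    (\<forall>(k :: real) z. (\<exists>v\<in>V. z v \<noteq> 0) \<and> (\<forall>v\<in>V. k * z v = (\<Sum>w | w \<in> V \<and> E v w. z w)) \<longrightarrow> k \<le> M)"
proof -
  obtain y0 where y0: "(\<Sum>v\<in>V. (y0 v)^2) = 1"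
    "\<And>z. (\<Sum>v\<in>V. (z v)^2) = 1 \<Longrightarrow> quad V E z z \<le> quad V E y0 y0"
    using sphere_max[OF V] by blast
  define y where "y v = \<bar>y0 v\<bar>" for v
  define M where "M = quad V E y0 y0"
  have y1: "(\<Sum>v\<in>V. (y v)^2) = 1" using y0(1) by (simp add: y_def)
  have "M \<le> quad V E y y" unfolding M_def y_def by (rule quad_abs[OF V(1)])
  then have My: "quad V E y y = M" using y0(2)[OF y1] by (simp add: M_def)
  have ray: "quad V E z z \<le> M * (\<Sum>v\<in>V. (z v)^2)" for z
  proof (cases "(\<Sum>v\<in>V. (z v)^2) = 0")
    case True
    then have "\<forall>v\<in>V. z v = 0" using V by (simp add: sum_nonneg_eq_0_iff)
    then have "quad V E z z = 0" by (simp add: quad_def)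
    then show ?thesis using True by simp
  next
    case False
    define n where "n = sqrt (\<Sum>v\<in>V. (z v)^2)"
    have n2: "n^2 = (\<Sum>v\<in>V. (z v)^2)" by (simp add: n_def sum_nonneg)
    then have n0: "n \<noteq> 0" using False by auto
    have "(\<Sum>v\<in>V. (z v / n)^2) = 1"
      using n0 by (simp add: power_divide sum_divide_distrib[symmetric] n2[symmetric])
    then have "quad V E (\<lambda>v. z v / n) (\<lambda>v. z v / n) \<le> M" using y0(2) by (simp add: M_def)
    moreover have "quad V E (\<lambda>v. z v / n) (\<lambda>v. z v / n) = quad V E z z / n^2"
      by (simp add: quad_def power2_eq_square sum_divide_distrib[symmetric])
    ultimately show ?thesis using n0 by (simp add: n2[symmetric] divide_le_eq)
  qed
  have "M * y v = (\<Sum>w | w \<in> V \<and> E v w. y w)" if v: "v \<in> V" for v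
  proof (rule ccontr)
    assume ne: "M * y v \<noteq> (\<Sum>w | w \<in> V \<and> E v w. y w)"
    define e :: "'a \<Rightarrow> real" where "e = (\<lambda>w. if w = v then 1 else 0)"
    define D where "D = (\<Sum>w | w \<in> V \<and> E v w. y w) - M * y v"
    have D0: "D \<noteq> 0" using ne by (simp add: D_def)
    have ey: "quad V E e y = (\<Sum>w | w \<in> V \<and> E v w. y w)"
      unfolding quad_def e_def using v V by (simp add: if_distrib[of "\<lambda>x. x * _"] cong: if_cong)
    have ye: "quad V E y e = quad V E e y" by (rule quad_sym[OF V(1) sym])
    \<comment> \<open>Perturbing the maximiser in the direction of \<open>v\<close>: the linear
      coefficient of this inequality in \<open>t\<close> has to vanish.\<close>
    have "2 * t * D \<le> t^2 * (M - quad V E e e)" for t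
    proof -
      have "quad V E (\<lambda>w. y w + t * e w) (\<lambda>w. y w + t * e w) =
          M + 2 * t * quad V E e y + t^2 * quad V E e e"
        unfolding quad_add_right quad_add_left My ye by (simp add: algebra_simps power2_eq_square)
      moreover have "(\<Sum>w\<in>V. (y w + t * e w)^2) = 1 + 2 * t * y v + t^2"
      proof -
        have "(\<Sum>w\<in>V. (y w + t * e w)^2) = (\<Sum>w\<in>V. (y w)^2) + (\<Sum>w\<in>V. (if w = v then 2 * t * y w + t^2 else 0))"
          unfolding sum.distrib[symmetric] by (intro sum.cong) (auto simp: e_def power2_eq_square algebra_simps)
        then show ?thesis using v V y1 by simp
      qed
      ultimately show ?thesis
        using ray[of "\<lambda>w. y w + t * e w"] by (simp add: ey D_def algebra_simps)
    qed
    note key = this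
    define B where "B = \<bar>M - quad V E e e\<bar> + 1"
    have B: "B > 0" by (simp add: B_def)
    \<comment> \<open>At \<open>t = D / B\<close> the linear term is twice the bound for the
      quadratic one.\<close>
    have "2 * (D / B) * D \<le> (D / B)^2 * (M - quad V E e e)" by (rule key)
    also have "\<dots> \<le> (D / B)^2 * B" by (intro mult_left_mono) (auto simp: B_def)
    finally have "2 * (D^2 / B) \<le> D^2 / B" using B by (simp add: power2_eq_square)
    moreover have "D^2 / B > 0" using B D0 by simp
    ultimately show False by simp
  qed
  moreover have "\<exists>v\<in>V. y v > 0"
  proof (rule ccontr)
    assume "\<not> (\<exists>v\<in>V. y v > 0)"
    then have "\<forall>v\<in>V. y v = 0" unfolding y_def by auto
    then show False using y1 by simp
  qed
  moreover have "\<forall>v. y v \<ge> 0" by (simp add: y_def)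
  moreover have "k \<le> M" if z: "\<exists>v\<in>V. z v \<noteq> 0" "\<forall>v\<in>V. k * z v = (\<Sum>w | w \<in> V \<and> E v w. z w)" for k z
  proof -
    have "quad V E z z = k * (\<Sum>v\<in>V. (z v)^2)"
      unfolding quad_def sum_distrib_left[of k] using z(2)
      by (intro sum.cong) (simp_all add: power2_eq_square flip: z(2)[rule_format])
    moreover have "(\<Sum>v\<in>V. (z v)^2) > 0"
    proof -
      obtain v where "v \<in> V" "z v \<noteq> 0" using z(1) by auto
      then show ?thesis using V by (intro sum_pos2[of V v]) auto
    qed
    ultimately show ?thesis using ray[of z] by simp
  qed
  ultimately show ?thesis
    by (intro exI[of _ M] exI[of _ y]) blast
qed

section \<open>The adjacency matrix and functions on the vertices\<close>

lemma eigenvalue_adj_mat: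
  assumes vs: "distinct vs" "set vs = pverts G"
  shows "eigenvalue (adj_mat G vs) k \<longleftrightarrow>
    (\<exists>z. (\<exists>v\<in>pverts G. z v \<noteq> 0) \<and> (\<forall>v\<in>pverts G. k * z v = (\<Sum>w | w \<in> pverts G \<and> (v, w) \<in> parcs G. z w)))"
    (is "?L \<longleftrightarrow> ?R")
proof -
  define n where "n = length vs"
  have bij: "bij_betw (nth vs) {..<n} (pverts G)"
    using bij_betw_nth[OF vs(1), of "{..<n}" "set vs"] vs(2) by (auto simp: n_def)
  have mv: "(adj_mat G vs *\<^sub>v vec n (\<lambda>i. z (vs ! i))) $ i = (\<Sum>w | w \<in> pverts G \<and> (vs ! i, w) \<in> parcs G. z w)"
    if "i < n" for i z
  proof -
    have "(adj_mat G vs *\<^sub>v vec n (\<lambda>i. z (vs ! i))) $ i =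
        (\<Sum>j<n. if (vs ! i, vs ! j) \<in> parcs G then z (vs ! j) else 0)"
      using that by (auto simp: adj_mat_def n_def scalar_prod_def atLeast0LessThan intro!: sum.cong)
    also have "\<dots> = (\<Sum>w\<in>pverts G. if (vs ! i, w) \<in> parcs G then z w else 0)"
      by (rule sum.reindex_bij_betw[OF bij])
    also have "\<dots> = (\<Sum>w | w \<in> pverts G \<and> (vs ! i, w) \<in> parcs G. z w)"
      using vs(2) by (simp add: sum.inter_filter flip: vs(2))
    finally show ?thesis .
  qed
  have ev: "eigenvector (adj_mat G vs) (vec n (\<lambda>i. z (vs ! i))) k \<longleftrightarrow>
    (\<exists>v\<in>pverts G. z v \<noteq> 0) \<and> (\<forall>v\<in>pverts G. k * z v = (\<Sum>w | w \<in> pverts G \<and> (v, w) \<in> parcs G. z w))" for z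
  proof -
    have P: "(\<forall>v\<in>pverts G. P v) \<longleftrightarrow> (\<forall>i<n. P (vs ! i))" for P
      unfolding vs(2)[symmetric] n_def by (auto simp: all_set_conv_all_nth)
    have "vec n (\<lambda>i. z (vs ! i)) = 0\<^sub>v n \<longleftrightarrow> (\<forall>v\<in>pverts G. z v = 0)"
      unfolding P by (auto simp: vec_eq_iff)
    moreover have "adj_mat G vs *\<^sub>v vec n (\<lambda>i. z (vs ! i)) = k \<cdot>\<^sub>v vec n (\<lambda>i. z (vs ! i)) \<longleftrightarrow>
      (\<forall>v\<in>pverts G. k * z v = (\<Sum>w | w \<in> pverts G \<and> (v, w) \<in> parcs G. z w))"
      unfolding P using mv[of _ z] by (auto simp: vec_eq_iff) (auto simp: adj_mat_def n_def)
    moreover have "dim_row (adj_mat G vs) = n" by (simp add: adj_mat_def n_def)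
    ultimately show ?thesis unfolding eigenvector_def by auto
  qed
  show ?thesis
  proof
    assume ?L
    then obtain y where y: "eigenvector (adj_mat G vs) y k" by (auto simp: eigenvalue_def)
    then have "y \<in> carrier_vec n" by (simp add: eigenvector_def adj_mat_def n_def)
    define z where "z v = y $ inv_into {..<n} (nth vs) v" for v
    have "y = vec n (\<lambda>i. z (vs ! i))"
      using \<open>y \<in> carrier_vec n\<close> bij by (intro eq_vecI) (auto simp: z_def bij_betw_def)
    then show ?R using y ev[of z] by auto
  next
    assume ?R
    then show ?L using ev unfolding eigenvalue_def by blast
  qed
qed

lemma lambda_max_perron:
  fixes G :: "'a pair_pre_digraph"
  assumes G: "pair_graph G" and ne: "pverts G \<noteq> {}"
  shows "\<exists>y :: 'a \<Rightarrow> real. (\<forall>v. y v \<ge> 0) \<and> (\<exists>v\<in>pverts G. y v > 0) \<and>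
    (\<forall>v\<in>pverts G. lambda_max G * y v = (\<Sum>w | (v, w) \<in> parcs G. y w))"
proof -
  interpret pair_graph G by (rule G)
  define vs where "vs = (SOME vs. distinct vs \<and> set vs = pverts G)"
  have "\<exists>vs. distinct vs \<and> set vs = pverts G"
    using finite_distinct_list[OF pair_finite_verts] by blast
  then have vs: "distinct vs" "set vs = pverts G"
    unfolding vs_def by (metis (mono_tags, lifting) someI_ex)+
  have sym: "(v, w) \<in> parcs G \<Longrightarrow> (w, v) \<in> parcs G" for v w
    using pair_sym_arcs by (auto simp: symmetric_def sym_def)
  obtain M :: real and y :: "'a \<Rightarrow> real" where y: "\<forall>v. y v \<ge> 0" "\<exists>v\<in>pverts G. y v > 0"
      "\<forall>v\<in>pverts G. M * y v = (\<Sum>w | w \<in> pverts G \<and> (v, w) \<in> parcs G. y w)"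
    and M: "\<And>(k :: real) z. (\<exists>v\<in>pverts G. z v \<noteq> 0) \<Longrightarrow>
      (\<forall>v\<in>pverts G. k * z v = (\<Sum>w | w \<in> pverts G \<and> (v, w) \<in> parcs G. z w)) \<Longrightarrow> k \<le> M"
    using perron_exists[OF pair_finite_verts ne, of "\<lambda>v w. (v, w) \<in> parcs G", OF sym] by blast
  have "finite (spectrum (adj_mat G vs))"
    using card_finite_spectrum(1)[of "adj_mat G vs" "length vs"] by (simp add: adj_mat_def)
  moreover have "M \<in> spectrum (adj_mat G vs)"
  proof -
    have "\<exists>v\<in>pverts G. y v \<noteq> 0" using y(2) by force
    then show ?thesis unfolding spectrum_def mem_Collect_eq eigenvalue_adj_mat[OF vs] using y(3) by blast
  qed
  moreover have "k \<le> M" if "k \<in> spectrum (adj_mat G vs)" for k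
    using that M unfolding spectrum_def mem_Collect_eq eigenvalue_adj_mat[OF vs] by blast
  ultimately have "lambda_max G = M"
    unfolding lambda_max_def vs_def[symmetric] by (intro Max_eqI)
  moreover have "{w. w \<in> pverts G \<and> (v, w) \<in> parcs G} = {w. (v, w) \<in> parcs G}" for v
    using in_arcsD2 by auto
  ultimately show ?thesis using y by auto
qed

text \<open>Pairing \<open>z\<close> with a nonnegative eigenvector \<open>y\<close> for
  \<open>lambda_max G\<close> and using symmetry gives both eigenvalues as factors of the same inner
  product, which is positive because \<open>z\<close> is strictly positive.\<close>

lemma lambda_max_eqI:
  fixes G :: "'a pair_pre_digraph" and z :: "'a \<Rightarrow> real"
  assumes G: "pair_graph G" and ne: "pverts G \<noteq> {}"
    and z: "\<And>v. v \<in> pverts G \<Longrightarrow> z v > 0" "\<And>v. v \<in> pverts G \<Longrightarrow> k * z v = (\<Sum>w | (v, w) \<in> parcs G. z w)"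
  shows "lambda_max G = k"
proof -
  interpret pair_graph G by (rule G)
  let ?E = "\<lambda>v w. (v, w) \<in> parcs G"
  let ?V = "pverts G"
  have sym: "?E v w \<Longrightarrow> ?E w v" for v w
    using pair_sym_arcs by (auto simp: symmetric_def sym_def)
  obtain y :: "'a \<Rightarrow> real" where y: "\<forall>v. y v \<ge> 0" "\<exists>v\<in>?V. y v > 0"
    "\<And>v. v \<in> ?V \<Longrightarrow> lambda_max G * y v = (\<Sum>w | ?E v w. y w)"
    using lambda_max_perron[OF G ne] by blast
  have nb: "{w. w \<in> ?V \<and> ?E v w} = {w. ?E v w}" for v using in_arcsD2 by auto
  have "quad ?V ?E z y = lambda_max G * (\<Sum>v\<in>?V. z v * y v)"
    unfolding quad_def nb sum_distrib_left[of "lambda_max G"] by (intro sum.cong) (simp_all flip: y(3))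
  moreover have "quad ?V ?E y z = k * (\<Sum>v\<in>?V. z v * y v)"
    unfolding quad_def nb sum_distrib_left[of k] by (intro sum.cong) (simp_all flip: z(2))
  moreover have "quad ?V ?E z y = quad ?V ?E y z"
    by (rule quad_sym[OF pair_finite_verts sym])
  moreover have "(\<Sum>v\<in>?V. z v * y v) > 0"
  proof -
    obtain v where v: "v \<in> ?V" "y v > 0" using y(2) by auto
    show ?thesis
    proof (rule sum_pos2[OF pair_finite_verts v(1)])
      show "0 < z v * y v" using v z(1) by simp
      show "0 \<le> z w * y w" if "w \<in> ?V" for w using y(1) z(1)[OF that] by simp
    qed
  qed
  ultimately show ?thesis by simp
qed

section \<open>Isomorphisms of hub graphs\<close>

text \<open>Arcs are pairs whose tail and head are their components, so the arc map of an
  isomorphism is forced by its vertex map.\<close>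

lemma graph_iso_iff:
  assumes "pair_wf_digraph G"
  shows "G \<simeq>\<^sub>g H \<longleftrightarrow> (\<exists>h. inj_on h (pverts G) \<and> pverts H = h ` pverts G \<and> parcs H = map_prod h h ` parcs G)"
proof
  assume "G \<simeq>\<^sub>g H"
  then obtain f where f: "pre_digraph.digraph_isomorphism (with_proj G) f" and H: "with_proj H = app_iso f (with_proj G)"
    by (auto simp: graph_iso_def digraph_iso_def)
  have "iso_tail f = fst" "iso_head f = snd"
    using arg_cong[OF H, of tail] arg_cong[OF H, of head] by simp_all
  then have "iso_arcs f e = map_prod (iso_verts f) (iso_verts f) e" if "e \<in> parcs G" for e
    using f that by (auto simp: pre_digraph.digraph_isomorphism_def prod_eq_iff)
  moreover have "pverts H = iso_verts f ` pverts G" "parcs H = iso_arcs f ` parcs G"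
    using arg_cong[OF H, of verts] arg_cong[OF H, of arcs] by simp_all
  moreover have "inj_on (iso_verts f) (pverts G)"
    using f by (simp add: pre_digraph.digraph_isomorphism_def)
  ultimately show "\<exists>h. inj_on h (pverts G) \<and> pverts H = h ` pverts G \<and> parcs H = map_prod h h ` parcs G"
    by (intro exI[of _ "iso_verts f"]) auto
next
  interpret pair_wf_digraph G by (rule assms)
  assume "\<exists>h. inj_on h (pverts G) \<and> pverts H = h ` pverts G \<and> parcs H = map_prod h h ` parcs G"
  then obtain h where h: "inj_on h (pverts G)" "pverts H = h ` pverts G" "parcs H = map_prod h h ` parcs G"
    by blast
  let ?f = "\<lparr>iso_verts = h, iso_arcs = map_prod h h, iso_head = snd, iso_tail = fst\<rparr>"
  have "inj_on (map_prod h h) (pverts G \<times> pverts G)" using h(1) by (auto simp: inj_on_def)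
  moreover have "parcs G \<subseteq> pverts G \<times> pverts G" using in_arcsD1 in_arcsD2 by auto
  ultimately have "inj_on (map_prod h h) (parcs G)" by (rule inj_on_subset)
  then have "pre_digraph.digraph_isomorphism (with_proj G) ?f"
    using h(1) wf_digraph_axioms by (simp add: pre_digraph.digraph_isomorphism_def)
  moreover have "with_proj H = app_iso ?f (with_proj G)"
    using h(2,3) by (intro pre_digraph.equality) simp_all
  ultimately show "G \<simeq>\<^sub>g H" unfolding graph_iso_def digraph_iso_def by blast
qed

definition hub_graph :: "bool \<Rightarrow> nat \<Rightarrow> nat \<Rightarrow> 'a pair_pre_digraph \<Rightarrow> bool" where
  "hub_graph f s i G \<longleftrightarrow> hub f s i (pverts G) (\<lambda>v w. (v, w) \<in> parcs G)"

lemma hub_graphI: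
  assumes "hub_frame f s i u a S I b c" "pverts G = {u, a} \<union> S \<union> I"
    "\<And>v w. (v, w) \<in> parcs G \<longleftrightarrow> hub_adj f u a S I b c v w"
  shows "hub_graph f s i G"
  unfolding hub_graph_def hub_def using assms by blast

lemma hub_graphE:
  assumes "hub_graph f s i G"
  obtains u a S I b c where "hub_frame f s i u a S I b c" "pverts G = {u, a} \<union> S \<union> I"
    "\<forall>v w. (v, w) \<in> parcs G \<longleftrightarrow> hub_adj f u a S I b c v w"
  using assms unfolding hub_graph_def hub_def by blast

lemma hub_adj_in:
  assumes "hub_frame f s i u a S I b c" "hub_adj f u a S I b c v w"
  shows "v \<in> {u, a} \<union> S \<union> I" "w \<in> {u, a} \<union> S \<union> I"
  using assms by (auto simp: hub_frame_def hub_adj_def)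

lemma bij_betw_extend_pair:
  assumes "finite S" "finite S'" "card S = card S'"
    and "f \<Longrightarrow> b \<in> S \<and> c \<in> S \<and> b \<noteq> c" "f \<Longrightarrow> b' \<in> S' \<and> c' \<in> S' \<and> b' \<noteq> c'"
  shows "\<exists>h. bij_betw h S S' \<and> (f \<longrightarrow> h b = b' \<and> h c = c')"
proof (cases f)
  case True
  note bc = assms(4,5)[OF True]
  have "card (S - {b, c}) = card (S' - {b', c'})"
    using bc assms(1-3) by (simp add: card_Diff_subset)
  then obtain g where g: "bij_betw g (S - {b, c}) (S' - {b', c'})"
    using finite_same_card_bij[of "S - {b, c}" "S' - {b', c'}"] assms(1,2) by auto
  have "bij_betw (g(b := b', c := c')) S S'"
  proof -
    have "bij_betw (g(b := b', c := c')) (S - {b, c}) (S' - {b', c'})"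
      using g by (subst bij_betw_cong[of _ _ g]) auto
    moreover have "bij_betw (g(b := b', c := c')) {b, c} {b', c'}"
      using bc by (auto simp: bij_betw_def)
    ultimately have "bij_betw (g(b := b', c := c')) ((S - {b, c}) \<union> {b, c}) ((S' - {b', c'}) \<union> {b', c'})"
      by (rule bij_betw_combine) auto
    moreover have "(S - {b, c}) \<union> {b, c} = S" "(S' - {b', c'}) \<union> {b', c'} = S'" using bc by auto
    ultimately show ?thesis by simp
  qed
  then show ?thesis using bc by (intro exI[of _ "g(b := b', c := c')"]) auto
next
  case False
  then show ?thesis using finite_same_card_bij[OF assms(1-3)] by auto
qed

text \<open>Bijections of the hubs, of \<open>S\<close> and of \<open>I\<close> are glued; the one
  on \<open>S\<close> is chosen to match the extra edges.\<close>

lemma hub_graph_unique: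
  assumes wf: "pair_wf_digraph G" and G: "hub_graph f s i G" and H: "hub_graph f s i H"
  shows "G \<simeq>\<^sub>g H"
proof -
  obtain u a S I b c where fr: "hub_frame f s i u a S I b c" and V: "pverts G = {u, a} \<union> S \<union> I"
    and E0: "\<forall>v w. (v, w) \<in> parcs G \<longleftrightarrow> hub_adj f u a S I b c v w"
    using G by (rule hub_graphE)
  obtain u' a' S' I' b' c' where fr': "hub_frame f s i u' a' S' I' b' c'" and V': "pverts H = {u', a'} \<union> S' \<union> I'"
    and E0': "\<forall>v w. (v, w) \<in> parcs H \<longleftrightarrow> hub_adj f u' a' S' I' b' c' v w"
    using H by (rule hub_graphE)
  note E = E0[rule_format] and E' = E0'[rule_format]
  note F = fr[unfolded hub_frame_def] and F' = fr'[unfolded hub_frame_def]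
  obtain h where h: "bij_betw h S S'" "f \<longrightarrow> h b = b' \<and> h c = c'"
    using bij_betw_extend_pair[of S S' f b c b' c'] F F' by auto
  obtain k where k: "bij_betw k I I'"
    using finite_same_card_bij[of I I'] F F' by auto
  define g where "g v = (if v = u then u' else if v = a then a' else if v \<in> S then h v else k v)" for v
  have gS: "g v = h v" "g v \<in> S'" if "v \<in> S" for v
    using that F h(1) by (auto simp: g_def bij_betw_def)
  have gI: "g v = k v" "g v \<in> I'" if "v \<in> I" for v
    using that F k(1) by (auto simp: g_def bij_betw_def)
  have gu: "g u = u'" "g a = a'" using F by (auto simp: g_def)
  have "bij_betw g {u, a} {u', a'}" using gu F F' by (auto simp: bij_betw_def)
  moreover have "bij_betw g S S'" using h(1) gS(1) by (subst bij_betw_cong[of _ _ h]) auto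
  ultimately have "bij_betw g ({u, a} \<union> S) ({u', a'} \<union> S')"
    by (rule bij_betw_combine) (use F' in auto)
  moreover have "bij_betw g I I'" using k(1) gI(1) by (subst bij_betw_cong[of _ _ k]) auto
  ultimately have bij: "bij_betw g ({u, a} \<union> S \<union> I) ({u', a'} \<union> S' \<union> I')"
    by (rule bij_betw_combine) (use F' in auto)
  have eq: "g v = g w \<longleftrightarrow> v = w" if "v \<in> pverts G" "w \<in> pverts G" for v w
    using bij that unfolding V bij_betw_def by (meson inj_on_eq_iff)
  have mem: "g v \<in> S' \<longleftrightarrow> v \<in> S" "g v \<in> I' \<longleftrightarrow> v \<in> I" if v: "v \<in> pverts G" for v
  proof -
    consider "v = u" | "v = a" | "v \<in> S" | "v \<in> I" using v V by blast
    then have "(g v \<in> S' \<longleftrightarrow> v \<in> S) \<and> (g v \<in> I' \<longleftrightarrow> v \<in> I)"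
    proof cases
      case 1 then show ?thesis using gu F F' by auto
    next
      case 2 then show ?thesis using gu F F' by auto
    next
      case 3 then show ?thesis using gS(2)[OF 3] F F' by auto
    next
      case 4 then show ?thesis using gI(2)[OF 4] F F' by auto
    qed
    then show "g v \<in> S' \<longleftrightarrow> v \<in> S" "g v \<in> I' \<longleftrightarrow> v \<in> I" by auto
  qed
  have inV: "u \<in> pverts G" "a \<in> pverts G" using V by auto
  have adj: "hub_adj f u' a' S' I' b' c' (g v) (g w) \<longleftrightarrow> hub_adj f u a S I b c v w"
    if v: "v \<in> pverts G" and w: "w \<in> pverts G" for v w
  proof -
    have "(g x = u') = (x = u)" "(g x = a') = (x = a)" if "x \<in> pverts G" for x
      using eq[OF that inV(1)] eq[OF that inV(2)] gu by auto
    moreover have "(g x = b') = (x = b)" "(g x = c') = (x = c)" if "f" "x \<in> pverts G" for x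
    proof -
      have "b \<in> S" "c \<in> S" using F that by auto
      then have "g b = b'" "g c = c'" "b \<in> pverts G" "c \<in> pverts G" using gS(1) h(2) that(1) V by auto
      then show "(g x = b') = (x = b)" "(g x = c') = (x = c)" using eq[OF that(2), of b] eq[OF that(2), of c] by auto
    qed
    ultimately show ?thesis
      unfolding hub_adj_def insert_iff Un_iff using mem[OF v] mem[OF w] v w by (cases f) simp_all
  qed
  have PG: "parcs G \<subseteq> pverts G \<times> pverts G"
    using wf by (auto simp: pair_wf_digraph_def)
  have gV: "pverts H = g ` pverts G" using bij V V' by (simp add: bij_betw_def)
  have "parcs H = map_prod g g ` parcs G"
  proof (intro equalityI subsetI)
    fix e assume e: "e \<in> parcs H"
    obtain v' w' where e': "e = (v', w')" by (cases e)
    then have "v' \<in> pverts H" "w' \<in> pverts H" using hub_adj_in[OF fr'] e E' V' by auto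
    then obtain v w where vw: "v \<in> pverts G" "w \<in> pverts G" "v' = g v" "w' = g w" using gV by auto
    then have "(v, w) \<in> parcs G" using e e' E E' adj by simp
    then show "e \<in> map_prod g g ` parcs G" using e' vw by force
  next
    fix e assume "e \<in> map_prod g g ` parcs G"
    then obtain v w where vw: "(v, w) \<in> parcs G" "e = (g v, g w)" by auto
    then have "v \<in> pverts G" "w \<in> pverts G" using PG by auto
    then show "e \<in> parcs H" using vw E E' adj by simp
  qed
  moreover have "inj_on g (pverts G)" using bij V by (simp add: bij_betw_def)
  ultimately show ?thesis using graph_iso_iff[OF wf] gV by blast
qed

lemma hub_graph_iso:
  assumes wf: "pair_wf_digraph G" and iso: "G \<simeq>\<^sub>g H" and H: "hub_graph f s i H"
  shows "hub_graph f s i G"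
proof -
  obtain g where g: "inj_on g (pverts G)" "pverts H = g ` pverts G" "parcs H = map_prod g g ` parcs G"
    using iso unfolding graph_iso_iff[OF wf] by auto
  define k where "k = inv_into (pverts G) g"
  have kg: "k (g v) = v" if "v \<in> pverts G" for v using g(1) that by (simp add: k_def)
  obtain u a S I b c where fr: "hub_frame f s i u a S I b c" and V: "pverts H = {u, a} \<union> S \<union> I"
    and E0: "\<forall>v w. (v, w) \<in> parcs H \<longleftrightarrow> hub_adj f u a S I b c v w"
    using H by (rule hub_graphE)
  note E = E0[rule_format]
  note F = fr[unfolded hub_frame_def]
  have inj: "inj_on k (pverts H)" unfolding k_def g(2) by (rule inj_on_inv_into) simp
  have eq: "k v = k w \<longleftrightarrow> v = w" if "v \<in> pverts H" "w \<in> pverts H" for v w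
    using inj that by (meson inj_on_eq_iff)
  have mem: "k v \<in> k ` X \<longleftrightarrow> v \<in> X" if "v \<in> pverts H" "X \<subseteq> pverts H" for v X
    using inj that by (meson inj_on_image_mem_iff)
  have sub: "S \<subseteq> pverts H" "I \<subseteq> pverts H" "u \<in> pverts H" "a \<in> pverts H" using V by auto
  have PG: "parcs G \<subseteq> pverts G \<times> pverts G"
    using wf by (auto simp: pair_wf_digraph_def)
  have arc: "(v, w) \<in> parcs G \<longleftrightarrow> (g v, g w) \<in> parcs H" if "v \<in> pverts G" "w \<in> pverts G" for v w
  proof
    assume "(g v, g w) \<in> parcs H"
    then obtain v1 w1 where vw: "(v1, w1) \<in> parcs G" "g v = g v1" "g w = g w1" using g(3) by auto
    then have "v1 \<in> pverts G" "w1 \<in> pverts G" using PG by auto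
    then show "(v, w) \<in> parcs G" using vw that g(1) by (auto dest: inj_onD)
  qed (use g(3) in force)
  have fr2: "hub_frame f s i (k u) (k a) (k ` S) (k ` I) (k b) (k c)"
  proof -
    have "card (k ` S) = s" "card (k ` I) = i"
      using F card_image inj_on_subset[OF inj sub(1)] inj_on_subset[OF inj sub(2)] by metis+
    moreover have "k ` S \<inter> k ` I = {}"
      using F inj_on_image_Int[OF inj sub(1,2)] by (metis image_empty)
    moreover have "f \<Longrightarrow> k b \<noteq> k c" using F sub(1) eq[of b c] by auto
    ultimately show ?thesis
      using F eq[OF sub(3,4)] mem[OF sub(3) sub(1)] mem[OF sub(3) sub(2)] mem[OF sub(4) sub(1)] mem[OF sub(4) sub(2)]
      by (auto simp: hub_frame_def)
  qed
  have kV: "pverts G = k ` pverts H"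
    unfolding g(2) using kg by (auto simp: image_image)
  have V2: "pverts G = {k u, k a} \<union> k ` S \<union> k ` I"
    unfolding kV V by auto
  have E2: "(v, w) \<in> parcs G \<longleftrightarrow> hub_adj f (k u) (k a) (k ` S) (k ` I) (k b) (k c) v w" for v w
  proof (cases "v \<in> pverts G \<and> w \<in> pverts G")
    case True
    define v' w' where "v' = g v" and "w' = g w"
    have v': "v' \<in> pverts H" "w' \<in> pverts H" "v = k v'" "w = k w'"
      using True kg g(2) by (auto simp: v'_def w'_def)
    have bc: "f \<Longrightarrow> b \<in> pverts H \<and> c \<in> pverts H" using F V by auto
    have "(v, w) \<in> parcs G \<longleftrightarrow> hub_adj f u a S I b c v' w'"
      using arc True E by (simp add: v'_def w'_def)
    also have "\<dots> \<longleftrightarrow> hub_adj f (k u) (k a) (k ` S) (k ` I) (k b) (k c) (k v') (k w')"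
      unfolding hub_adj_def insert_iff Un_iff
      using bc by (cases f) (simp_all add: mem[OF v'(1) sub(1)] mem[OF v'(1) sub(2)] mem[OF v'(2) sub(1)] mem[OF v'(2) sub(2)]
          eq[OF v'(1)] eq[OF v'(2)] sub)
    finally show ?thesis using v' by simp
  next
    case False
    then have "(v, w) \<notin> parcs G" using PG by auto
    moreover have "\<not> hub_adj f (k u) (k a) (k ` S) (k ` I) (k b) (k c) v w"
      using hub_adj_in[OF fr2, of v w] V2 False by auto
    ultimately show ?thesis by simp
  qed
  show ?thesis by (rule hub_graphI[OF fr2 V2 E2])
qed

text \<open>Turns isomorphism with a concrete graph into a property of \<open>G\<close> alone, so
  each graph of the theorem only has to be recognised as a hub graph.\<close>

lemma graph_iso_hub_graph:
  assumes "pair_wf_digraph G" "hub_graph f s i T"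
  shows "G \<simeq>\<^sub>g T \<longleftrightarrow> hub_graph f s i G"
  using hub_graph_unique[OF assms(1) _ assms(2)] hub_graph_iso[OF assms(1) _ assms(2)] by blast

section \<open>The extremal graphs\<close>

lemma split_graph_arcs:
  "(v, w) \<in> parcs (split_graph n 2) \<longleftrightarrow>
    hub_adj False (Inl 0) (Inl 1) (Inr ` {..<n - 2}) {} undefined undefined v w"
  by (cases v; cases w)
    (auto simp: split_graph_def join_graph_def disj_union_def complete_graph_def edgeless_def hub_adj_def
      less_2_cases_iff)

lemma split_graph_verts: "pverts (split_graph n 2) = {Inl 0, Inl 1} \<union> Inr ` {..<n - 2}"
  by (auto simp: split_graph_def join_graph_def disj_union_def complete_graph_def edgeless_def less_2_cases_iff)

lemma hub_graph_split_graph: "hub_graph False (n - 2) 0 (split_graph n 2)"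
proof (rule hub_graphI)
  show "hub_frame False (n - 2) 0 (Inl 0 :: nat + nat) (Inl 1) (Inr ` {..<n - 2}) {} undefined undefined"
    by (auto simp: hub_frame_def card_image)
qed (use split_graph_arcs split_graph_verts in auto)

text \<open>Which maximiser is chosen stays unknown; degree \<open>n - 1\<close> against at most 2
  shows that it is one of the two centres, and \<open>n \<ge> 4\<close> separates these
  degrees.\<close>

lemma max_degree_vertex_split_graph:
  assumes "n \<ge> 4"
  shows "max_degree_vertex (split_graph n 2) \<in> {Inl 0, Inl 1}"
proof -
  let ?G = "split_graph n 2"
  let ?d = "out_degree (with_proj ?G)"
  have fin: "finite (pverts ?G)" by (simp add: split_graph_verts)
  have d: "?d v = card {w. (v, w) \<in> parcs ?G}" for v
  proof -
    have "out_arcs (with_proj ?G) v = Pair v ` {w. (v, w) \<in> parcs ?G}"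
      by (auto simp: out_arcs_def)
    then show ?thesis by (simp add: out_degree_def card_image inj_on_def)
  qed
  have "Inl 0 \<in> pverts ?G" by (simp add: split_graph_verts)
  moreover have "\<forall>v. v \<in> pverts ?G \<longrightarrow> ?d v < Suc (Max (?d ` pverts ?G))"
    using fin by (auto simp: less_Suc_eq_le)
  ultimately have "max_degree_vertex ?G \<in> pverts ?G \<and> (\<forall>v. v \<in> pverts ?G \<longrightarrow> ?d v \<le> ?d (max_degree_vertex ?G))"
    unfolding max_degree_vertex_def arg_max_on_def by (rule arg_max_nat_lemma)
  then have mem: "max_degree_vertex ?G \<in> pverts ?G" and le: "?d (Inl 0) \<le> ?d (max_degree_vertex ?G)"
    by (simp_all add: split_graph_verts)
  moreover have "?d (Inl 0) = n - 1"
  proof -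
    have "{w. (Inl 0, w) \<in> parcs ?G} = insert (Inl 1) (Inr ` {..<n - 2})"
      by (auto simp: split_graph_arcs hub_adj_def)
    moreover have "Inl 1 \<notin> (Inr ` {..<n - 2} :: (nat + nat) set)" by auto
    ultimately show ?thesis using assms unfolding d by (simp add: card_image)
  qed
  moreover have "?d (Inr j) \<le> 2" for j
  proof -
    have "{w. (Inr j, w) \<in> parcs ?G} \<subseteq> {Inl 0, Inl 1}"
      by (auto simp: split_graph_arcs hub_adj_def)
    then have "card {w. (Inr j, w) \<in> parcs ?G} \<le> card {Inl 0 :: nat + nat, Inl 1}" by (intro card_mono) auto
    then show ?thesis unfolding d by simp
  qed
  ultimately have deg: "?d (Inl 0) = n - 1" "\<And>j. ?d (Inr j) \<le> 2" by blast+
  have "max_degree_vertex ?G \<noteq> Inr j" for j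
  proof
    assume "max_degree_vertex ?G = Inr j"
    then show False using le deg(2)[of j] assms unfolding deg(1) by simp
  qed
  then show ?thesis using mem unfolding split_graph_verts by blast
qed

lemma hub_graph_split_graph_pendant:
  assumes "n \<ge> t + 4"
  shows "hub_graph False (n - t - 2) t (split_graph_pendant t n 2)"
proof -
  define k where "k = n - t"
  define v0 where "v0 = max_degree_vertex (split_graph k 2)"
  \<comment> \<open>The centre that receives the pendant vertices becomes the first hub;
    \<open>v1\<close> is the other one.\<close>
  define v1 :: "nat + nat" where "v1 = (if v0 = Inl 0 then Inl 1 else Inl 0)"
  have v0: "v0 = Inl 0 \<or> v0 = Inl 1"
    using max_degree_vertex_split_graph[of k] assms by (auto simp: k_def v0_def)
  have G: "split_graph_pendant t n 2 = attach_pendants t v0 (split_graph k 2)"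
    by (simp add: split_graph_pendant_def k_def v0_def)
  let ?S = "Inl ` Inr ` {..<k - 2} :: ((nat + nat) + nat) set"
  show ?thesis unfolding G k_def[symmetric]
  proof (rule hub_graphI)
    show "hub_frame False (k - 2) t (Inl v0) (Inl v1) ?S (Inr ` {..<t}) undefined undefined"
      using v0 by (auto simp: hub_frame_def v1_def card_image)
    show "pverts (attach_pendants t v0 (split_graph k 2)) = {Inl v0, Inl v1} \<union> ?S \<union> Inr ` {..<t}"
      using v0 by (auto simp: attach_pendants_def split_graph_verts v1_def)
    fix v w
    have inl: "(Inl x, Inl y) \<in> parcs (attach_pendants t v0 (split_graph k 2)) \<longleftrightarrow> (x, y) \<in> parcs (split_graph k 2)" for x y
      by (auto simp: attach_pendants_def)
    have inr: "(Inl x, Inr y) \<in> parcs (attach_pendants t v0 (split_graph k 2)) \<longleftrightarrow> x = v0 \<and> y < t"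
      "(Inr y, Inl x) \<in> parcs (attach_pendants t v0 (split_graph k 2)) \<longleftrightarrow> x = v0 \<and> y < t"
      "(Inr y, Inr z) \<notin> parcs (attach_pendants t v0 (split_graph k 2))" for x y z
      by (auto simp: attach_pendants_def)
    show "(v, w) \<in> parcs (attach_pendants t v0 (split_graph k 2)) \<longleftrightarrow>
        hub_adj False (Inl v0) (Inl v1) ?S (Inr ` {..<t}) undefined undefined v w"
      using v0
      by (cases v; cases w) (auto simp: inl inr split_graph_arcs hub_adj_def v1_def)
  qed
qed

lemma star_matching_arcs:
  "(v, w) \<in> parcs (star_matching n 1) \<longleftrightarrow>
    v = Inl 0 \<and> w \<in> Inr ` {..<n - 1} \<or> w = Inl 0 \<and> v \<in> Inr ` {..<n - 1} \<or>
    v = Inr 0 \<and> w = Inr 1 \<or> v = Inr 1 \<and> w = Inr 0"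
  by (cases v; cases w)
    (auto simp: star_matching_def star_graph_def join_graph_def disj_union_def complete_graph_def edgeless_def)

lemma star_matching_verts: "pverts (star_matching n 1) = {Inl 0} \<union> Inr ` {..<n - 1}"
  by (auto simp: star_matching_def star_graph_def join_graph_def disj_union_def complete_graph_def edgeless_def)

lemmas star_matching_simps = star_matching_arcs[unfolded One_nat_def] star_matching_verts[unfolded One_nat_def]

text \<open>The apex is the first hub and the centre of the star the second;
  \<open>k \<ge> 3\<close> provides both ends of the added edge.\<close>

lemma hub_graph_join_star_matching:
  assumes "k \<ge> 3"
  shows "hub_graph True (k - 1) 0 (join_graph (complete_graph 1) (star_matching k 1))"
proof (rule hub_graphI)
  let ?S = "Inr ` Inr ` {..<k - 1} :: (nat + (nat + nat)) set"
  show "hub_frame True (k - 1) 0 (Inl 0) (Inr (Inl 0)) ?S {} (Inr (Inr 0)) (Inr (Inr 1))"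
    using assms by (auto simp: hub_frame_def card_image)
  show "pverts (join_graph (complete_graph 1) (star_matching k 1)) = {Inl 0, Inr (Inl 0)} \<union> ?S \<union> {}"
    by (auto simp: join_graph_def disj_union_def complete_graph_def star_matching_simps)
  show "(v, w) \<in> parcs (join_graph (complete_graph 1) (star_matching k 1)) \<longleftrightarrow>
      hub_adj True (Inl 0) (Inr (Inl 0)) ?S {} (Inr (Inr 0)) (Inr (Inr 1)) v w" for v w
    by (cases v; cases w)
      (auto simp: join_graph_def disj_union_def complete_graph_def star_matching_simps hub_adj_def)
qed

lemma hub_graph_join_star_matching_isolated:
  assumes "k \<ge> 3"
  shows "hub_graph True (k - 1) 1 (join_graph (complete_graph 1) (disj_union (star_matching k 1) (complete_graph 1)))"
proof (rule hub_graphI)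
  let ?S = "Inr ` Inl ` Inr ` {..<k - 1} :: (nat + ((nat + nat) + nat)) set"
  show "hub_frame True (k - 1) 1 (Inl 0) (Inr (Inl (Inl 0))) ?S {Inr (Inr 0)} (Inr (Inl (Inr 0))) (Inr (Inl (Inr 1)))"
    using assms by (auto simp: hub_frame_def card_image)
  show "pverts (join_graph (complete_graph 1) (disj_union (star_matching k 1) (complete_graph 1))) =
      {Inl 0, Inr (Inl (Inl 0))} \<union> ?S \<union> {Inr (Inr 0)}"
    by (auto simp: join_graph_def disj_union_def complete_graph_def star_matching_simps)
  have arcs: "(v, w) \<in> parcs (disj_union (star_matching k 1) (complete_graph 1)) \<longleftrightarrow>
      (\<exists>x y. v = Inl x \<and> w = Inl y \<and> (x, y) \<in> parcs (star_matching k 1))" for v w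
    by (auto simp: disj_union_def complete_graph_def)
  have verts: "pverts (disj_union (star_matching k 1) (complete_graph 1)) = Inl ` pverts (star_matching k 1) \<union> {Inr 0}"
    by (auto simp: disj_union_def complete_graph_def)
  have join: "(v, w) \<in> parcs (join_graph (complete_graph 1) G) \<longleftrightarrow>
      (\<exists>x y. v = Inr x \<and> w = Inr y \<and> (x, y) \<in> parcs G) \<or> v = Inl 0 \<and> w \<in> Inr ` pverts G \<or> w = Inl 0 \<and> v \<in> Inr ` pverts G"
    for v w and G :: "((nat + nat) + nat) pair_pre_digraph"
    by (auto simp: join_graph_def disj_union_def complete_graph_def)
  show "(v, w) \<in> parcs (join_graph (complete_graph 1) (disj_union (star_matching k 1) (complete_graph 1))) \<longleftrightarrow>
      hub_adj True (Inl 0) (Inr (Inl (Inl 0))) ?S {Inr (Inr 0)} (Inr (Inl (Inr 0))) (Inr (Inl (Inr 1))) v w" for v w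
    unfolding join arcs verts star_matching_arcs star_matching_verts hub_adj_def by auto
qed

section \<open>The spectral radius of the extremal graphs\<close>

text \<open>These are the eigenvalue equations at \<open>u\<close> and \<open>a\<close> of a hub
  graph with entries 1 at \<open>u\<close>, \<open>y\<close> at \<open>a\<close>,
  \<open>1 / l\<close> on \<open>I\<close>, and \<open>(1 + y) / l\<close> on \<open>S\<close>,
  except \<open>(1 + y) / (l - 1)\<close> at \<open>b\<close> and \<open>c\<close>; \<open>q\<close>
  accounts for that exception. Multiplied by \<open>2 * L * l\<close>, the first one reduces to
  \<open>psi2 m l = 0\<close>.\<close>

lemma psi2_balance:
  fixes l y :: real
  assumes l: "l > 5" and psi: "psi2 m l = 0" and m: "m = 1 + 2 * s + i + (if f then 1 else 0)"
    and tg: "target f i m" and y: "l * (l + 1) * (1 - y) = real i"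
  defines "q \<equiv> if f then 2 / (l - 1) - 2 / l else 0"
  shows "l = y + (1 + y) * (real s / l + q) + real i / l" and "l * y = 1 + (1 + y) * (real s / l + q)"
proof -
  define d where "d = l^2 - l - real m + 2"
  define L where "L = l * (l + 1)"
  have L_sq: "L = l^2 + l" by (simp add: L_def power2_eq_square algebra_simps)
  have L0: "L > 0" using l by (simp add: L_def)
  have yL: "L * y = L - i" using y unfolding L_def[symmetric] right_diff_distrib by simp
  have m': "real m = l^2 - l + 2 - d" by (simp add: d_def)
  let ?X = "2 * L * l^2 - 2 * l * (L - i) - 2 * real s * (2 * L - i) - 2 * i * L"
  have main: "?X = (if f then 4 * (2 * L - i) / (l - 1) else 0)"
  proof (cases "even m")
    case ev: True
    show ?thesis
    proof (cases "m \<le> 72")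
      case True
      then have fi: "f" "i = 0" using tg ev by (auto simp: target_def)
      have s: "2 * real s = l^2 - l - d" using m m' fi by simp
      have e: "(l - 1) * d = 4" using psi psi2_even_small[OF ev True, of l] by (simp add: d_def)
      have "?X = 2 * L * d" unfolding s fi by (simp add: algebra_simps)
      then have "(l - 1) * ?X = (l - 1) * (2 * L * d)" by (simp only:)
      also have "\<dots> = 2 * L * ((l - 1) * d)" by simp
      finally have "(l - 1) * ?X = 4 * (2 * L - i)" unfolding e fi by simp
      then show ?thesis using l fi(1) by (simp add: field_simps)
    next
      case False
      then have fi: "\<not> f" "i = 1" using tg ev by (auto simp: target_def)
      have s: "2 * real s = l^2 - l - d" using m m' fi by simp
      have "2 * (d * L) - (L + d) = 0" using psi psi2_even_large[OF ev False, of l] by (simp add: d_def L_def)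
      moreover have "?X = 2 * (d * L) - (L + d)" unfolding s fi L_sq by (simp add: algebra_simps power2_eq_square)
      ultimately show ?thesis using fi by simp
    qed
  next
    case od: False
    show ?thesis
    proof (cases "m \<le> 71")
      case True
      then have fi: "f" "i = 1" using tg od by (auto simp: target_def)
      have s: "2 * real s = l^2 - l - 1 - d" using m m' fi by simp
      have "2 * (l - 1) * (d * L) - (8 * L - (l - 1) * L - 4 + (l - 1) * (1 + d)) = 0"
        using psi psi2_odd_small[OF od True, of l] by (simp add: d_def L_def)
      moreover have "(l - 1) * ?X - 4 * (2 * L - i) =
          2 * (l - 1) * (d * L) - (8 * L - (l - 1) * L - 4 + (l - 1) * (1 + d))"
        unfolding s fi L_sq by (simp add: algebra_simps power2_eq_square)
      ultimately have "(l - 1) * ?X = 4 * (2 * L - i)" by simp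
      then show ?thesis using l fi(1) by (simp add: field_simps)
    next
      case False
      then have fi: "\<not> f" "i = 2" using tg od by (auto simp: target_def)
      have s: "2 * real s = l^2 - l - 1 - d" using m m' fi by simp
      have "d * L - (1 + d) = 0" using psi psi2_odd_large[OF od False, of l] by (simp add: d_def L_def)
      moreover have "?X = 2 * (d * L - (1 + d))" unfolding s fi L_sq by (simp add: algebra_simps power2_eq_square)
      ultimately show ?thesis using fi by simp
    qed
  qed
  have ql: "2 * l * q = (if f then 4 / (l - 1) else 0)" using l by (simp add: q_def field_simps)
  have "2 * L * l * (y + (1 + y) * (real s / l + q) + i / l) =
      2 * l * (L * y) + 2 * real s * (L + L * y) + (2 * l * q) * (L + L * y) + 2 * i * L"
    using l by (simp add: field_simps)
  also have "\<dots> = 2 * L * l^2" using main unfolding yL ql by (cases f) (simp_all add: algebra_simps)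
  finally have "(2 * L * l) * (y + (1 + y) * (real s / l + q) + i / l) = (2 * L * l) * l"
    by (simp add: power2_eq_square)
  then show A: "l = y + (1 + y) * (real s / l + q) + i / l" using L0 l by simp
  \<comment> \<open>The difference of the two equations, which is the definition of
    \<open>y\<close>.\<close>
  have "(l + 1) * (1 - y) = i / l" using y l by (simp add: field_simps)
  then show "l * y = 1 + (1 + y) * (real s / l + q)" using A by (simp add: algebra_simps)
qed

lemma hub_lambda_max:
  assumes G: "pair_graph G" and hub: "hub_graph f s i G" and m: "m = 1 + 2 * s + i + (if f then 1 else 0)"
    and tg: "target f i m" and m22: "m \<ge> 22"
  shows "lambda_max G = rho2 m"
proof -
  obtain u a S I b c where fr: "hub_frame f s i u a S I b c" and V: "pverts G = {u, a} \<union> S \<union> I"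
    and E0: "\<forall>v w. (v, w) \<in> parcs G \<longleftrightarrow> hub_adj f u a S I b c v w"
    using hub by (rule hub_graphE)
  note E = E0[rule_format] and F = fr[unfolded hub_frame_def]
  have fin: "finite S" "finite I" and card: "card S = s" "card I = i" using F by auto
  define l where "l = rho2 m"
  have l: "l > 5" and psi: "psi2 m l = 0" using rho2_bounds[OF m22] by (auto simp: l_def)
  have i2: "i \<le> 2" using tg by (auto simp: target_def split: if_splits)
  define y where "y = 1 - real i / (l * (l + 1))"
  have yL: "l * (l + 1) * (1 - y) = real i" using l by (simp add: y_def)
  have "real i / (l * (l + 1)) \<le> 2 / 30"
  proof (rule frac_le)
    have "5 * 6 \<le> l * (l + 1)" using l by (intro mult_mono) auto
    then show "30 \<le> l * (l + 1)" by simp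
  qed (use i2 in auto)
  also have "\<dots> < (1 :: real)" by simp
  finally have y0: "y > 0" by (simp add: y_def)
  define q where "q = (if f then 2 / (l - 1) - 2 / l else 0)"
  note bal = psi2_balance[OF l psi m tg yL, folded q_def]
  define z where "z v = (if v = u then 1 else if v = a then y else if v \<in> I then 1 / l
    else if f \<and> (v = b \<or> v = c) then (1 + y) / (l - 1) else (1 + y) / l)" for v
  have zu: "z u = 1" and za: "z a = y" using F by (auto simp: z_def)
  have zI: "z v = 1 / l" if "v \<in> I" for v using F that by (auto simp: z_def)
  have zbc: "z b = (1 + y) / (l - 1)" "z c = (1 + y) / (l - 1)" if f using F that by (auto simp: z_def)
  have zS: "z v = (1 + y) / l" if "v \<in> S" "f \<Longrightarrow> v \<noteq> b \<and> v \<noteq> c" for v using F that by (auto simp: z_def)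
  have sumS: "(\<Sum>v\<in>S. z v) = (1 + y) * (real s / l + q)"
  proof (cases f)
    case True
    have bc: "b \<in> S" "c \<in> S" "b \<noteq> c" using F True by auto
    have "card {b, c} \<le> card S" using bc fin by (intro card_mono) auto
    then have s2: "s \<ge> 2" using bc card by simp
    have "(\<Sum>v\<in>S. z v) = (\<Sum>v\<in>S - {b, c}. z v) + (\<Sum>v\<in>{b, c}. z v)"
      using bc fin by (intro sum.subset_diff) auto
    also have "(\<Sum>v\<in>S - {b, c}. z v) = (\<Sum>v\<in>S - {b, c}. (1 + y) / l)"
      using zS by (intro sum.cong) auto
    also have "\<dots> = (real s - 2) * ((1 + y) / l)"
      using bc fin card s2 by (simp add: card_Diff_subset of_nat_diff)
    also have "(\<Sum>v\<in>{b, c}. z v) = 2 * ((1 + y) / (l - 1))" using bc zbc True by simp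
    also have "(real s - 2) * ((1 + y) / l) + 2 * ((1 + y) / (l - 1)) = (1 + y) * (real s / l + q)"
      unfolding q_def divide_inverse using True by (simp add: algebra_simps)
    finally show ?thesis .
  next
    case False
    have "(\<Sum>v\<in>S. z v) = (\<Sum>v\<in>S. (1 + y) / l)" using zS False by (intro sum.cong) auto
    then show ?thesis using False card by (simp add: q_def field_simps)
  qed
  have sumI: "(\<Sum>v\<in>I. z v) = real i / l" using zI card by simp
  have "lambda_max G = l"
  proof (rule lambda_max_eqI[OF G, of z])
    show "pverts G \<noteq> {}" using V by auto
    show "z v > 0" for v using l y0 by (auto simp: z_def)
    fix v assume "v \<in> pverts G"
    then consider "v = u" | "v = a" | "v \<in> I" | "v \<in> S" "f" "v = b" | "v \<in> S" "f" "v = c"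
      | "v \<in> S" "f \<longrightarrow> v \<noteq> b \<and> v \<noteq> c" using V by blast
    then show "l * z v = (\<Sum>w | (v, w) \<in> parcs G. z w)"
    proof cases
      case 1
      have "{w. (v, w) \<in> parcs G} = insert a (S \<union> I)" unfolding E hub_adj_def 1 using F by auto
      moreover have "(\<Sum>w\<in>insert a (S \<union> I). z w) = y + ((\<Sum>v\<in>S. z v) + (\<Sum>v\<in>I. z v))"
        using F za by (simp add: sum.union_disjoint)
      ultimately show ?thesis using bal(1) 1 zu unfolding sumS sumI by simp
    next
      case 2
      have "{w. (v, w) \<in> parcs G} = insert u S" unfolding E hub_adj_def 2 using F by auto
      moreover have "(\<Sum>w\<in>insert u S. z w) = 1 + (\<Sum>v\<in>S. z v)" using F zu by simp
      ultimately show ?thesis using bal(2) 2 za unfolding sumS by simp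
    next
      case 3
      have "{w. (v, w) \<in> parcs G} = {u}" unfolding E hub_adj_def using F 3 by auto
      then show ?thesis using zI[OF 3] zu l by simp
    next
      case 4
      have n: "{w. (v, w) \<in> parcs G} = {u, a, c}" unfolding E hub_adj_def using F 4 by auto
      have sm: "(\<Sum>w\<in>{u, a, c}. z w) = 1 + y + z c"
      proof -
        have "u \<noteq> c" "a \<noteq> c" using F 4 by blast+
        then show ?thesis using F zu za by simp
      qed
      show ?thesis unfolding n sm unfolding 4(3) zbc[OF 4(2)] using l by (simp add: field_simps)
    next
      case 5
      have n: "{w. (v, w) \<in> parcs G} = {u, a, b}" unfolding E hub_adj_def using F 5 by auto
      have sm: "(\<Sum>w\<in>{u, a, b}. z w) = 1 + y + z b"
      proof -
        have "u \<noteq> b" "a \<noteq> b" using F 5 by blast+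
        then show ?thesis using F zu za by simp
      qed
      show ?thesis unfolding n sm unfolding 5(3) zbc[OF 5(2)] using l by (simp add: field_simps)
    next
      case 6
      have "{w. (v, w) \<in> parcs G} = {u, a}" unfolding E hub_adj_def using F 6 by auto
      moreover have "(\<Sum>w\<in>{u, a}. z w) = 1 + y" using F zu za by auto
      ultimately show ?thesis using 6 zS[of v] l by simp
    qed
  qed
  then show ?thesis by (simp add: l_def)
qed

section \<open>From pair graphs to the abstract setting, and the theorem\<close>

lemma (in pair_graph) arc_sym: "(v, w) \<in> parcs G \<Longrightarrow> (w, v) \<in> parcs G"
  using pair_sym_arcs by (auto simp: symmetric_def sym_def)

lemma (in pair_graph) degree_sum: "2 * card (edges G) = (\<Sum>v\<in>pverts G. card {w. (v, w) \<in> parcs G})"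
proof -
  define h where "h = (\<lambda>e :: 'a \<times> 'a. {fst e, snd e})"
  have edges: "edges G = h ` parcs G" by (force simp: edges_def h_def)
  have nb: "finite {w. (v, w) \<in> parcs G}" for v
    using in_arcsD2 by (intro finite_subset[OF _ pair_finite_verts]) auto
  have "parcs G = Sigma (pverts G) (\<lambda>v. {w. (v, w) \<in> parcs G})" using in_arcsD1 by auto
  then have "card (parcs G) = (\<Sum>v\<in>pverts G. card {w. (v, w) \<in> parcs G})"
    using card_SigmaI[OF pair_finite_verts, of "\<lambda>v. {w. (v, w) \<in> parcs G}"] nb by simp
  moreover have "card (parcs G) = (\<Sum>e\<in>h ` parcs G. 2)"
  proof -
    have "card (parcs G) = (\<Sum>p\<in>parcs G. 1)" by simp
    also have "\<dots> = (\<Sum>e\<in>h ` parcs G. \<Sum>p\<in>{p \<in> parcs G. h p = e}. 1)"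
      by (rule sum.image_gen[OF pair_finite_arcs])
    also have "\<dots> = (\<Sum>e\<in>h ` parcs G. 2)"
    proof (rule sum.cong[OF refl])
      fix e assume "e \<in> h ` parcs G"
      then obtain v w where vw: "(v, w) \<in> parcs G" "e = {v, w}" by (auto simp: h_def)
      have "v \<noteq> w" using pair_no_loops[OF vw(1)] by simp
      have "{p \<in> parcs G. h p = e} = {(v, w), (w, v)}"
        using vw arc_sym by (auto simp: h_def doubleton_eq_iff)
      then show "(\<Sum>p\<in>{p \<in> parcs G. h p = e}. 1) = (2 :: nat)" using \<open>v \<noteq> w\<close> by simp
    qed
    finally show ?thesis .
  qed
  ultimately show ?thesis unfolding edges by simp
qed

text \<open>The enumeration \<open>p\<close> embeds the 6-cycle; subgraphs need not be induced, so
  chords do no harm.\<close>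

lemma (in pair_graph) no_hexagon_if_no_C6:
  assumes no: "\<not> contains_subgraph G (cycle_graph 6)"
    and d: "distinct [a, b, c, d, e, f]" and E: "(a, b) \<in> parcs G" "(b, c) \<in> parcs G" "(c, d) \<in> parcs G"
      "(d, e) \<in> parcs G" "(e, f) \<in> parcs G" "(f, a) \<in> parcs G"
  shows False
proof -
  define p where "p = (!) [a, b, c, d, e, f]"
  have less6: "i < 6 \<longleftrightarrow> i \<in> {0, 1, 2, 3, 4, 5}" for i :: nat by auto
  have inj: "inj_on p {..<6}" unfolding p_def using d by (intro inj_on_nth) auto
  have step: "(p i, p ((i + 1) mod 6)) \<in> parcs G" if "i < 6" for i
    using that E unfolding less6 by (auto simp: p_def)
  define H where "H = \<lparr>pverts = p ` {..<6}, parcs = map_prod p p ` parcs (cycle_graph 6)\<rparr>"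
  have C: "parcs (cycle_graph 6) \<subseteq> {..<6} \<times> {..<6}" by (auto simp: cycle_graph_def)
  have wf: "pair_wf_digraph H" using C by unfold_locales (auto simp: H_def)
  have arcs: "parcs H \<subseteq> parcs G"
  proof
    fix e assume "e \<in> parcs H"
    then obtain i j where ij: "e = (p i, p j)" "i < 6" "j < 6" "j = (i + 1) mod 6 \<or> i = (j + 1) mod 6"
      by (auto simp: H_def cycle_graph_def)
    then show "e \<in> parcs G" using step[of i] step[of j] arc_sym by auto
  qed
  have verts: "pverts H \<subseteq> pverts G"
    using step in_arcsD1 by (auto simp: H_def)
  have "subgraph (with_proj H) (with_proj G)"
  proof (rule subgraphI)
    show "verts (with_proj H) \<subseteq> verts (with_proj G)" "arcs (with_proj H) \<subseteq> arcs (with_proj G)"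
      using arcs verts by simp_all
    show "wf_digraph (with_proj G)" by (rule wf_digraph_axioms)
    interpret H: pair_wf_digraph H by (rule wf)
    show "wf_digraph (with_proj H)" by (rule H.wf_digraph_axioms)
    show "compatible (with_proj G) (with_proj H)" by (simp add: compatible_def)
  qed
  moreover have "H \<simeq>\<^sub>g cycle_graph 6"
    unfolding graph_iso_iff[OF wf]
  proof (intro exI conjI)
    let ?k = "inv_into {..<6} p"
    have kp: "?k (p i) = i" if "i < 6" for i using inj that by simp
    show "inj_on ?k (pverts H)" unfolding H_def by (simp add: inj_on_inv_into)
    show "pverts (cycle_graph 6) = ?k ` pverts H"
      using kp by (auto simp: H_def cycle_graph_def image_image)
    have "map_prod ?k ?k (map_prod p p e) = e" if "e \<in> parcs (cycle_graph 6)" for e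
      using that C kp by auto
    then show "parcs (cycle_graph 6) = map_prod ?k ?k ` parcs H"
      by (simp add: H_def image_image)
  qed
  ultimately show False using no unfolding contains_subgraph_def by blast
qed

lemma hub_if_rho2_le:
  assumes m22: "m \<ge> 22" and G: "pair_graph G" and ce: "card (edges G) = m"
    and ni: "\<not> (\<exists>v. isolated G v)" and nc: "\<not> contains_subgraph G (cycle_graph 6)"
    and le: "rho2 m \<le> lambda_max G"
  shows "\<exists>f s i. hub_graph f s i G \<and> m = 1 + 2 * s + i + (if f then 1 else 0) \<and>
    (target f i m \<or> odd m \<and> \<not> f \<and> i = 0)"
proof -
  interpret pair_graph G by (rule G)
  define l where "l = lambda_max G"
  have r: "rho2 m > 5" "(rho2 m)^2 - rho2 m > real m - 2" using rho2_bounds[OF m22] by auto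
  have l5: "l > 5" using r le by (simp add: l_def)
  have "(rho2 m) * (rho2 m - 1) \<le> l * (l - 1)" using r le by (intro mult_mono) (auto simp: l_def)
  then have l2: "l^2 - l > real m - 2" using r by (simp add: power2_eq_square algebra_simps)
  have "edges G \<noteq> {}" using ce m22 by auto
  then have ne: "pverts G \<noteq> {}" using in_arcsD1 by (auto simp: edges_def)
  obtain y :: "'a \<Rightarrow> real" where y: "\<forall>v. y v \<ge> 0" "\<exists>v\<in>pverts G. y v > 0"
    "\<And>v. v \<in> pverts G \<Longrightarrow> l * y v = (\<Sum>w | (v, w) \<in> parcs G. y w)"
    using lambda_max_perron[OF G ne] unfolding l_def by blast
  obtain u where u: "u \<in> pverts G" "\<And>v. v \<in> pverts G \<Longrightarrow> y v \<le> y u"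
    using obtains_MAX[OF pair_finite_verts ne, of y] pair_finite_verts by (metis Max_ge finite_imageI image_eqI)
  obtain v0 where "v0 \<in> pverts G" "y v0 > 0" using y(2) by auto
  then have yu: "y u > 0" using u(2)[of v0] by simp
  interpret perron "pverts G" "\<lambda>v w. (v, w) \<in> parcs G" "\<lambda>v. y v / y u" l u m
  proof unfold_locales
    show "\<exists>w. (v, w) \<in> parcs G" if "v \<in> pverts G" for v using ni that by (auto simp: isolated_def)
    show "2 * m = (\<Sum>v\<in>pverts G. card {w. (v, w) \<in> parcs G})" using degree_sum ce by simp
    show "l * (y v / y u) = (\<Sum>w | (v, w) \<in> parcs G. y w / y u)" if "v \<in> pverts G" for v
      using y(3)[OF that] by (simp add: sum_divide_distrib[symmetric])
    show False if "distinct [a, b, c, d, e, f]" "(a, b) \<in> parcs G" "(b, c) \<in> parcs G" "(c, d) \<in> parcs G"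
      "(d, e) \<in> parcs G" "(e, f) \<in> parcs G" "(f, a) \<in> parcs G" for a b c d e f
      using no_hexagon_if_no_C6[OF nc that] .
    show "(v, v) \<notin> parcs G" for v using pair_no_loops by force
  qed (use pair_finite_verts in_arcsD1 arc_sym y u yu l5 l2 in auto)
  have "psi2 m l \<ge> 0" using psi2_nonneg[OF le] by (simp add: l_def)
  then show ?thesis using hub_conclusion m22 unfolding hub_graph_def by blast
qed

theorem theorem1p4:
  fixes G :: "'a pair_pre_digraph" and m :: nat
  assumes "m \<ge> 22"
    and "pair_graph G"
    and "card (edges G) = m"
    and "\<not> (\<exists>v. isolated G v)"
    and "\<not> contains_subgraph G (cycle_graph 6)"
    and "odd m \<Longrightarrow> \<not> G \<simeq>\<^sub>g split_graph ((m + 3) div 2) 2"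
  shows "lambda_max G \<le> rho2 m
    \<and> (even m \<and> m \<le> 72 \<longrightarrow>
        (lambda_max G = rho2 m \<longleftrightarrow> G \<simeq>\<^sub>g join_graph (complete_graph 1) (star_matching (m div 2) 1)))
    \<and> (even m \<and> m \<ge> 74 \<longrightarrow>
        (lambda_max G = rho2 m \<longleftrightarrow> G \<simeq>\<^sub>g split_graph_pendant 1 ((m + 4) div 2) 2))
    \<and> (odd m \<and> m \<le> 71 \<longrightarrow>
        (lambda_max G = rho2 m \<longleftrightarrow>
          G \<simeq>\<^sub>g join_graph (complete_graph 1) (disj_union (star_matching ((m - 1) div 2) 1) (complete_graph 1))))
    \<and> (odd m \<and> m \<ge> 73 \<longrightarrow>
        (lambda_max G = rho2 m \<longleftrightarrow> G \<simeq>\<^sub>g split_graph_pendant 2 ((m + 5) div 2) 2))"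
proof -
  have wf: "pair_wf_digraph G"
    using assms(2) by (simp add: pair_graph_def pair_digraph_def pair_fin_digraph_def)
  have hub: "\<exists>f s i. hub_graph f s i G \<and> m = 1 + 2 * s + i + (if f then 1 else 0) \<and> target f i m"
    if le: "rho2 m \<le> lambda_max G"
  proof -
    obtain f s i where h: "hub_graph f s i G" "m = 1 + 2 * s + i + (if f then 1 else 0)"
      "target f i m \<or> odd m \<and> \<not> f \<and> i = 0"
      using hub_if_rho2_le[OF assms(1-5) le] by blast
    \<comment> \<open>With \<open>m = 1 + 2 * s\<close> this is the complete split graph on
      \<open>s + 2 = (m + 3) / 2\<close> vertices.\<close>
    have False if odd: "odd m" "\<not> f" "i = 0"
    proof -
      have "(m + 3) div 2 - 2 = s" using h(2) odd by simp
      then have T: "hub_graph False s 0 (split_graph ((m + 3) div 2) 2)"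
        using hub_graph_split_graph[of "(m + 3) div 2"] by simp
      then have "G \<simeq>\<^sub>g split_graph ((m + 3) div 2) 2"
        using graph_iso_hub_graph[OF wf T] h(1) odd by simp
      then show False using assms(6) odd by simp
    qed
    then show ?thesis using h by blast
  qed
  have le: "lambda_max G \<le> rho2 m"
  proof (rule ccontr)
    assume n: "\<not> lambda_max G \<le> rho2 m"
    then obtain f s i where "hub_graph f s i G" "m = 1 + 2 * s + i + (if f then 1 else 0)" "target f i m"
      using hub by (meson linear)
    then show False using hub_lambda_max[OF assms(2)] assms(1) n by (metis order_refl)
  qed
  \<comment> \<open>One equivalence serves all four ranges: \<open>target\<close> and the edge count
    determine \<open>f\<close>, \<open>i\<close> and \<open>s\<close>.\<close>
  have eq: "lambda_max G = rho2 m \<longleftrightarrow> G \<simeq>\<^sub>g T"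
    if T: "hub_graph f s i T" "m = 1 + 2 * s + i + (if f then 1 else 0)" "target f i m" for f s i
      and T :: "'b pair_pre_digraph"
  proof
    assume "lambda_max G = rho2 m"
    then obtain f' s' i' where h: "hub_graph f' s' i' G" "m = 1 + 2 * s' + i' + (if f' then 1 else 0)" "target f' i' m"
      using hub by auto
    have "f' = f" "i' = i" using h(3) T(3) by (auto simp: target_def split: if_splits)
    then have "s' = s" using h(2) T(2) by simp
    then show "G \<simeq>\<^sub>g T" using h(1) \<open>f' = f\<close> \<open>i' = i\<close> graph_iso_hub_graph[OF wf T(1)] by simp
  next
    assume "G \<simeq>\<^sub>g T"
    then have "hub_graph f s i G" using graph_iso_hub_graph[OF wf T(1)] by simp
    then show "lambda_max G = rho2 m" using hub_lambda_max[OF assms(2) _ T(2,3) assms(1)] by simp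
  qed
  have "lambda_max G = rho2 m \<longleftrightarrow> G \<simeq>\<^sub>g join_graph (complete_graph 1) (star_matching (m div 2) 1)"
    if "even m" "m \<le> 72"
    by (rule eq[OF hub_graph_join_star_matching]) (use that assms(1) in \<open>auto simp: target_def elim!: evenE\<close>)
  moreover have "lambda_max G = rho2 m \<longleftrightarrow> G \<simeq>\<^sub>g split_graph_pendant 1 ((m + 4) div 2) 2"
    if "even m" "m \<ge> 74"
    by (rule eq[OF hub_graph_split_graph_pendant]) (use that assms(1) in \<open>auto simp: target_def elim!: evenE\<close>)
  moreover have "lambda_max G = rho2 m \<longleftrightarrow>
      G \<simeq>\<^sub>g join_graph (complete_graph 1) (disj_union (star_matching ((m - 1) div 2) 1) (complete_graph 1))"
    if "odd m" "m \<le> 71"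
    by (rule eq[OF hub_graph_join_star_matching_isolated]) (use that assms(1) in \<open>auto simp: target_def elim!: oddE\<close>)
  moreover have "lambda_max G = rho2 m \<longleftrightarrow> G \<simeq>\<^sub>g split_graph_pendant 2 ((m + 5) div 2) 2"
    if "odd m" "m \<ge> 73"
    by (rule eq[OF hub_graph_split_graph_pendant]) (use that assms(1) in \<open>auto simp: target_def elim!: oddE\<close>)
  ultimately show ?thesis using le by blast
qed

end
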